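(* In the state-space setting (see context), let $\gamma>0$ and let $P,F_P$ and the $\gamma$-dependent matrices $U,R_Q$ be as in the context. Let $\Pi$ and $Z_\gamma$ be the solutions to the Lyapunov equations $$\Pi=F_P^\ast\Pi F_P+H^\ast(I+HPH^\ast)^{-1}H,$$ $$Z_\gamma=F_PZ_\gamma F_P^\ast+F_P(P-U)^\ast L^\ast R_Q^{-1}L(P-U)F_P^\ast.$$ Then a $\gamma$-optimal causal estimator exists (i.e. a causal linear $\mathcal K$ with $\|T_{\mathcal K}^\ast T_{\mathcal K}-T_{\mathcal K_0}^\ast T_{\mathcal K_0}\|\le\gamma^2$) if and only if $$\lambda_{\max}(Z_\gamma\Pi)\le1 .$$
   Context: State-space setting (doubly-infinite horizon, $i\in\mathbb Z$): $x_{i+1}=Fx_i+Gw_i$, $y_i=Hx_i+v_i$, $s_i=Lx_i$, with $(F,H)$ detectable and $(F,G)$ controllable on the unit circle. Let $\mathcal H,\mathcal L$ be the strictly causal block Toeplitz operators with Markov parameters $HF^{i-1}G$ and $LF^{i-1}G$ ($i>0$; zero otherwise), i.e. with transfer matrices $H(z)=H(zI-F)^{-1}G$, $L(z)=L(zI-F)^{-1}G$. A linear estimator $\hat{\mathbf s}=\mathcal K\mathbf y$ has error operator $T_{\mathcal K}=\begin{pmatrix}\mathcal L-\mathcal K\mathcal H&-\mathcal K\end{pmatrix}$ acting on $(\mathbf w,\mathbf v)$; $\mathcal K_0=\mathcal L\mathcal H^\ast(I+\mathcal H\mathcal H^\ast)^{-1}$ is the optimal non-causal estimator. $\|\cdot\|$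 is the $\ell_2$-induced operator norm (for time-invariant operators: the maximum over $|z|=1$ of the largest singular value of the transfer matrix). A causal estimator is a causal (lower triangular) linear $\mathcal K$, i.e. $\hat s_i$ depends only on $y_j$, $j\le i$. $^\ast$ is conjugate transpose; $\lambda_{\max}(X)$ is the maximal eigenvalue of a matrix with real eigenvalues. Riccati/Lyapunov data: $P$ is the stabilizing solution of $P=GG^\ast+FPF^\ast-FPH^\ast(I+HPH^\ast)^{-1}HPF^\ast$, with $K_P=FPH^\ast(I+HPH^\ast)^{-1}$, $F_P=F-K_PH$. For given $\gamma>0$, $W$ and $Q$ are the stabilizing solutions (i.e. $F_W$, resp. $F_Q$, has all eigenvalues in the open unit disk) of $$W=H^\ast H+\gamma^{-2}L^\ast L+F^\ast WF-K_W^\ast R_WK_W,\quad Q=-GR_W^{-1}G^\ast+F_WQF_W^\ast-K_QR_QK_Q^\ast,$$ where $R_W=I+G^\ast WG$, $K_W=R_W^{-1}G^\ast WF$, $F_W=F-GK_W$, $R_Q=\gamma^2I+LQL^\ast$, $K_Q=F_WQL^\ast R_Q^{-1}$, $F_Q=F_W-K_QL$. $U$ is the solution of $U=K_QLPF_P^\ast+F_QUF_P^\ast$. *)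

theory Defs
  imports "HOL-Analysis.Analysis"
begin

section \<open>Square-summable doubly-infinite sequences\<close>

typedef (overloaded) 'a ell2 =
  "{x :: int \<Rightarrow> 'a::real_inner. (\<lambda>i. (norm (x i))\<^sup>2) summable_on UNIV}"
  by (rule exI[of _ "\<lambda>_. 0"]) simp

setup_lifting type_definition_ell2

lemma ell2_inner_summable:
  fixes x y :: "int \<Rightarrow> 'a::real_inner"
  assumes "(\<lambda>i. (norm (x i))\<^sup>2) summable_on UNIV" "(\<lambda>i. (norm (y i))\<^sup>2) summable_on UNIV"
  shows "(\<lambda>i. x i \<bullet> y i) summable_on UNIV"
proof -
  have s: "(\<lambda>i. (norm (x i))\<^sup>2 + (norm (y i))\<^sup>2) summable_on UNIV"
    by (rule summable_on_add[OF assms])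
  have "norm (x i \<bullet> y i) \<le> (norm (x i))\<^sup>2 + (norm (y i))\<^sup>2" for i
  proof -
    have "norm (x i \<bullet> y i) \<le> norm (x i) * norm (y i)"
      by (simp add: Cauchy_Schwarz_ineq2)
    moreover have "2 * (norm (x i) * norm (y i)) \<le> (norm (x i))\<^sup>2 + (norm (y i))\<^sup>2"
      using sum_squares_bound[of "norm (x i)" "norm (y i)"] by (simp add: mult.assoc)
    moreover have "0 \<le> norm (x i) * norm (y i)"
      by simp
    ultimately show ?thesis by linarith
  qed
  then have "(\<lambda>i. norm (x i \<bullet> y i)) summable_on UNIV"
    by (intro summable_on_comparison_test[OF s]) auto
  then show ?thesis
    by (rule abs_summable_summable)
qed

lemma ell2_add_closed:
  fixes x y :: "int \<Rightarrow> 'a::real_inner"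
  assumes "(\<lambda>i. (norm (x i))\<^sup>2) summable_on UNIV" "(\<lambda>i. (norm (y i))\<^sup>2) summable_on UNIV"
  shows "(\<lambda>i. (norm (x i + y i))\<^sup>2) summable_on UNIV"
proof -
  have "(norm (x i + y i))\<^sup>2 = (norm (x i))\<^sup>2 + (norm (y i))\<^sup>2 + 2 * (x i \<bullet> y i)" for i
    by (simp add: power2_norm_eq_inner inner_add_left inner_add_right inner_commute)
  then show ?thesis
    using summable_on_add[OF summable_on_add[OF assms]
        summable_on_cmult_right[OF ell2_inner_summable[OF assms], of 2]]
    by simp
qed

lemma ell2_scaleR_closed:
  fixes x :: "int \<Rightarrow> 'a::real_inner"
  assumes "(\<lambda>i. (norm (x i))\<^sup>2) summable_on UNIV"
  shows "(\<lambda>i. (norm (r *\<^sub>R x i))\<^sup>2) summable_on UNIV"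
  using summable_on_cmult_right[OF assms, of "r\<^sup>2"] by (simp add: power_mult_distrib)

instantiation ell2 :: (real_inner) real_vector
begin

lift_definition zero_ell2 :: "'a ell2" is "\<lambda>_. 0"
  by simp

lift_definition plus_ell2 :: "'a ell2 \<Rightarrow> 'a ell2 \<Rightarrow> 'a ell2" is "\<lambda>x y i. x i + y i"
  by (rule ell2_add_closed)

lift_definition uminus_ell2 :: "'a ell2 \<Rightarrow> 'a ell2" is "\<lambda>x i. - x i"
  by simp

lift_definition minus_ell2 :: "'a ell2 \<Rightarrow> 'a ell2 \<Rightarrow> 'a ell2" is "\<lambda>x y i. x i - y i"
  using ell2_add_closed[of _ "\<lambda>i. - _ i"] by simp

lift_definition scaleR_ell2 :: "real \<Rightarrow> 'a ell2 \<Rightarrow> 'a ell2" is "\<lambda>r x i. r *\<^sub>R x i"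
  by (rule ell2_scaleR_closed)

instance
  by standard (transfer; simp add: fun_eq_iff algebra_simps)+

end

instantiation ell2 :: (real_inner) real_inner
begin

lift_definition inner_ell2 :: "'a ell2 \<Rightarrow> 'a ell2 \<Rightarrow> real" is
  "\<lambda>x y. \<Sum>\<^sub>\<infinity>i. x i \<bullet> y i" .

definition norm_ell2 :: "'a ell2 \<Rightarrow> real" where
  "norm_ell2 x = sqrt (x \<bullet> x)"

definition sgn_ell2 :: "'a ell2 \<Rightarrow> 'a ell2" where
  "sgn_ell2 x = x /\<^sub>R norm x"

definition dist_ell2 :: "'a ell2 \<Rightarrow> 'a ell2 \<Rightarrow> real" where
  "dist_ell2 x y = norm (x - y)"

definition uniformity_ell2 :: "('a ell2 \<times> 'a ell2) filter" where
  "uniformity_ell2 = (INF e\<in>{0<..}. principal {(x, y). dist x y < e})"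

definition open_ell2 :: "'a ell2 set \<Rightarrow> bool" where
  "open_ell2 S \<longleftrightarrow> (\<forall>x\<in>S. \<forall>\<^sub>F (x', y) in uniformity. x' = x \<longrightarrow> y \<in> S)"

instance
proof
  fix x y z :: "'a ell2" and r :: real
  show "x \<bullet> y = y \<bullet> x"
    by transfer (simp add: inner_commute)
  show "(x + y) \<bullet> z = x \<bullet> z + y \<bullet> z"
    by transfer (simp add: inner_add_left infsum_add ell2_inner_summable)
  show "(r *\<^sub>R x) \<bullet> y = r * (x \<bullet> y)"
    by transfer (simp add: infsum_cmult_right')
  show "0 \<le> x \<bullet> x"
    by transfer (simp add: infsum_nonneg)
  show "x \<bullet> x = 0 \<longleftrightarrow> x = 0"
  proof transfer
    fix x :: "int \<Rightarrow> 'a"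
    assume x: "(\<lambda>i. (norm (x i))\<^sup>2) summable_on UNIV"
    show "(\<Sum>\<^sub>\<infinity>i. x i \<bullet> x i) = 0 \<longleftrightarrow> x = (\<lambda>_. 0)"
    proof
      assume "(\<Sum>\<^sub>\<infinity>i. x i \<bullet> x i) = 0"
      then have "x i \<bullet> x i = 0" for i
        by (intro nonneg_infsum_le_0D[of "\<lambda>i. x i \<bullet> x i" UNIV] ell2_inner_summable[OF x x]) auto
      then show "x = (\<lambda>_. 0)"
        by auto
    qed simp
  qed
qed (simp_all add: norm_ell2_def sgn_ell2_def dist_ell2_def uniformity_ell2_def open_ell2_def)

end

section \<open>Matrices\<close>

definition cadj :: "complex^'n^'m \<Rightarrow> complex^'m^'n" (\<open>_\<^sup>\<dagger>\<close> [1000] 1000) where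
  "A\<^sup>\<dagger> = (\<chi> i j. cnj (A $ j $ i))"

text \<open>The power of the ring class would multiply entrywise on this type.\<close>

definition mpow :: "complex^'n^'n \<Rightarrow> nat \<Rightarrow> complex^'n^'n" where
  "mpow A k = ((\<lambda>X. A ** X) ^^ k) (mat 1)"

definition block_row :: "complex^'a^'q \<Rightarrow> complex^'b^'q \<Rightarrow> complex^('a + 'b)^'q" where
  "block_row A B = (\<chi> i j. case j of Inl a \<Rightarrow> A $ i $ a | Inr b \<Rightarrow> B $ i $ b)"

definition hermitian :: "complex^'n^'n \<Rightarrow> bool" where
  "hermitian A \<longleftrightarrow> A\<^sup>\<dagger> = A"

definition eigenval :: "complex^'n^'n \<Rightarrow> complex \<Rightarrow> bool" where
  "eigenval A \<mu> \<longleftrightarrow> (\<exists>v. v \<noteq> 0 \<and> A *v v = \<mu> *s v)"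

definition stable :: "complex^'n^'n \<Rightarrow> bool" where
  "stable A \<longleftrightarrow> (\<forall>\<mu>. eigenval A \<mu> \<longrightarrow> norm \<mu> < 1)"

text \<open>For a matrix all of whose eigenvalues are real, this is the largest one.\<close>

definition lambda_max :: "complex^'n^'n \<Rightarrow> real" where
  "lambda_max A = Max {t :: real. eigenval A (complex_of_real t)}"

definition detectable :: "complex^'n^'n \<Rightarrow> complex^'n^'p \<Rightarrow> bool" where
  "detectable F H \<longleftrightarrow> (\<exists>K :: complex^'p^'n. stable (F - K ** H))"

definition controllable_on_circle :: "complex^'n^'n \<Rightarrow> complex^'m^'n \<Rightarrow> bool" where
  "controllable_on_circle F G \<longleftrightarrow>
     (\<forall>z. norm z = 1 \<longrightarrow> rank (block_row (mat z - F) G) = CARD('n))"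

section \<open>Block operators on sequences\<close>

text \<open>A doubly-infinite block matrix is a function \<open>M\<close> with block \<open>M i j\<close> in row \<open>i\<close>, column
  \<open>j\<close>. The value of \<open>block_op M\<close> is meaningful when \<open>M\<close> is \<open>block_bounded\<close>, that is,
  when it defines a bounded operator between the two sequence spaces.\<close>

definition block_apply ::
    "(int \<Rightarrow> int \<Rightarrow> complex^'d^'q) \<Rightarrow> (complex^'d) ell2 \<Rightarrow> int \<Rightarrow> complex^'q" where
  "block_apply M d i = (\<Sum>\<^sub>\<infinity>j. M i j *v Rep_ell2 d j)"

definition block_op ::
    "(int \<Rightarrow> int \<Rightarrow> complex^'d^'q) \<Rightarrow> (complex^'d) ell2 \<Rightarrow> (complex^'q) ell2" where
  "block_op M d = Abs_ell2 (block_apply M d)"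

definition block_bounded :: "(int \<Rightarrow> int \<Rightarrow> complex^'d^'q) \<Rightarrow> bool" where
  "block_bounded M \<longleftrightarrow>
     (\<forall>d i. (\<lambda>j. M i j *v Rep_ell2 d j) summable_on UNIV) \<and>
     (\<forall>d. (\<lambda>i. (norm (block_apply M d i))\<^sup>2) summable_on UNIV) \<and>
     bounded_linear (block_op M)"

definition causal :: "(int \<Rightarrow> int \<Rightarrow> complex^'p^'q) \<Rightarrow> bool" where
  "causal M \<longleftrightarrow> (\<forall>i j. i < j \<longrightarrow> M i j = 0)"

text \<open>Product of two causal block matrices. The blocks with \<open>k\<close> outside \<open>{j..i}\<close> vanish, so
  no convergence is involved, whether or not the factors are bounded.\<close>

definition causal_prod ::
    "(int \<Rightarrow> int \<Rightarrow> complex^'p^'q) \<Rightarrow> (int \<Rightarrow> int \<Rightarrow> complex^'m^'p) \<Rightarrow>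
     (int \<Rightarrow> int \<Rightarrow> complex^'m^'q)" where
  "causal_prod A B i j = (\<Sum>k\<in>{j..i}. A i k ** B k j)"

text \<open>The block Laurent matrix of a symbol \<open>\<Phi>(z) = \<Sum>k. \<Phi>\<^sub>k z\<^sup>-\<^sup>k\<close> on the unit circle. Its
  \<open>(i, j)\<close> block is \<open>\<Phi>\<^sub>k\<close> with \<open>k = i - j\<close>.\<close>

definition laurent :: "(complex \<Rightarrow> complex^'d^'q) \<Rightarrow> int \<Rightarrow> int \<Rightarrow> complex^'d^'q" where
  "laurent \<Phi> i j =
     (\<chi> a b. integral {-pi..pi} (\<lambda>t. cis (of_int (i - j) * t) * \<Phi> (cis t) $ a $ b) / (2 * of_real pi))"

section \<open>The estimation problem\<close>

text \<open>The operator with Markov parameters \<open>C F\<^sup>k\<^sup>-\<^sup>1 G\<close>, \<open>k > 0\<close>, and its transfer matrix;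
  used with \<open>C = H\<close> and \<open>C = L\<close>.\<close>

definition plant ::
    "complex^'n^'n \<Rightarrow> complex^'m^'n \<Rightarrow> complex^'n^'r \<Rightarrow> int \<Rightarrow> int \<Rightarrow> complex^'m^'r" where
  "plant F G C i j = (if j < i then C ** mpow F (nat (i - j - 1)) ** G else 0)"

definition transfer_matrix ::
    "complex^'n^'n \<Rightarrow> complex^'m^'n \<Rightarrow> complex^'n^'r \<Rightarrow> complex \<Rightarrow> complex^'m^'r" where
  "transfer_matrix F G C z = C ** matrix_inv (mat z - F) ** G"

text \<open>The error operator of a causal estimator \<open>K\<close>. An index of type \<open>'m + 'p\<close> stacks the
  disturbances \<open>w\<close> and \<open>v\<close>.\<close>

definition error_matrix ::
    "complex^'n^'n \<Rightarrow> complex^'m^'n \<Rightarrow> complex^'n^'p \<Rightarrow> complex^'n^'q \<Rightarrow>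
     (int \<Rightarrow> int \<Rightarrow> complex^'p^'q) \<Rightarrow> int \<Rightarrow> int \<Rightarrow> complex^('m + 'p)^'q" where
  "error_matrix F G H L K i j =
     block_row (plant F G L i j - causal_prod K (plant F G H) i j) (- K i j)"

text \<open>The optimal non-causal estimator and its error operator are given by their transfer
  matrices on the unit circle. This also covers unstable \<open>F\<close>, where the causal block matrices
  \<open>plant F G H\<close> and \<open>plant F G L\<close> are unbounded. If \<open>F\<close> has an eigenvalue \<open>z\<close> with
  \<open>norm z = 1\<close>, the symbol has an arbitrary value there, which does not affect
  \<open>laurent\<close>.\<close>

definition noncausal_estimator ::
    "complex^'n^'n \<Rightarrow> complex^'m^'n \<Rightarrow> complex^'n^'p \<Rightarrow> complex^'n^'q \<Rightarrow>
     complex \<Rightarrow> complex^'p^'q" where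
  "noncausal_estimator F G H L z =
     (let Hz = transfer_matrix F G H z; Lz = transfer_matrix F G L z
      in Lz ** Hz\<^sup>\<dagger> ** matrix_inv (mat 1 + Hz ** Hz\<^sup>\<dagger>))"

definition noncausal_error_matrix ::
    "complex^'n^'n \<Rightarrow> complex^'m^'n \<Rightarrow> complex^'n^'p \<Rightarrow> complex^'n^'q \<Rightarrow>
     int \<Rightarrow> int \<Rightarrow> complex^('m + 'p)^'q" where
  "noncausal_error_matrix F G H L =
     laurent (\<lambda>z. block_row
       (transfer_matrix F G L z - noncausal_estimator F G H L z ** transfer_matrix F G H z)
       (- noncausal_estimator F G H L z))"

text \<open>The constant \<^const>\<open>adjoint\<close> refers to the real inner product, which on \<open>(complex^'d) ell2\<close>
  is the real part of the complex one. For bounded complex-linear operators, such as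
  those given by block matrices, it is the usual Hilbert space adjoint.\<close>

definition regret_operator ::
    "complex^'n^'n \<Rightarrow> complex^'m^'n \<Rightarrow> complex^'n^'p \<Rightarrow> complex^'n^'q \<Rightarrow>
     (int \<Rightarrow> int \<Rightarrow> complex^'p^'q) \<Rightarrow>
     (complex^('m + 'p)) ell2 \<Rightarrow> (complex^('m + 'p)) ell2" where
  "regret_operator F G H L K =
     (let T = block_op (error_matrix F G H L K);
          T\<^sub>0 = block_op (noncausal_error_matrix F G H L)
      in (\<lambda>d. adjoint T (T d) - adjoint T\<^sub>0 (T\<^sub>0 d)))"

definition gamma_optimal ::
    "complex^'n^'n \<Rightarrow> complex^'m^'n \<Rightarrow> complex^'n^'p \<Rightarrow> complex^'n^'q \<Rightarrow> real \<Rightarrow>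
     (int \<Rightarrow> int \<Rightarrow> complex^'p^'q) \<Rightarrow> bool" where
  "gamma_optimal F G H L \<gamma> K \<longleftrightarrow>
     causal K \<and> block_bounded (error_matrix F G H L K) \<and>
     onorm (regret_operator F G H L K) \<le> \<gamma>\<^sup>2"

section \<open>Riccati equations\<close>

definition R_P :: "complex^'n^'p \<Rightarrow> complex^'n^'n \<Rightarrow> complex^'p^'p" where
  "R_P H P = mat 1 + H ** P ** H\<^sup>\<dagger>"

definition K_P :: "complex^'n^'n \<Rightarrow> complex^'n^'p \<Rightarrow> complex^'n^'n \<Rightarrow> complex^'p^'n" where
  "K_P F H P = F ** P ** H\<^sup>\<dagger> ** matrix_inv (R_P H P)"

definition F_P :: "complex^'n^'n \<Rightarrow> complex^'n^'p \<Rightarrow> complex^'n^'n \<Rightarrow> complex^'n^'n" where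
  "F_P F H P = F - K_P F H P ** H"

definition stabilizing_P ::
    "complex^'n^'n \<Rightarrow> complex^'m^'n \<Rightarrow> complex^'n^'p \<Rightarrow> complex^'n^'n \<Rightarrow> bool" where
  "stabilizing_P F G H P \<longleftrightarrow>
     hermitian P \<and> invertible (R_P H P) \<and>
     P = G ** G\<^sup>\<dagger> + F ** P ** F\<^sup>\<dagger>
         - F ** P ** H\<^sup>\<dagger> ** matrix_inv (R_P H P) ** H ** P ** F\<^sup>\<dagger> \<and>
     stable (F_P F H P)"

definition R_W :: "complex^'m^'n \<Rightarrow> complex^'n^'n \<Rightarrow> complex^'m^'m" where
  "R_W G W = mat 1 + G\<^sup>\<dagger> ** W ** G"

definition K_W :: "complex^'n^'n \<Rightarrow> complex^'m^'n \<Rightarrow> complex^'n^'n \<Rightarrow> complex^'n^'m" where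
  "K_W F G W = matrix_inv (R_W G W) ** G\<^sup>\<dagger> ** W ** F"

definition F_W :: "complex^'n^'n \<Rightarrow> complex^'m^'n \<Rightarrow> complex^'n^'n \<Rightarrow> complex^'n^'n" where
  "F_W F G W = F - G ** K_W F G W"

definition stabilizing_W ::
    "complex^'n^'n \<Rightarrow> complex^'m^'n \<Rightarrow> complex^'n^'p \<Rightarrow> complex^'n^'q \<Rightarrow> real \<Rightarrow>
     complex^'n^'n \<Rightarrow> bool" where
  "stabilizing_W F G H L \<gamma> W \<longleftrightarrow>
     hermitian W \<and> invertible (R_W G W) \<and>
     W = H\<^sup>\<dagger> ** H + (1 / \<gamma>\<^sup>2) *\<^sub>R (L\<^sup>\<dagger> ** L) + F\<^sup>\<dagger> ** W ** F
         - (K_W F G W)\<^sup>\<dagger> ** R_W G W ** K_W F G W \<and>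
     stable (F_W F G W)"

definition R_Q :: "complex^'n^'q \<Rightarrow> real \<Rightarrow> complex^'n^'n \<Rightarrow> complex^'q^'q" where
  "R_Q L \<gamma> Q = \<gamma>\<^sup>2 *\<^sub>R mat 1 + L ** Q ** L\<^sup>\<dagger>"

definition K_Q ::
    "complex^'n^'n \<Rightarrow> complex^'m^'n \<Rightarrow> complex^'n^'q \<Rightarrow> real \<Rightarrow> complex^'n^'n \<Rightarrow>
     complex^'n^'n \<Rightarrow> complex^'q^'n" where
  "K_Q F G L \<gamma> W Q = F_W F G W ** Q ** L\<^sup>\<dagger> ** matrix_inv (R_Q L \<gamma> Q)"

definition F_Q ::
    "complex^'n^'n \<Rightarrow> complex^'m^'n \<Rightarrow> complex^'n^'q \<Rightarrow> real \<Rightarrow> complex^'n^'n \<Rightarrow>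
     complex^'n^'n \<Rightarrow> complex^'n^'n" where
  "F_Q F G L \<gamma> W Q = F_W F G W - K_Q F G L \<gamma> W Q ** L"

definition stabilizing_Q ::
    "complex^'n^'n \<Rightarrow> complex^'m^'n \<Rightarrow> complex^'n^'q \<Rightarrow> real \<Rightarrow> complex^'n^'n \<Rightarrow>
     complex^'n^'n \<Rightarrow> bool" where
  "stabilizing_Q F G L \<gamma> W Q \<longleftrightarrow>
     hermitian Q \<and> invertible (R_Q L \<gamma> Q) \<and>
     Q = - (G ** matrix_inv (R_W G W) ** G\<^sup>\<dagger>) + F_W F G W ** Q ** (F_W F G W)\<^sup>\<dagger>
         - K_Q F G L \<gamma> W Q ** R_Q L \<gamma> Q ** (K_Q F G L \<gamma> W Q)\<^sup>\<dagger> \<and>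
     stable (F_Q F G L \<gamma> W Q)"

end

theory Submission
  imports Defs "HOL-Computational_Algebra.Fundamental_Theorem_Algebra"
begin

text \<open>
  The disturbances \<open>d = (w, v)\<close> split orthogonally into the trajectories with zero output, on which
  every bounded error operator acts as \<open>d \<mapsto> L x\<close>, and the range of the adjoint of the normalized Kalman
  innovation map; the latter is parametrized isometrically by innovations \<open>\<nu>\<close>, and the noncausal error
  vanishes on it. If \<open>f\<close> is the error caused by \<open>\<nu>\<close>, then \<open>\<gamma>\<close>-optimality says that
  \<open>\<parallel>L x + f\<parallel>\<^sup>2 - \<parallel>L x\<parallel>\<^sup>2\<close> is at most \<open>\<gamma>\<^sup>2\<close> times the energy of \<open>d\<close>, for all output-nulling \<open>x\<close> and all \<open>\<nu>\<close>.
  Completing squares with \<open>W\<close> and \<open>Q\<close> eliminates \<open>x\<close> and leaves a Nehari problem: approximate an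
  anticausal filter of \<open>\<nu>\<close> by a causal one with error norm at most 1. The equation for \<open>U\<close> extracts the
  anticausal filter, and \<open>Z\<close> and \<open>\<Pi>\<close> are the Gramians of its Hankel operator, whose squared norm is
  the largest eigenvalue of \<open>Z \<Pi>\<close>. Necessity follows by testing with future innovations and looking at past errors.
  For sufficiency the coefficients of the causal filter are chosen one by one, each by extending a
  contraction from a subspace (Parrott's theorem). Energy identities are weighted throughout, so that no matrix
  square roots are needed.
\<close>

section \<open>Matrices\<close>

text \<open>The obstacle is that \<open>F\<close> may be unstable. The plant matrices are then
  unbounded, and the error of an estimator cannot be computed by composing bounded operators.
  Square-summable states are therefore produced by resolvents of the stable matrices
  \<open>F_P\<close>, \<open>F_W\<close>, \<open>F_Q\<close> and their adjoints, while block
  matrices are evaluated on inputs with a starting time, where every sum is finite; rest before that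
  time identifies the two pictures, and density finishes. Since an estimator need not be time
  invariant, necessity is argued in the time domain; symbols enter only to identify the noncausal
  error operator with a state-space smoothing error. The weights \<open>R_P\<close>,
  \<open>R_W\<close>, \<open>R_Q\<close> come merely invertible, and their definiteness is read off
  from the energy identities. The operator norm demands a two-sided bound; for the constructed
  estimator the lower side follows from the upper one because an output-nulling trajectory can be
  negated. Inner products are real throughout, so an extended contraction is only real-linear and is
  averaged into a complex matrix.\<close>

lemma matrix_mult_uminus_left: "(- A) ** B = - (A ** B)"
  for A :: "'a::comm_ring_1^'n^'m"
  by (simp add: matrix_matrix_mult_def vec_eq_iff sum_negf)

lemma matrix_mult_uminus_right: "A ** (- B) = - (A ** B)"
  for A :: "'a::comm_ring_1^'n^'m"
  by (simp add: matrix_matrix_mult_def vec_eq_iff sum_negf)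

lemma matrix_diff_ldistrib: "A ** (B - C) = A ** B - A ** C"
  for A :: "'a::comm_ring_1^'n^'m"
  by (simp add: matrix_matrix_mult_def vec_eq_iff sum_subtractf right_diff_distrib)

lemma matrix_diff_rdistrib: "(B - C) ** A = B ** A - C ** A"
  for A :: "'a::comm_ring_1^'n^'m"
  by (simp add: matrix_matrix_mult_def vec_eq_iff sum_subtractf left_diff_distrib)

lemma matrix_zero_left: "0 ** A = 0"
  for A :: "'a::comm_ring_1^'n^'m"
  by (simp add: matrix_matrix_mult_def vec_eq_iff)

lemma matrix_zero_right: "A ** 0 = 0"
  for A :: "'a::comm_ring_1^'n^'m"
  by (simp add: matrix_matrix_mult_def vec_eq_iff)

lemma matrix_add_rdistrib': "(B + C) ** A = B ** A + C ** A"
  for A :: "'a::comm_ring_1^'n^'m"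
  by (simp add: matrix_matrix_mult_def vec_eq_iff sum.distrib distrib_right)

lemma matrix_scaleR_left: "(r *\<^sub>R A) ** B = r *\<^sub>R (A ** B)"
  for A :: "complex^'n^'m"
  by (simp add: matrix_matrix_mult_def vec_eq_iff scaleR_sum_right)

lemma matrix_scaleR_right: "A ** (r *\<^sub>R B) = r *\<^sub>R (A ** B)"
  for A :: "complex^'n^'m"
  by (simp add: matrix_matrix_mult_def vec_eq_iff scaleR_sum_right)

lemmas matrix_algebra = matrix_mult_uminus_left matrix_mult_uminus_right matrix_diff_ldistrib
  matrix_diff_rdistrib matrix_add_ldistrib matrix_add_rdistrib' matrix_mul_assoc
  matrix_zero_left matrix_zero_right matrix_scaleR_left matrix_scaleR_right

lemma cadj_cadj [simp]: "(A\<^sup>\<dagger>)\<^sup>\<dagger> = A"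
  by (simp add: cadj_def vec_eq_iff)

lemma cadj_mult: "(A ** B)\<^sup>\<dagger> = B\<^sup>\<dagger> ** A\<^sup>\<dagger>"
  by (simp add: cadj_def vec_eq_iff matrix_matrix_mult_def mult.commute)

lemma cadj_add: "(A + B)\<^sup>\<dagger> = A\<^sup>\<dagger> + B\<^sup>\<dagger>"
  and cadj_diff: "(A - B)\<^sup>\<dagger> = A\<^sup>\<dagger> - B\<^sup>\<dagger>"
  and cadj_uminus: "(- A)\<^sup>\<dagger> = - A\<^sup>\<dagger>"
  and cadj_scaleR: "(r *\<^sub>R A)\<^sup>\<dagger> = r *\<^sub>R A\<^sup>\<dagger>"
  by (simp_all add: cadj_def vec_eq_iff)

lemma cadj_mat [simp]: "(mat c)\<^sup>\<dagger> = mat (cnj c)"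
  by (simp add: cadj_def vec_eq_iff mat_def)

lemma inner_matrix_vector: "(A *v x) \<bullet> y = x \<bullet> (A\<^sup>\<dagger> *v y)"
  for A :: "complex^'n^'m"
proof -
  have c: "u \<bullet> v = Re (u * cnj v)" for u v :: complex
    by (simp add: inner_complex_def)
  have "(A *v x) \<bullet> y = (\<Sum>i\<in>UNIV. \<Sum>j\<in>UNIV. (A$i$j * x$j) \<bullet> (y$i))"
    by (simp add: inner_vec_def matrix_vector_mult_def inner_sum_left)
  also have "\<dots> = (\<Sum>j\<in>UNIV. \<Sum>i\<in>UNIV. (A$i$j * x$j) \<bullet> (y$i))"
    by (rule sum.swap)
  also have "\<dots> = (\<Sum>j\<in>UNIV. \<Sum>i\<in>UNIV. x$j \<bullet> (cnj (A$i$j) * y$i))"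
    unfolding c by (simp add: mult_ac)
  also have "\<dots> = x \<bullet> (A\<^sup>\<dagger> *v y)"
    by (simp add: inner_vec_def matrix_vector_mult_def inner_sum_right cadj_def)
  finally show ?thesis .
qed

lemma matrix_vector_scaleR: "(r *\<^sub>R A) *v x = r *\<^sub>R (A *v x)" "A *v (r *\<^sub>R x) = r *\<^sub>R (A *v x)"
  for A :: "complex^'n^'m"
  by (simp_all add: matrix_vector_mult_def vec_eq_iff scaleR_sum_right)

lemma matrix_vector_uminus: "(- A) *v x = - (A *v x)" "A *v (- x) = - (A *v x)"
  for A :: "complex^'n^'m"
  by (simp_all add: matrix_vector_mult_def vec_eq_iff sum_negf)

lemma bounded_linear_matrix_vector: "bounded_linear ((*v) A)" for A :: "complex^'n^'m"
  by (rule linear_conv_bounded_linear[THEN iffD1])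
     (auto intro!: linearI simp: matrix_vector_right_distrib matrix_vector_scaleR)

lemma norm_matrix_vector_le: "norm (A *v x) \<le> norm A * norm x" for A :: "complex^'n^'m"
proof -
  have "norm ((A *v x) $ i) \<le> norm (A $ i) * norm x" for i
  proof -
    have "norm ((A *v x) $ i) \<le> (\<Sum>j\<in>UNIV. norm (A $ i $ j) * norm (x $ j))"
      unfolding matrix_vector_mult_def by (auto intro!: sum_norm_le simp: norm_mult)
    also have "\<dots> \<le> norm (A $ i) * norm x"
      unfolding norm_vec_def
      using L2_set_mult_ineq[of "\<lambda>j. cmod (A $ i $ j)" "\<lambda>j. cmod (x $ j)" UNIV] by simp
    finally show ?thesis .
  qed
  then have "norm (A *v x) \<le> L2_set (\<lambda>i. norm (A $ i) * norm x) UNIV"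
    unfolding norm_vec_def[of "A *v x"] by (intro L2_set_mono) auto
  also have "\<dots> = norm A * norm x"
    by (simp add: norm_vec_def[of A] L2_set_left_distrib)
  finally show ?thesis .
qed

lemma norm_cadj [simp]: "norm (A\<^sup>\<dagger>) = norm A" for A :: "complex^'n^'m"
proof -
  have "(norm (A\<^sup>\<dagger>))\<^sup>2 = (\<Sum>i\<in>UNIV. \<Sum>j\<in>UNIV. (norm (A $ j $ i))\<^sup>2)"
    by (simp add: norm_vec_def L2_set_def cadj_def sum_nonneg)
  also have "\<dots> = (\<Sum>j\<in>UNIV. \<Sum>i\<in>UNIV. (norm (A $ j $ i))\<^sup>2)"
    by (rule sum.swap)
  also have "\<dots> = (norm A)\<^sup>2"
    by (simp add: norm_vec_def L2_set_def sum_nonneg)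
  finally show ?thesis
    by simp
qed

lemma matrix_inv_right_left:
  fixes A :: "complex^'n^'n"
  assumes "invertible A"
  shows "A ** matrix_inv A = mat 1" "matrix_inv A ** A = mat 1"
  using someI_ex[OF assms[unfolded invertible_def]] by (auto simp: matrix_inv_def)

lemma matrix_inv_eqI:
  fixes A :: "complex^'n^'n"
  assumes "A ** B = mat 1"
  shows "matrix_inv A = B" "invertible A"
proof -
  have "B ** A = mat 1"
    using assms matrix_left_right_inverse by blast
  then show i: "invertible A"
    using assms invertible_def by blast
  have "matrix_inv A = matrix_inv A ** (A ** B)"
    using assms by simp
  then show "matrix_inv A = B"
    by (simp add: matrix_mul_assoc matrix_inv_right_left[OF i])
qed

lemma hermitian_matrix_inv:
  fixes A :: "complex^'n^'n"
  assumes "hermitian A" "invertible A"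
  shows "hermitian (matrix_inv A)"
proof -
  have "(matrix_inv A ** A)\<^sup>\<dagger> = mat 1"
    by (simp add: matrix_inv_right_left[OF assms(2)])
  then have "A ** (matrix_inv A)\<^sup>\<dagger> = mat 1"
    using assms(1) by (simp add: cadj_mult hermitian_def)
  then show ?thesis
    using matrix_inv_eqI(1)[of A "(matrix_inv A)\<^sup>\<dagger>"] by (simp add: hermitian_def)
qed

section \<open>Positive semidefinite matrices and coercivity\<close>

definition psd :: "complex^'n^'n \<Rightarrow> bool" where
  "psd A \<longleftrightarrow> hermitian A \<and> (\<forall>x. 0 \<le> x \<bullet> (A *v x))"

definition posdef :: "complex^'n^'n \<Rightarrow> bool" where
  "posdef A \<longleftrightarrow> psd A \<and> invertible A"

lemma hermitian_inner: "hermitian A \<Longrightarrow> x \<bullet> (A *v y) = y \<bullet> (A *v x)"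
  by (metis hermitian_def inner_commute inner_matrix_vector)

lemma psdI: "hermitian A \<Longrightarrow> (\<And>x. 0 \<le> x \<bullet> (A *v x)) \<Longrightarrow> psd A"
  by (simp add: psd_def)

lemma psd_nonneg: "psd A \<Longrightarrow> 0 \<le> x \<bullet> (A *v x)"
  by (simp add: psd_def)

lemma psd_hermitian: "psd A \<Longrightarrow> hermitian A"
  by (simp add: psd_def)

text \<open>Along \<open>x + t A x\<close> the form is a nonnegative quadratic in \<open>t\<close>
  with zero constant term, so its linear coefficient, twice the squared norm of \<open>A x\<close>,
  must vanish.\<close>

lemma psd_kernel:
  assumes "psd A" "x \<bullet> (A *v x) \<le> 0"
  shows "A *v x = 0"
proof -
  let ?y = "A *v x"
  have h: "hermitian A" and x0: "x \<bullet> (A *v x) = 0"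
    using assms psd_nonneg[OF assms(1), of x] by (auto simp: psd_def)
  have q: "0 \<le> t * t * (?y \<bullet> (A *v ?y)) + 2 * t * (?y \<bullet> ?y)" for t :: real
  proof -
    have "0 \<le> (x + t *\<^sub>R ?y) \<bullet> (A *v (x + t *\<^sub>R ?y))"
      using assms(1) psd_nonneg by blast
    also have "\<dots> = t * t * (?y \<bullet> (A *v ?y)) + 2 * t * (?y \<bullet> ?y)"
      using x0 hermitian_inner[OF h, of x ?y]
      by (simp add: matrix_vector_right_distrib matrix_vector_scaleR inner_add_left inner_add_right algebra_simps)
    finally show ?thesis .
  qed
  have "?y \<bullet> ?y = 0"
  proof (rule ccontr)
    assume "?y \<bullet> ?y \<noteq> 0"
    then have p: "?y \<bullet> ?y > 0"
      by (metis inner_ge_zero less_eq_real_def)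
    define c where "c = ?y \<bullet> (A *v ?y)"
    have c: "c \<ge> 0"
      using assms(1) psd_nonneg by (auto simp: c_def)
    \<comment> \<open>Negative, so that the linear term wins; adding 1 keeps the denominator
      positive when \<open>c = 0\<close>.\<close>
    define t where "t = - (?y \<bullet> ?y) / (c + 1)"
    have tc: "t * (c + 1) = - (?y \<bullet> ?y)"
      using c by (simp add: t_def)
    have t: "t < 0"
      unfolding t_def using p c by (simp add: divide_neg_pos)
    have "t * t * c + 2 * t * (?y \<bullet> ?y) = t * (t * c + 2 * (?y \<bullet> ?y))"
      by (simp add: algebra_simps)
    also have "t * c + 2 * (?y \<bullet> ?y) = (?y \<bullet> ?y) - t"
      using tc by (simp add: algebra_simps)
    finally have "t * t * c + 2 * t * (?y \<bullet> ?y) < 0"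
      using mult_neg_pos[of t "?y \<bullet> ?y - t"] t p by simp
    then show False
      using q[of t] by (simp add: c_def)
  qed
  then show ?thesis
    by simp
qed

lemma posdef_inv:
  assumes "posdef A"
  shows "posdef (matrix_inv A)"
proof -
  have i: "invertible A" and p: "psd A"
    using assms by (auto simp: posdef_def)
  note inv = matrix_inv_right_left[OF i]
  have "0 \<le> x \<bullet> (matrix_inv A *v x)" for x
  proof -
    have "x = A *v (matrix_inv A *v x)"
      by (simp add: matrix_vector_mul_assoc inv)
    then have "x \<bullet> (matrix_inv A *v x) = (matrix_inv A *v x) \<bullet> (A *v (matrix_inv A *v x))"
      by (metis inner_commute)
    then show ?thesis
      using psd_nonneg[OF p] by simp
  qed
  then show ?thesis
    using p i hermitian_matrix_inv[OF psd_hermitian[OF p] i] matrix_inv_eqI(2)[OF inv(2)]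
    by (simp add: posdef_def psd_def)
qed

text \<open>The form attains its minimum on the compact unit sphere; \<open>psd_kernel\<close> and
  invertibility make it positive, and homogeneity does the rest.\<close>

lemma posdef_coercive:
  fixes A :: "complex^'n^'n"
  assumes "posdef A"
  obtains k where "k > 0" "\<And>x. k * (norm x)\<^sup>2 \<le> x \<bullet> (A *v x)"
proof -
  let ?f = "\<lambda>x. x \<bullet> (A *v x)"
  have c: "continuous_on (sphere 0 1) ?f"
    by (intro continuous_intros linear_continuous_on[OF bounded_linear_matrix_vector])
  obtain b :: "complex^'n" where b: "norm b = 1"
    using vector_choose_size[of 1] by auto
  obtain m where m: "norm m = 1" "\<And>y. norm y = 1 \<Longrightarrow> ?f m \<le> ?f y"
    using continuous_attains_inf[OF compact_sphere _ c] b by (force simp: dist_norm)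
  have "?f m > 0"
  proof (rule ccontr)
    assume "\<not> ?f m > 0"
    then have "A *v m = 0"
      using psd_kernel assms by (force simp: posdef_def)
    then have "m = 0"
      using assms by (metis matrix_vector_mul_assoc matrix_inv_right_left(2) posdef_def
          matrix_vector_mul_lid matrix_vector_mult_0_right)
    then show False
      using m(1) by simp
  qed
  moreover have "?f m * (norm x)\<^sup>2 \<le> ?f x" for x
  proof (cases "x = 0")
    case False
    let ?y = "x /\<^sub>R norm x"
    have "?f m \<le> ?f ?y"
      using False by (intro m(2)) simp
    also have "\<dots> = ?f x / (norm x)\<^sup>2"
      by (simp add: matrix_vector_scaleR power2_eq_square field_simps)
    finally show ?thesis
      using False by (simp add: field_simps)
  qed simp
  ultimately show ?thesis
    using that by blast
qed

lemma block_row_mult: "block_row A B *v d = A *v (\<chi> i. d $ Inl i) + B *v (\<chi> i. d $ Inr i)"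
proof -
  have "(\<Sum>j\<in>UNIV. (case j of Inl a \<Rightarrow> A $ i $ a | Inr b \<Rightarrow> B $ i $ b) * d $ j)
      = (\<Sum>a\<in>UNIV. A $ i $ a * d $ Inl a) + (\<Sum>b\<in>UNIV. B $ i $ b * d $ Inr b)" for i
    unfolding UNIV_Plus_UNIV[symmetric] by (subst sum.Plus) (auto)
  then show ?thesis
    by (simp add: block_row_def matrix_vector_mult_def vec_eq_iff)
qed

text \<open>Eigenvectors of distinct eigenvalues are independent. Used for the \<open>Max\<close> in
  \<open>lambda_max\<close> and for the exceptional points of the symbol on the circle.\<close>

lemma finite_eigenvals: "finite {\<mu>. eigenval A \<mu>}"
proof (rule ccontr)
  assume inf: "infinite {\<mu>. eigenval A \<mu>}"
  define v where "v = (\<lambda>\<mu>. SOME v. v \<noteq> 0 \<and> A *v v = \<mu> *s v)"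
  have v: "v \<mu> \<noteq> 0 \<and> A *v v \<mu> = \<mu> *s v \<mu>" if "eigenval A \<mu>" for \<mu>
    unfolding v_def by (rule someI_ex) (use that in \<open>simp add: eigenval_def\<close>)
  have ind: "\<forall>\<mu>\<in>M. c \<mu> = 0"
    if "finite M" "\<forall>\<mu>\<in>M. eigenval A \<mu>" "(\<Sum>\<mu>\<in>M. c \<mu> *s v \<mu>) = 0" for M c
    using that
  proof (induction M arbitrary: c)
    case (insert m M)
    let ?s = "\<Sum>\<mu>\<in>M. c \<mu> *s v \<mu>"
    have s: "c m *s v m + ?s = 0"
      using insert by simp
    have As: "A *v ?s = (\<Sum>\<mu>\<in>M. (c \<mu> * \<mu>) *s v \<mu>)"
      using insert.prems v by (auto simp: vec.linear_sum[OF matrix_vector_mul_linear_gen] vector_scalar_commute vector_smult_assoc intro!: sum.cong)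
    have "A *v (c m *s v m + ?s) = (c m * m) *s v m + A *v ?s"
      using v[of m] insert.prems by (simp add: matrix_vector_right_distrib vector_scalar_commute vector_smult_assoc)
    then have "(c m * m) *s v m + A *v ?s = 0"
      using s by simp
    moreover have "(c m * m) *s v m + m *s ?s = 0"
      using arg_cong[OF s, of "\<lambda>x. m *s x"] by (simp add: vector_add_ldistrib vector_smult_assoc mult.commute)
    ultimately have "A *v ?s - m *s ?s = 0"
      by (simp add: add_eq_0_iff)
    then have "(\<Sum>\<mu>\<in>M. (c \<mu> * (\<mu> - m)) *s v \<mu>) = 0"
      unfolding As vec.scale_sum_right sum_subtractf[symmetric]
      by (simp add: vector_smult_assoc right_diff_distrib vec.scale_left_diff_distrib mult.commute)
    then have "\<forall>\<mu>\<in>M. c \<mu> * (\<mu> - m) = 0"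
      using insert.IH[of "\<lambda>\<mu>. c \<mu> * (\<mu> - m)"] insert.prems by auto
    then have "\<forall>\<mu>\<in>M. c \<mu> = 0"
      using insert.hyps by auto
    moreover from this have "c m *s v m = 0"
      using s by simp
    then have "c m = 0"
      using v[of m] insert.prems by simp
    ultimately show ?case by simp
  qed simp
  obtain M where M: "M \<subseteq> {\<mu>. eigenval A \<mu>}" "finite M" "card M = Suc DIM(complex^'a)"
    using infinite_arbitrarily_large[OF inf] by blast
  have inj: "inj_on v M"
  proof (rule inj_onI, rule ccontr)
    fix x y assume *: "x \<in> M" "y \<in> M" "v x = v y" "x \<noteq> y"
    have "x *s v x = y *s v x"
      using v * M by (metis mem_Collect_eq subsetD)
    then show False
      using * v[of x] M by auto
  qed
  \<comment> \<open>Complex independence implies real independence, to which the dimension bound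
    applies.\<close>
  have "independent (v ` M)"
  proof (rule independent_if_scalars_zero)
    show "finite (v ` M)"
      using M by simp
    fix f x assume "(\<Sum>x\<in>v ` M. f x *\<^sub>R x) = 0" and x: "x \<in> v ` M"
    moreover have "r *\<^sub>R y = complex_of_real r *s y" for r and y :: "complex^'a"
      by (simp add: vec_eq_iff) (simp add: scaleR_conv_of_real)
    ultimately have "(\<Sum>\<mu>\<in>M. complex_of_real (f (v \<mu>)) *s v \<mu>) = 0"
      using inj by (simp add: sum.reindex)
    then have "\<forall>\<mu>\<in>M. complex_of_real (f (v \<mu>)) = 0"
      using ind[of M "\<lambda>\<mu>. complex_of_real (f (v \<mu>))"] M by blast
    then show "f x = 0"
      using x by auto
  qed
  then have "card (v ` M) \<le> DIM(complex^'a)"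
    using independent_bound by blast
  then show False
    using M card_image[OF inj] by simp
qed

lemma linear_matrix_vector: "linear ((*v) A)" for A :: "complex^'n^'m"
  using bounded_linear_matrix_vector bounded_linear.linear by blast

text \<open>A variational construction: \<open>t\<close> is the maximum, over the range of
  \<open>Z\<close>, of the form of \<open>Z Y Z\<close> divided by that of \<open>Z\<close>. The
  inequality is what sufficiency needs from the eigenvalue condition.\<close>

lemma psd_product_eigenval:
  fixes Z Y :: "complex^'n^'n"
  assumes Z: "psd Z" and Y: "psd Y"
  obtains t where "eigenval (Z ** Y) (complex_of_real t)"
    and "\<And>x. (Z *v x) \<bullet> (Y *v (Z *v x)) \<le> t * (x \<bullet> (Z *v x))"
proof (cases "Z = 0")
  case True
  obtain b :: "complex^'n" where b: "norm b = 1"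
    using vector_choose_size[of 1] by auto
  then have "eigenval (Z ** Y) (complex_of_real 0)"
    using True by (auto simp: eigenval_def matrix_zero_left intro!: exI[of _ b])
  then show ?thesis
    using that[of 0] True by simp
next
  case False
  define V where "V = range ((*v) Z)"
  have sub: "subspace V"
    unfolding V_def by (rule linear_subspace_image[OF linear_matrix_vector subspace_UNIV])
  have hZ: "hermitian Z"
    using Z by (simp add: psd_def)
  have pos: "x \<bullet> (Z *v x) > 0" if x: "x \<in> V" "x \<noteq> 0" for x
  proof (rule ccontr)
    assume "\<not> ?thesis"
    then have 0: "Z *v x = 0"
      using psd_kernel[OF Z] by force
    obtain y where "x = Z *v y"
      using x(1) unfolding V_def by blast
    then have "x \<bullet> x = 0"
      using 0 hermitian_inner[OF hZ, of x y] by simp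
    then show False
      using x by simp
  qed
  let ?f = "\<lambda>x. (Z *v x) \<bullet> (Y *v (Z *v x))" and ?g = "\<lambda>x. x \<bullet> (Z *v x)"
  let ?S = "sphere 0 1 \<inter> V"
  obtain i where "Z *v i \<noteq> 0"
    using False by (metis matrix_eq matrix_vector_mult_0)
  then have "(Z *v i) /\<^sub>R norm (Z *v i) \<in> ?S"
    using subspace_scale[OF sub] by (auto simp: V_def)
  then have ne: "?S \<noteq> {}"
    by blast
  have cont: "continuous_on ?S (\<lambda>x. ?f x / ?g x)"
    using pos
    by (intro continuous_intros linear_continuous_on_compose[OF _ linear_matrix_vector]) force
  obtain m where m: "m \<in> ?S" "\<And>y. y \<in> ?S \<Longrightarrow> ?f y / ?g y \<le> ?f m / ?g m"
    using continuous_attains_sup[OF compact_Int_closed[OF compact_sphere closed_subspace[OF sub]] ne cont]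
    by blast
  define t where "t = ?f m / ?g m"
  have gm: "?g m > 0"
    using pos m(1) by fastforce
  have onV: "?f x \<le> t * ?g x" if "x \<in> V" for x
  proof (cases "x = 0")
    case False
    have "x /\<^sub>R norm x \<in> ?S"
      using False that subspace_scale[OF sub] by auto
    from m(2)[OF this] have "?f x / ?g x \<le> t"
      using False by (simp add: t_def matrix_vector_scaleR)
    then show ?thesis
      using pos[OF that False] by (simp add: field_simps)
  qed simp
  \<comment> \<open>The component of \<open>x\<close> orthogonal to the range of \<open>Z\<close>
    lies in the kernel of \<open>Z\<close> and changes neither form.\<close>
  have bound: "?f x \<le> t * ?g x" for x
  proof -
    obtain y z where yz: "y \<in> span V" "\<And>w. w \<in> span V \<Longrightarrow> orthogonal z w" "x = y + z"
      using orthogonal_subspace_decomp_exists[of V x] by metis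
    have "orthogonal z (Z *v (Z *v z))"
      using yz(2) by (auto simp: V_def intro: span_base)
    then have "(Z *v z) \<bullet> (Z *v z) = 0"
      using hZ by (simp add: orthogonal_def inner_matrix_vector hermitian_def)
    then have "Z *v z = 0"
      by simp
    then have "?f x = ?f y" "?g x = ?g y"
      using hermitian_inner[OF hZ, of z y] by (simp_all add: yz(3) matrix_vector_right_distrib inner_add_left)
    then show ?thesis
      using onV yz(1) span_eq_iff sub by fastforce
  qed
  \<comment> \<open>This difference is positive semidefinite and its form vanishes at the maximizer
    \<open>m\<close>, so \<open>m\<close> lies in its kernel; the eigenvector is
    \<open>Z m\<close>.\<close>
  define M where "M = t *\<^sub>R Z - Z ** Y ** Z"
  have Mx: "x \<bullet> (M *v y) = t * (x \<bullet> (Z *v y)) - (Z *v x) \<bullet> (Y *v (Z *v y))" for x y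
    using hZ by (simp add: M_def matrix_vector_mult_diff_rdistrib matrix_vector_scaleR inner_diff_right
        inner_matrix_vector[of Z x] hermitian_def matrix_vector_mul_assoc matrix_mul_assoc)
  have "psd M"
  proof (rule psdI)
    show "hermitian M"
      using Z Y by (simp add: M_def hermitian_def psd_def cadj_diff cadj_mult cadj_scaleR matrix_mul_assoc)
  qed (use bound in \<open>simp add: Mx\<close>)
  moreover have "m \<bullet> (M *v m) \<le> 0"
    using gm by (simp add: Mx t_def)
  ultimately have "M *v m = 0"
    using psd_kernel by blast
  then have "(Z ** Y) *v (Z *v m) = complex_of_real t *s (Z *v m)"
    by (simp add: M_def matrix_vector_mult_diff_rdistrib matrix_vector_scaleR matrix_vector_mul_assoc
        vec_eq_iff) (simp add: scaleR_conv_of_real)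
  moreover have "Z *v m \<noteq> 0"
    using gm by force
  ultimately have "eigenval (Z ** Y) (complex_of_real t)"
    unfolding eigenval_def by blast
  then show ?thesis
    using that bound by blast
qed

lemma lambda_max_le_iff:
  assumes "eigenval A (complex_of_real t)"
  shows "lambda_max A \<le> c \<longleftrightarrow> (\<forall>s. eigenval A (complex_of_real s) \<longrightarrow> s \<le> c)"
proof -
  have "finite {t :: real. eigenval A (complex_of_real t)}"
    using finite_vimageI[OF finite_eigenvals[of A], of complex_of_real]
    by (simp add: inj_on_def vimage_def)
  then show ?thesis
    unfolding lambda_max_def using assms by (subst Max_le_iff) auto
qed

section \<open>Powers of stable matrices\<close>

lemma mpow_0 [simp]: "mpow A 0 = mat 1"
  and mpow_Suc: "mpow A (Suc k) = A ** mpow A k"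
  by (simp_all add: mpow_def)

lemma mpow_Suc2: "mpow A (Suc k) = mpow A k ** A"
proof (induction k)
  case (Suc k)
  have "mpow A (Suc (Suc k)) = A ** (mpow A k ** A)"
    using Suc by (simp add: mpow_Suc)
  then show ?case
    by (simp add: mpow_Suc matrix_mul_assoc)
qed (simp add: mpow_Suc)

lemma mpow_cadj: "mpow (A\<^sup>\<dagger>) k = (mpow A k)\<^sup>\<dagger>"
proof (induction k)
  case (Suc k)
  then show ?case
    by (simp add: mpow_Suc[of "A\<^sup>\<dagger>"] mpow_Suc2[of A] cadj_mult)
qed simp

text \<open>Summing the recursion keeps the partial sums of \<open>a\<close> below the fixed point
  of \<open>M = a 0 + suminf b + c M\<close>.\<close>

lemma summable_recursion:
  fixes a b :: "nat \<Rightarrow> real"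
  assumes a: "\<And>k. 0 \<le> a k" and b: "\<And>k. 0 \<le> b k" "summable b"
    and c: "0 \<le> c" "c < 1" and rec: "\<And>k. a (Suc k) \<le> c * a k + b k"
  shows "summable a"
proof -
  define M where "M = (a 0 + suminf b) / (1 - c)"
  have M: "a 0 + suminf b + c * M = M"
    using c by (simp add: M_def field_simps)
  have M0: "0 \<le> M"
    using a[of 0] suminf_nonneg[OF b(2) b(1)] c by (simp add: M_def)
  have "(\<Sum>k<n. a k) \<le> M" for n
  proof (induction n)
    case (Suc n)
    have "(\<Sum>k<Suc n. a k) = a 0 + (\<Sum>k<n. a (Suc k))"
      by (rule sum.lessThan_Suc_shift)
    also have "\<dots> \<le> a 0 + (\<Sum>k<n. c * a k + b k)"
      by (intro add_left_mono sum_mono rec)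
    also have "\<dots> = a 0 + (\<Sum>k<n. b k) + c * (\<Sum>k<n. a k)"
      by (simp add: sum.distrib sum_distrib_left)
    also have "\<dots> \<le> a 0 + suminf b + c * M"
      using b c Suc by (intro add_mono mult_left_mono sum_le_suminf) auto
    finally show ?case
      using M by simp
  qed (simp add: M0)
  then show ?thesis
    by (intro summableI_nonneg_bounded[OF a])
qed

lemma matrix_vector_mult_sum_rdistrib: "(\<Sum>k\<in>I. M k) *v v = (\<Sum>k\<in>I. M k *v v)"
  for v :: "complex^'n"
  by (induction I rule: infinite_finite_induct) (simp_all add: matrix_vector_mult_add_rdistrib)

lemma scaleR_eq_of_real_smult: "r *\<^sub>R v = complex_of_real r *s v" for v :: "complex^'n"
  by (simp add: vec_eq_iff) (simp add: scaleR_conv_of_real)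

definition poly_apply :: "complex poly \<Rightarrow> complex^'n^'n \<Rightarrow> complex^'n \<Rightarrow> complex^'n" where
  "poly_apply p A v = (\<Sum>k\<le>degree p. coeff p k *s (mpow A k *v v))"

lemma poly_apply_bound:
  "degree p \<le> N \<Longrightarrow> poly_apply p A v = (\<Sum>k\<le>N. coeff p k *s (mpow A k *v v))"
  unfolding poly_apply_def
  by (rule sum.mono_neutral_left) (auto simp: coeff_eq_0)

text \<open>A linear factor may act first or last: the first form peels off a root inside the disk,
  the second cancels a root outside it.\<close>

lemma poly_apply_root_factor:
  "poly_apply ([:- l, 1:] * q) A v = poly_apply q A (A *v v - l *s v)"
  "poly_apply ([:- l, 1:] * q) A v = A *v (poly_apply q A v) - l *s poly_apply q A v"
proof -
  let ?N = "degree q"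
  have eq: "[:- l, 1:] * q = pCons 0 q - smult l q"
    by simp
  have "degree ([:- l, 1:] * q) \<le> Suc ?N"
    unfolding eq by (rule degree_diff_le) (auto simp: degree_pCons_le degree_smult_le le_SucI)
  then have "poly_apply ([:- l, 1:] * q) A v =
      (\<Sum>k\<le>Suc ?N. coeff (pCons 0 q) k *s (mpow A k *v v)) - l *s (\<Sum>k\<le>Suc ?N. coeff q k *s (mpow A k *v v))"
    by (simp only: poly_apply_bound eq) (simp add: vec.scale_left_diff_distrib sum_subtractf vec.scale_sum_right vector_smult_assoc)
  also have "(\<Sum>k\<le>Suc ?N. coeff q k *s (mpow A k *v v)) = poly_apply q A v"
    by (simp add: poly_apply_def coeff_eq_0)
  also have s: "(\<Sum>k\<le>Suc ?N. coeff (pCons 0 q) k *s (mpow A k *v v)) = (\<Sum>k\<le>?N. coeff q k *s (mpow A (Suc k) *v v))"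
    by (simp only: sum.atMost_Suc_shift) simp
  finally have 1: "poly_apply ([:- l, 1:] * q) A v
    = (\<Sum>k\<le>?N. coeff q k *s (mpow A (Suc k) *v v)) - l *s poly_apply q A v" .
  show "poly_apply ([:- l, 1:] * q) A v = poly_apply q A (A *v v - l *s v)"
    unfolding 1 unfolding poly_apply_def
    by (simp add: mpow_Suc2 matrix_vector_mul_assoc[symmetric] matrix_vector_mult_diff_distrib
        vec.scale_right_diff_distrib sum_subtractf vec.scale_sum_right vector_scalar_commute vector_smult_assoc mult.commute)
  show "poly_apply ([:- l, 1:] * q) A v = A *v (poly_apply q A v) - l *s poly_apply q A v"
    unfolding 1 unfolding poly_apply_def
    by (simp add: mpow_Suc matrix_vector_mul_assoc[symmetric] vec.linear_sum[OF matrix_vector_mul_linear_gen] vector_scalar_commute)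
qed

text \<open>Induction on the degree: a root of modulus at least 1 is no eigenvalue and can be cancelled,
  any other root is peeled off by a contracting recursion.\<close>

lemma summable_powers_of_annihilator:
  assumes st: "stable A"
  shows "p \<noteq> 0 \<Longrightarrow> poly_apply p A v = 0 \<Longrightarrow> summable (\<lambda>k. norm (mpow A k *v v))"
proof (induction "degree p" arbitrary: p v)
  case 0
  then obtain a where "p = [:a:]" "a \<noteq> 0"
    by (metis degree_eq_zeroE pCons_0_0)
  then have "v = 0"
    using 0 by (simp add: poly_apply_def)
  then show ?case by simp
next
  case (Suc n)
  have "\<not> constant (poly p)"
    using Suc.hyps(2) by (simp add: constant_degree)
  then obtain l where "poly p l = 0"
    using fundamental_theorem_of_algebra by blast
  then obtain q where q: "p = [:- l, 1:] * q"
    using poly_eq_0_iff_dvd[of p l] unfolding dvd_def by blast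
  have q0: "q \<noteq> 0"
    using q Suc by auto
  have n: "n = degree q"
    using Suc q q0 by (simp add: degree_mult_eq del: mult_pCons_left)
  show ?case
  proof (cases "norm l < 1")
    case True
    let ?u = "A *v v - l *s v"
    have su: "summable (\<lambda>k. norm (mpow A k *v ?u))"
      using Suc.hyps(1)[OF n q0] Suc.prems q poly_apply_root_factor(1) by metis
    have rec: "norm (mpow A (Suc k) *v v) \<le> norm l * norm (mpow A k *v v) + norm (mpow A k *v ?u)" for k
    proof -
      have "mpow A (Suc k) *v v = l *s (mpow A k *v v) + mpow A k *v ?u"
        by (simp add: mpow_Suc2 matrix_vector_mul_assoc[symmetric] matrix_vector_mult_diff_distrib vector_scalar_commute)
      moreover have "norm (l *s (mpow A k *v v)) = norm l * norm (mpow A k *v v)"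
        by (simp add: norm_vec_def norm_mult L2_set_right_distrib)
      ultimately show ?thesis
        using norm_triangle_ineq[of "l *s (mpow A k *v v)" "mpow A k *v ?u"] by simp
    qed
    show ?thesis
      by (rule summable_recursion[OF _ _ su _ True rec]) simp_all
  next
    case False
    have "A *v (poly_apply q A v) = l *s poly_apply q A v"
      using Suc.prems(2) unfolding q poly_apply_root_factor(2) by simp
    then have "poly_apply q A v = 0"
      using st False by (auto simp: stable_def eigenval_def)
    then show ?thesis
      using Suc.hyps(1)[OF n q0] by blast
  qed
qed

text \<open>More powers than the real dimension of the matrix space are linearly dependent, and a
  dependence is an annihilator.\<close>

lemma annihilating_polynomial:
  fixes A :: "complex^'n^'n"
  obtains p where "p \<noteq> 0" "\<And>v. poly_apply p A v = 0"
proof -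
  let ?N = "DIM(complex^'n^'n)"
  obtain r :: "nat \<Rightarrow> real" and j where r: "(\<Sum>k\<le>?N. r k *\<^sub>R mpow A k) = 0" and j: "j \<le> ?N" "r j \<noteq> 0"
  proof (cases "inj_on (mpow A) {..?N}")
    \<comment> \<open>Equal powers at different exponents give a relation at once; the image set
      used below would hide it.\<close>
    case False
    then obtain i j where ij: "i \<le> ?N" "j \<le> ?N" "i \<noteq> j" "mpow A i = mpow A j"
      by (auto simp: inj_on_def)
    have "(\<Sum>k\<le>?N. (if k = i then 1 else if k = j then - 1 else 0) *\<^sub>R mpow A k) = 
      (\<Sum>k\<le>?N. (if k = i then mpow A k else 0) - (if k = j then mpow A k else 0))"
      using ij by (intro sum.cong) auto
    also have "\<dots> = 0"
      using ij by (simp add: sum_subtractf)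
    finally show ?thesis
      using ij that[of "\<lambda>k. if k = i then 1 else if k = j then - 1 else 0" i] by simp
  next
    case True
    have "card (mpow A ` {..?N}) > DIM(complex^'n^'n)"
      using True by (simp add: card_image)
    then have "dependent (mpow A ` {..?N})"
      using independent_bound by (metis leD)
    then obtain u v where uv: "v \<in> mpow A ` {..?N}" "u v \<noteq> 0" "(\<Sum>v\<in>mpow A ` {..?N}. u v *\<^sub>R v) = 0"
      by (auto simp: dependent_finite)
    then have "(\<Sum>k\<le>?N. u (mpow A k) *\<^sub>R mpow A k) = 0"
      using True by (simp add: sum.reindex)
    then show ?thesis
      using uv that[of "\<lambda>k. u (mpow A k)"] by auto
  qed
  define p where "p = (\<Sum>k\<le>?N. monom (complex_of_real (r k)) k)"
  have c: "coeff p k = (if k \<le> ?N then complex_of_real (r k) else 0)" for k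
    by (simp add: p_def coeff_sum)
  have "p \<noteq> 0"
    using c[of j] j by (metis coeff_0 of_real_eq_0_iff)
  moreover have "poly_apply p A v = 0" for v
  proof -
    have "degree p \<le> ?N"
      using c by (intro degree_le) auto
    then have "poly_apply p A v = (\<Sum>k\<le>?N. r k *\<^sub>R mpow A k) *v v"
      by (simp add: poly_apply_bound c matrix_vector_mult_sum_rdistrib matrix_vector_scaleR
          scaleR_eq_of_real_smult)
    then show ?thesis
      using r by simp
  qed
  ultimately show ?thesis
    using that by blast
qed

lemma matrix_vector_mul_component_axis: "(A *v axis j 1) $ i = A $ i $ j" for A :: "complex^'n^'m"
  by (simp add: matrix_vector_mult_def axis_def if_distrib cong: if_cong)

text \<open>The quantitative form of stability behind every resolvent.\<close>

definition powers_summable :: "complex^'n^'n \<Rightarrow> bool" where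
  "powers_summable A \<longleftrightarrow> summable (\<lambda>k. norm (mpow A k))"

text \<open>The annihilating polynomial makes each column of the powers summable, and a matrix norm
  is at most the sum of its column norms.\<close>

lemma stable_powers_summable:
  assumes "stable A"
  shows "powers_summable A"
proof -
  obtain p where p: "p \<noteq> 0" "\<And>v. poly_apply p A v = 0"
    using annihilating_polynomial[of A] by blast
  have s: "summable (\<lambda>k. \<Sum>j\<in>UNIV. norm (mpow A k *v axis j 1))"
    by (intro summable_sum summable_powers_of_annihilator[OF assms p])
  have "norm (mpow A k) \<le> (\<Sum>j\<in>UNIV. norm (mpow A k *v axis j 1))" for k
  proof -
    have "norm (mpow A k) = norm ((mpow A k)\<^sup>\<dagger>)"
      by simp
    also have "\<dots> \<le> (\<Sum>j\<in>UNIV. norm ((mpow A k)\<^sup>\<dagger> $ j))"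
      unfolding norm_vec_def[of "(mpow A k)\<^sup>\<dagger>"] by (rule L2_set_le_sum) simp
    also have "\<dots> = (\<Sum>j\<in>UNIV. norm (mpow A k *v axis j 1))"
      by (simp add: norm_vec_def[where 'a=complex] cadj_def matrix_vector_mul_component_axis)
    finally show ?thesis .
  qed
  then show ?thesis
    unfolding powers_summable_def by (intro summable_comparison_test'[OF s, of 0]) simp
qed

lemma powers_summable_cadj: "powers_summable A \<Longrightarrow> powers_summable (A\<^sup>\<dagger>)"
  by (simp add: powers_summable_def mpow_cadj)

lemma powers_summable_apply: "powers_summable A \<Longrightarrow> (\<lambda>k. mpow A k *v x) \<longlonglongrightarrow> 0"
proof (rule Lim_null_comparison)
  assume "powers_summable A"
  then have "(\<lambda>k. norm (mpow A k)) \<longlonglongrightarrow> 0"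
    unfolding powers_summable_def by (rule summable_LIMSEQ_zero)
  then show "(\<lambda>k. norm (mpow A k) * norm x) \<longlonglongrightarrow> 0"
    by (rule tendsto_mult_left_zero)
qed (simp add: norm_matrix_vector_le)

text \<open>Iterating the equation exhibits the form of \<open>X\<close> as a limit of sums of forms
  of \<open>Y\<close>. Symmetry has to be derived as well, since Gramians enter only as
  solutions.\<close>

lemma lyapunov_psd:
  fixes A X Y :: "complex^'n^'n"
  assumes A: "powers_summable A" and X: "X = A\<^sup>\<dagger> ** X ** A + Y" and Y: "psd Y"
  shows "psd X"
proof (rule psdI)
  have it: "x \<bullet> (X *v y) = (mpow A k *v x) \<bullet> (X *v (mpow A k *v y))
      + (\<Sum>j<k. (mpow A j *v x) \<bullet> (Y *v (mpow A j *v y)))" for x y k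
  proof (induction k)
    case (Suc k)
    have step: "u \<bullet> (X *v v) = (A *v u) \<bullet> (X *v (A *v v)) + u \<bullet> (Y *v v)" for u v
      by (subst (1) X) (simp add: matrix_vector_mult_add_rdistrib inner_add_right inner_matrix_vector
          matrix_vector_mul_assoc matrix_mul_assoc)
    show ?case
      using Suc step[of "mpow A k *v x" "mpow A k *v y"] by (simp add: mpow_Suc matrix_vector_mul_assoc)
  qed simp
  have lim: "(\<lambda>k. (mpow A k *v x) \<bullet> (X *v (mpow A k *v y))) \<longlonglongrightarrow> 0" for x y
  proof -
    have "(\<lambda>k. (mpow A k *v x) \<bullet> (X *v (mpow A k *v y))) \<longlonglongrightarrow> 0 \<bullet> (X *v 0)"
      by (intro tendsto_inner powers_summable_apply[OF A]
          bounded_linear.tendsto[OF bounded_linear_matrix_vector])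
    then show ?thesis by simp
  qed
  have sums: "(\<lambda>k. \<Sum>j<k. (mpow A j *v x) \<bullet> (Y *v (mpow A j *v y))) \<longlonglongrightarrow> x \<bullet> (X *v y)" for x y
  proof -
    have "(\<lambda>k. x \<bullet> (X *v y) - (mpow A k *v x) \<bullet> (X *v (mpow A k *v y))) \<longlonglongrightarrow> x \<bullet> (X *v y) - 0"
      by (intro tendsto_intros lim)
    moreover have "(\<lambda>k. x \<bullet> (X *v y) - (mpow A k *v x) \<bullet> (X *v (mpow A k *v y))) =
        (\<lambda>k. \<Sum>j<k. (mpow A j *v x) \<bullet> (Y *v (mpow A j *v y)))"
      by (intro ext) (use it[of x y] in \<open>simp add: algebra_simps\<close>)
    ultimately show ?thesis
      by simp
  qed
  have "x \<bullet> (X *v y) = y \<bullet> (X *v x)" for x y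
    using LIMSEQ_unique[OF sums[of x y]] sums[of y x] hermitian_inner[OF psd_hermitian[OF Y]] by simp
  then have "x \<bullet> (X *v y) = x \<bullet> (X\<^sup>\<dagger> *v y)" for x y
    by (metis inner_commute inner_matrix_vector)
  then have "X *v y = X\<^sup>\<dagger> *v y" for y
    by (metis vector_eq_rdot inner_commute)
  then show "hermitian X"
    by (simp add: hermitian_def matrix_eq)
  show "0 \<le> x \<bullet> (X *v x)" for x
    by (rule LIMSEQ_le_const[OF sums]) (auto intro!: sum_nonneg psd_nonneg[OF Y])
qed

section \<open>Operators on square-summable sequences\<close>

abbreviation ell2_nth :: "'a::real_inner ell2 \<Rightarrow> int \<Rightarrow> 'a" (infixl \<open>$$\<close> 90) where
  "x $$ i \<equiv> Rep_ell2 x i"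

lemma ell2_eqI: "(\<And>i. x $$ i = y $$ i) \<Longrightarrow> x = y"
  by (metis Rep_ell2_inject ext)

lemmas ell2_nth [simp] = zero_ell2.rep_eq plus_ell2.rep_eq uminus_ell2.rep_eq minus_ell2.rep_eq
  scaleR_ell2.rep_eq

lemma ell2_nth_sum: "(\<Sum>k\<in>K. f k) $$ i = (\<Sum>k\<in>K. f k $$ i)"
  by (induction K rule: infinite_finite_induct) auto

lemma ell2_summable: "(\<lambda>i. (norm (x $$ i))\<^sup>2) summable_on UNIV"
  using Rep_ell2[of x] by simp

lemma inner_ell2_has_sum: "((\<lambda>i. x $$ i \<bullet> y $$ i) has_sum (x \<bullet> y)) UNIV"
  by (simp add: inner_ell2.rep_eq ell2_inner_summable ell2_summable)

lemma norm_ell2_has_sum: "((\<lambda>i. (norm (x $$ i))\<^sup>2) has_sum (norm x)\<^sup>2) UNIV"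
  using inner_ell2_has_sum[of x x] by (simp add: power2_norm_eq_inner)

lemma L2_set_ell2_le: "finite I \<Longrightarrow> L2_set (\<lambda>i. norm (x $$ i)) I \<le> norm x"
  using finite_sum_le_has_sum[OF norm_ell2_has_sum[of x], of I]
  by (auto simp: L2_set_def real_le_lsqrt sum_nonneg)

lemma norm_ell2_nth_le: "norm (x $$ i) \<le> norm x"
  using L2_set_ell2_le[of "{i}" x] by simp

lemma bounded_linear_nth: "bounded_linear (\<lambda>x. x $$ i)"
  by (rule bounded_linear_intro[where K=1]) (auto simp: norm_ell2_nth_le)

text \<open>How sequences given by formulas enter \<open>ell2\<close>: bounds on finite windows give
  both membership and norm.\<close>

lemma ell2_of_bounded:
  assumes "\<And>I. finite I \<Longrightarrow> L2_set (\<lambda>i. norm (f i)) I \<le> c"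
  shows "(\<lambda>i. (norm (f i))\<^sup>2) summable_on UNIV" "\<exists>x. (\<forall>i. x $$ i = f i) \<and> norm x \<le> c"
proof -
  have c: "0 \<le> c"
    using assms[of "{}"] by simp
  have b: "(\<Sum>i\<in>I. (norm (f i))\<^sup>2) \<le> c\<^sup>2" if "finite I" for I
    using power_mono[OF assms[OF that], of 2] by (simp add: L2_set_def sum_nonneg)
  show s: "(\<lambda>i. (norm (f i))\<^sup>2) summable_on UNIV"
    using b by (intro nonneg_bdd_above_summable_on) (auto intro!: bdd_aboveI)
  have x: "Abs_ell2 f $$ i = f i" for i
    using s by (simp add: Abs_ell2_inverse)
  have "(norm (Abs_ell2 f))\<^sup>2 \<le> c\<^sup>2"
    using b x by (intro has_sum_le_finite_sums[OF norm_ell2_has_sum]) simp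
  then show "\<exists>x. (\<forall>i. x $$ i = f i) \<and> norm x \<le> c"
    using x c by (intro exI[of _ "Abs_ell2 f"]) (auto intro: power2_le_imp_le)
qed

lemma has_sum_single_index:
  assumes "\<And>i. i \<noteq> j \<Longrightarrow> f i = 0"
  shows "(f has_sum f j) UNIV"
proof -
  have "(f has_sum f j) {j}"
    by (simp add: has_sum_finiteI)
  then show ?thesis
    by (rule has_sum_cong_neutral[THEN iffD1, rotated -1]) (use assms in auto)
qed

lift_definition window :: "int set \<Rightarrow> 'a::real_inner ell2 \<Rightarrow> 'a ell2" is
  "\<lambda>S x i. if i \<in> S then x i else 0"
proof -
  fix S :: "int set" and x :: "int \<Rightarrow> 'a"
  assume "(\<lambda>i. (norm (x i))\<^sup>2) summable_on UNIV"
  then show "(\<lambda>i. (norm (if i \<in> S then x i else 0))\<^sup>2) summable_on UNIV"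
    by (rule summable_on_comparison_test) auto
qed

lift_definition single :: "int \<Rightarrow> 'a::real_inner \<Rightarrow> 'a ell2" is
  "\<lambda>j a i. if i = j then a else 0"
proof -
  fix j :: int and a :: 'a
  show "(\<lambda>i. (norm (if i = j then a else 0))\<^sup>2) summable_on UNIV"
    by (rule has_sum_imp_summable[OF has_sum_single_index[of j]]) simp
qed

text \<open>A time advance, so that a state equation reads
  \<open>shift 1 x = A \<rhd> x + u\<close>.\<close>

lift_definition shift :: "int \<Rightarrow> 'a::real_inner ell2 \<Rightarrow> 'a ell2" is
  "\<lambda>k x i. x (i + k)"
proof -
  fix k :: int and x :: "int \<Rightarrow> 'a"
  assume "(\<lambda>i. (norm (x i))\<^sup>2) summable_on UNIV"
  then show "(\<lambda>i. (norm (x (i + k)))\<^sup>2) summable_on UNIV"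
    using summable_on_reindex_bij_betw[of "\<lambda>i. i + k" UNIV UNIV "\<lambda>i. (norm (x i))\<^sup>2"]
    by (simp add: bij_plus_right)
qed

lift_definition reverse :: "'a::real_inner ell2 \<Rightarrow> 'a ell2" is
  "\<lambda>x i. x (- i)"
proof -
  fix x :: "int \<Rightarrow> 'a"
  assume "(\<lambda>i. (norm (x i))\<^sup>2) summable_on UNIV"
  then show "(\<lambda>i. (norm (x (- i)))\<^sup>2) summable_on UNIV"
    using summable_on_reindex_bij_betw[of "\<lambda>i. - i" UNIV UNIV "\<lambda>i. (norm (x i))\<^sup>2"]
    by (simp add: bij_uminus)
qed

lift_definition pointwise :: "complex^'n^'m \<Rightarrow> (complex^'n) ell2 \<Rightarrow> (complex^'m) ell2" (infixr \<open>\<rhd>\<close> 75) is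
  "\<lambda>A x i. A *v x i"
proof -
  fix A :: "complex^'n^'m" and x :: "int \<Rightarrow> complex^'n"
  assume "(\<lambda>i. (norm (x i))\<^sup>2) summable_on UNIV"
  then have "(\<lambda>i. (norm A)\<^sup>2 * (norm (x i))\<^sup>2) summable_on UNIV"
    by (rule summable_on_cmult_right)
  then show "(\<lambda>i. (norm (A *v x i))\<^sup>2) summable_on UNIV"
    by (rule summable_on_comparison_test)
       (auto simp: power_mult_distrib[symmetric] intro!: power_mono norm_matrix_vector_le)
qed

lemmas ell2_nth_op [simp] = window.rep_eq single.rep_eq shift.rep_eq reverse.rep_eq pointwise.rep_eq

lemma window_zero: "(\<And>i. i \<notin> S \<Longrightarrow> x $$ i = 0) \<Longrightarrow> window S x = x"
  by (rule ell2_eqI) auto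

lemma norm_window_le: "norm (window S x) \<le> norm x"
proof (rule power2_le_imp_le)
  show "(norm (window S x))\<^sup>2 \<le> (norm x)\<^sup>2"
    by (rule has_sum_mono[OF norm_ell2_has_sum norm_ell2_has_sum]) auto
qed simp

lemma norm_single [simp]: "norm (single j a) = norm a"
proof -
  have "((\<lambda>i. (norm (single j a $$ i))\<^sup>2) has_sum (norm a)\<^sup>2) UNIV"
    using has_sum_single_index[of j "\<lambda>i. (norm (single j a $$ i))\<^sup>2"] by simp
  then have "(norm (single j a))\<^sup>2 = (norm a)\<^sup>2"
    using norm_ell2_has_sum has_sum_unique by blast
  then show ?thesis
    by simp
qed

lemma inner_single: "single j a \<bullet> x = a \<bullet> x $$ j"
  using has_sum_unique[OF inner_ell2_has_sum[of "single j a" x]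
      has_sum_single_index[of j "\<lambda>i. single j a $$ i \<bullet> x $$ i"]] by simp

lemma inner_shift: "shift k x \<bullet> shift k y = x \<bullet> y"
proof -
  have "((\<lambda>i. x $$ (i + k) \<bullet> y $$ (i + k)) has_sum (x \<bullet> y)) UNIV"
    using has_sum_reindex_bij_betw[of "\<lambda>i. i + k" UNIV UNIV "\<lambda>i. x $$ i \<bullet> y $$ i"] inner_ell2_has_sum[of x y]
    by (simp add: bij_plus_right)
  then show ?thesis
    using inner_ell2_has_sum[of "shift k x" "shift k y"] has_sum_unique by fastforce
qed

lemma inner_reverse: "reverse x \<bullet> reverse y = x \<bullet> y"
proof -
  have "((\<lambda>i. x $$ (- i) \<bullet> y $$ (- i)) has_sum (x \<bullet> y)) UNIV"
    using has_sum_reindex_bij_betw[of "\<lambda>i. - i" UNIV UNIV "\<lambda>i. x $$ i \<bullet> y $$ i"] inner_ell2_has_sum[of x y]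
    by (simp add: bij_uminus)
  then show ?thesis
    using inner_ell2_has_sum[of "reverse x" "reverse y"] has_sum_unique by fastforce
qed

lemma norm_shift [simp]: "norm (shift k x) = norm x"
  and norm_reverse [simp]: "norm (reverse x) = norm x"
  by (simp_all add: norm_eq_sqrt_inner inner_shift inner_reverse)

lemma norm_pointwise_le: "norm (A \<rhd> x) \<le> norm A * norm x"
proof (rule power2_le_imp_le)
  have "((\<lambda>i. (norm A)\<^sup>2 * (norm (x $$ i))\<^sup>2) has_sum ((norm A)\<^sup>2 * (norm x)\<^sup>2)) UNIV"
    by (intro has_sum_cmult_right norm_ell2_has_sum)
  then show "(norm (A \<rhd> x))\<^sup>2 \<le> (norm A * norm x)\<^sup>2"
    unfolding power_mult_distrib
    by (rule has_sum_mono[OF norm_ell2_has_sum])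
       (auto simp: power_mult_distrib[symmetric] intro!: power_mono norm_matrix_vector_le)
qed simp

lemma bounded_linear_shift: "bounded_linear (shift k)"
  by (rule bounded_linear_intro[where K=1]) (auto intro!: ell2_eqI)

lemma bounded_linear_reverse: "bounded_linear reverse"
  by (rule bounded_linear_intro[where K=1]) (auto intro!: ell2_eqI)

lemma bounded_linear_pointwise: "bounded_linear (pointwise A)"
  by (rule bounded_linear_intro[where K="norm A"])
     (use norm_pointwise_le[of A] in \<open>auto intro!: ell2_eqI
       simp: matrix_vector_right_distrib matrix_vector_scaleR mult.commute\<close>)

lemma bounded_linear_single: "bounded_linear (single j)"
  by (rule bounded_linear_intro[where K=1]) (auto intro!: ell2_eqI)

lemma pointwise_mult: "A \<rhd> B \<rhd> x = (A ** B) \<rhd> x"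
  by (rule ell2_eqI) (simp add: matrix_vector_mul_assoc)

lemma pointwise_one [simp]: "mat 1 \<rhd> x = x"
  by (rule ell2_eqI) simp

lemma pointwise_zero [simp]: "0 \<rhd> x = 0" "A \<rhd> 0 = 0"
  by (auto intro: ell2_eqI)

lemma pointwise_add_left: "(A + B) \<rhd> x = A \<rhd> x + B \<rhd> x"
  and pointwise_diff_left: "(A - B) \<rhd> x = A \<rhd> x - B \<rhd> x"
  and pointwise_minus_left: "(- A) \<rhd> x = - (A \<rhd> x)"
  and pointwise_scaleR_left: "(r *\<^sub>R A) \<rhd> x = r *\<^sub>R (A \<rhd> x)"
  by (auto intro!: ell2_eqI simp: matrix_vector_mult_add_rdistrib matrix_vector_mult_diff_rdistrib
      matrix_vector_uminus matrix_vector_scaleR)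

lemma pointwise_add: "A \<rhd> (x + y) = A \<rhd> x + A \<rhd> y"
  and pointwise_diff: "A \<rhd> (x - y) = A \<rhd> x - A \<rhd> y"
  and pointwise_minus: "A \<rhd> (- x) = - (A \<rhd> x)"
  and pointwise_scaleR: "A \<rhd> (r *\<^sub>R x) = r *\<^sub>R (A \<rhd> x)"
  by (auto intro!: ell2_eqI simp: matrix_vector_right_distrib matrix_vector_mult_diff_distrib
      matrix_vector_uminus matrix_vector_scaleR)

lemmas pointwise_algebra = pointwise_add_left pointwise_diff_left pointwise_minus_left
  pointwise_scaleR_left pointwise_add pointwise_diff pointwise_minus pointwise_scaleR

lemma shift_zero [simp]: "shift 0 x = x" "shift k 0 = 0"
  by (auto intro!: ell2_eqI)

lemma shift_shift: "shift k (shift l x) = shift (k + l) x"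
  by (rule ell2_eqI) (simp add: add.assoc)

lemma shift_pointwise: "shift k (A \<rhd> x) = A \<rhd> shift k x"
  by (rule ell2_eqI) simp

lemma shift_add: "shift k (x + y) = shift k x + shift k y"
  and shift_diff: "shift k (x - y) = shift k x - shift k y"
  and shift_scaleR: "shift k (r *\<^sub>R x) = r *\<^sub>R shift k x"
  by (auto intro!: ell2_eqI)

lemma inner_pointwise: "(A \<rhd> x) \<bullet> y = x \<bullet> (A\<^sup>\<dagger> \<rhd> y)"
  by (simp add: inner_ell2.rep_eq inner_matrix_vector)

lemma pointwise_inner_commute: "hermitian A \<Longrightarrow> x \<bullet> (A \<rhd> y) = y \<bullet> (A \<rhd> x)"
  by (metis hermitian_def inner_commute inner_pointwise)

lemma pointwise_psd: "psd A \<Longrightarrow> 0 \<le> x \<bullet> (A \<rhd> x)"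
  by (rule has_sum_nonneg[OF inner_ell2_has_sum]) (simp add: psd_nonneg)

lemma sum_single: "finite F \<Longrightarrow> (\<Sum>j\<in>F. single j (x $$ j)) = window F x"
  by (rule ell2_eqI) (simp add: ell2_nth_sum)

lemma norm_window_finite:
  assumes "finite F"
  shows "(norm (window F x))\<^sup>2 = (\<Sum>i\<in>F. (norm (x $$ i))\<^sup>2)"
proof -
  have "((\<lambda>i. (norm (window F x $$ i))\<^sup>2) has_sum (\<Sum>i\<in>F. (norm (x $$ i))\<^sup>2)) F"
    using assms by (simp add: has_sum_finiteI)
  then have "((\<lambda>i. (norm (window F x $$ i))\<^sup>2) has_sum (\<Sum>i\<in>F. (norm (x $$ i))\<^sup>2)) UNIV"
    by (rule has_sum_cong_neutral[THEN iffD1, rotated -1]) auto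
  then show ?thesis
    using norm_ell2_has_sum has_sum_unique by blast
qed

lemma inner_window: "window S x \<bullet> y = window S x \<bullet> window S y"
  unfolding inner_ell2.rep_eq by (rule infsum_cong) simp

lemma norm_window_compl: "(norm x)\<^sup>2 = (norm (window S x))\<^sup>2 + (norm (x - window S x))\<^sup>2"
proof -
  have "window S x \<bullet> (x - window S x) = 0"
    by (subst inner_window) (auto simp: inner_ell2.rep_eq intro!: infsum_0)
  then show ?thesis
    by (simp add: power2_norm_eq_inner inner_diff_left inner_diff_right inner_commute)
qed

text \<open>By Pythagoras the squared norm of a remainder is the tail of a convergent sum. Bounded
  operators are thereby determined by impulses.\<close>

lemma single_has_sum: "((\<lambda>j. single j (x $$ j)) has_sum x) UNIV"
proof -
  let ?F = "finite_subsets_at_top (UNIV :: int set)"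
  have "((\<lambda>F. (norm x)\<^sup>2 - (\<Sum>i\<in>F. (norm (x $$ i))\<^sup>2)) \<longlongrightarrow> (norm x)\<^sup>2 - (norm x)\<^sup>2) ?F"
    using norm_ell2_has_sum[of x] unfolding has_sum_def by (intro tendsto_intros)
  then have "((\<lambda>F. (norm (x - window F x))\<^sup>2) \<longlongrightarrow> (norm x)\<^sup>2 - (norm x)\<^sup>2) ?F"
  proof (rule Lim_transform_eventually, intro eventually_finite_subsets_at_top_weakI)
    show "(norm x)\<^sup>2 - (\<Sum>i\<in>F. (norm (x $$ i))\<^sup>2) = (norm (x - window F x))\<^sup>2"
      if "finite F" for F
      using norm_window_compl[of x F] norm_window_finite[OF that, of x] by simp
  qed
  then have "((\<lambda>F. sqrt ((norm (x - window F x))\<^sup>2)) \<longlongrightarrow> sqrt ((norm x)\<^sup>2 - (norm x)\<^sup>2)) ?F"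
    by (rule tendsto_real_sqrt)
  then have "((\<lambda>F. x - window F x) \<longlongrightarrow> 0) ?F"
    by (simp add: tendsto_norm_zero_iff)
  then have "((\<lambda>F. x - (x - window F x)) \<longlongrightarrow> x - 0) ?F"
    by (intro tendsto_intros)
  then have "((\<lambda>F. window F x) \<longlongrightarrow> x) ?F"
    by simp
  then show ?thesis
    unfolding has_sum_def
    by (rule Lim_transform_eventually) (auto intro!: eventually_finite_subsets_at_top_weakI simp: sum_single)
qed

lemma filterlim_symmetric_intervals:
  "filterlim (\<lambda>N. {- int N..int N}) (finite_subsets_at_top UNIV) sequentially"
  unfolding filterlim_finite_subsets_at_top
proof (intro allI impI)
  fix X :: "int set" assume X: "finite X \<and> X \<subseteq> UNIV"
  define m where "m = nat (Max (insert 0 (abs ` X)))"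
  have "X \<subseteq> {- int N..int N}" if "m \<le> N" for N
  proof
    fix i assume "i \<in> X"
    then have "\<bar>i\<bar> \<le> Max (insert 0 (abs ` X))"
      using X by (intro Max_ge) auto
    then show "i \<in> {- int N..int N}"
      using that by (auto simp: m_def)
  qed
  then show "\<forall>\<^sub>F N in sequentially. finite {- int N..int N} \<and> X \<subseteq> {- int N..int N} \<and> {- int N..int N} \<subseteq> UNIV"
    by (auto intro: eventually_sequentiallyI[of m])
qed

text \<open>Density of the sequences with a starting time. The one-sided remainder is a restriction
  of the symmetric one, hence no larger.\<close>

lemma window_tendsto: "(\<lambda>N. window {- int N..} x) \<longlonglongrightarrow> x"
proof -
  have "(\<lambda>N. window {- int N..int N} x) \<longlonglongrightarrow> x"
    using filterlim_compose[OF single_has_sum[of x, unfolded has_sum_def] filterlim_symmetric_intervals]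
    by (simp add: sum_single)
  then have "(\<lambda>N. x - window {- int N..int N} x) \<longlonglongrightarrow> x - x"
    by (intro tendsto_intros)
  then have z: "(\<lambda>N. norm (x - window {- int N..int N} x)) \<longlonglongrightarrow> 0"
    by (simp add: tendsto_norm_zero)
  have "(\<lambda>N. window {- int N..} x - x) \<longlonglongrightarrow> 0"
  proof (rule Lim_null_comparison[OF _ z], rule always_eventually, rule allI)
    fix N
    have "window {- int N..} x - x = - (window (- {- int N..}) (x - window {- int N..int N} x))"
      by (rule ell2_eqI) auto
    then show "norm (window {- int N..} x - x) \<le> norm (x - window {- int N..int N} x)"
      by (metis norm_minus_cancel norm_window_le)
  qed
  then show ?thesis
    by (simp add: LIM_zero_iff)
qed

section \<open>Resolvents\<close>

text \<open>Going back \<open>k\<close> steps writes \<open>x i\<close> as the \<open>k\<close>-th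
  power of \<open>A\<close> applied to a bounded vector, which tends to zero. This uniqueness
  principle identifies states throughout.\<close>

lemma half_line_zero:
  fixes x :: "int \<Rightarrow> complex^'n"
  assumes A: "powers_summable A" and b: "\<And>i. norm (x i) \<le> c"
    and rec: "\<And>i. i < N \<Longrightarrow> x (i + 1) = A *v x i" and i: "i \<le> N"
  shows "x i = 0"
proof -
  have it: "x i = mpow A k *v x (i - int k)" for k
  proof (induction k)
    case (Suc k)
    then show ?case
      using rec[of "i - int (Suc k)"] i by (simp add: mpow_Suc2 matrix_vector_mul_assoc[symmetric])
  qed simp
  have "norm (x i) \<le> norm (mpow A k) * c" for k
    using it[of k] norm_matrix_vector_le[of "mpow A k" "x (i - int k)"] b[of "i - int k"]
    by (metis mult_left_mono norm_ge_zero order_trans)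
  moreover have "(\<lambda>k. norm (mpow A k) * c) \<longlonglongrightarrow> 0"
    using A unfolding powers_summable_def by (intro tendsto_mult_left_zero summable_LIMSEQ_zero)
  ultimately have "norm (x i) \<le> 0"
    by (intro LIMSEQ_le_const[of _ 0 "norm (x i)"]) auto
  then show ?thesis
    by simp
qed

text \<open>The inverse of advance minus \<open>A\<close>: the state reached from rest in the
  infinite past, strictly causal in \<open>u\<close>.\<close>

definition resolvent :: "complex^'n^'n \<Rightarrow> (complex^'n) ell2 \<Rightarrow> (complex^'n) ell2" where
  "resolvent A u = Abs_ell2 (\<lambda>i. \<Sum>k. mpow A k *v u $$ (i - 1 - int k))"

context
  fixes A :: "complex^'n^'n"
  assumes A: "powers_summable A"
begin

lemma resolvent_summable: "summable (\<lambda>k. norm (mpow A k *v u $$ (i - 1 - int k)))"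
proof (rule summable_comparison_test'[of "\<lambda>k. norm (mpow A k) * norm u" 0])
  show "summable (\<lambda>k. norm (mpow A k) * norm u)"
    using A unfolding powers_summable_def by (rule summable_mult2)
  show "norm (norm (mpow A k *v u $$ (i - 1 - int k))) \<le> norm (mpow A k) * norm u" for k
    using norm_matrix_vector_le[of "mpow A k" "u $$ (i - 1 - int k)"] norm_ell2_nth_le[of u "i - 1 - int k"]
    by (simp add: order_trans[OF _ mult_left_mono])
qed

text \<open>Young's inequality for convolutions: truncate the sum over powers, use the triangle
  inequality in \<open>ell2\<close>, and pass to the limit on finite windows.\<close>

lemma resolvent_nth: "resolvent A u $$ i = (\<Sum>k. mpow A k *v u $$ (i - 1 - int k))"
  and norm_resolvent_le: "norm (resolvent A u) \<le> suminf (\<lambda>k. norm (mpow A k)) * norm u"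
proof -
  let ?B = "suminf (\<lambda>k. norm (mpow A k))"
  let ?x = "\<lambda>i. \<Sum>k. mpow A k *v u $$ (i - 1 - int k)"
  have b: "L2_set (\<lambda>i. norm (?x i)) I \<le> ?B * norm u" if I: "finite I" for I
  proof (rule LIMSEQ_le_const2)
    let ?y = "\<lambda>K. \<Sum>k<K. mpow A k \<rhd> shift (- 1 - int k) u"
    have yi: "?y K $$ i = (\<Sum>k<K. mpow A k *v u $$ (i - 1 - int k))" for K i
      by (simp add: ell2_nth_sum algebra_simps)
    have "(\<lambda>K. ?y K $$ i) \<longlonglongrightarrow> ?x i" for i
      unfolding yi using summable_norm_cancel[OF resolvent_summable] summable_LIMSEQ by blast
    then show "(\<lambda>K. L2_set (\<lambda>i. norm (?y K $$ i)) I) \<longlonglongrightarrow> L2_set (\<lambda>i. norm (?x i)) I"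
      unfolding L2_set_def by (intro tendsto_intros)
    have "norm (?y K) \<le> ?B * norm u" for K
    proof -
      have "norm (?y K) \<le> (\<Sum>k<K. norm (mpow A k) * norm u)"
        by (rule sum_norm_le) (metis norm_pointwise_le norm_shift)
      also have "\<dots> \<le> ?B * norm u"
        unfolding sum_distrib_right[symmetric] using A
        by (intro mult_right_mono sum_le_suminf) (auto simp: powers_summable_def)
      finally show ?thesis .
    qed
    then show "\<exists>N. \<forall>K\<ge>N. L2_set (\<lambda>i. norm (?y K $$ i)) I \<le> ?B * norm u"
      using L2_set_ell2_le[OF I] order_trans by blast
  qed
  then show nth: "resolvent A u $$ i = ?x i" for i
    using ell2_of_bounded(1)[OF b] by (simp add: resolvent_def Abs_ell2_inverse)
  obtain x where x: "\<And>i. x $$ i = ?x i" "norm x \<le> ?B * norm u"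
    using ell2_of_bounded(2)[OF b] by blast
  then have "resolvent A u = x"
    by (intro ell2_eqI) (simp add: nth)
  then show "norm (resolvent A u) \<le> ?B * norm u"
    using x by simp
qed

lemma resolvent: "shift 1 (resolvent A u) = A \<rhd> resolvent A u + u"
proof (rule ell2_eqI)
  fix i
  have s: "summable (\<lambda>k. mpow A k *v u $$ (i' - 1 - int k))" for i'
    using summable_norm_cancel[OF resolvent_summable] .
  have "resolvent A u $$ (i + 1) = u $$ i + (\<Sum>k. mpow A (Suc k) *v u $$ (i - 1 - int k))"
    unfolding resolvent_nth using suminf_split_head[OF s[of "i + 1"]] by (simp add: algebra_simps)
  also have "(\<Sum>k. mpow A (Suc k) *v u $$ (i - 1 - int k)) = A *v resolvent A u $$ i"
    unfolding resolvent_nth bounded_linear.suminf[OF bounded_linear_matrix_vector s]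
    by (simp add: mpow_Suc matrix_vector_mul_assoc)
  finally show "shift 1 (resolvent A u) $$ i = (A \<rhd> resolvent A u + u) $$ i"
    by simp
qed

lemma resolvent_unique:
  assumes "shift 1 x = A \<rhd> x + u"
  shows "x = resolvent A u"
proof (rule ell2_eqI)
  fix i
  let ?d = "x - resolvent A u"
  have "shift 1 ?d = A \<rhd> ?d"
    using assms resolvent[of u] by (simp add: shift_diff pointwise_diff)
  then have "?d $$ (j + 1) = A *v ?d $$ j" for j
    by (metis shift.rep_eq pointwise.rep_eq)
  then have "?d $$ i = 0"
    by (intro half_line_zero[OF A norm_ell2_nth_le, where N=i]) auto
  then show "x $$ i = resolvent A u $$ i"
    by simp
qed

lemma bounded_linear_resolvent: "bounded_linear (resolvent A)"
proof (rule bounded_linear_intro)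
  show "resolvent A (x + y) = resolvent A x + resolvent A y" for x y
    using resolvent[of x] resolvent[of y]
    by (intro resolvent_unique[symmetric]) (simp add: shift_add pointwise_add)
  show "resolvent A (r *\<^sub>R x) = r *\<^sub>R resolvent A x" for r x
    using arg_cong[OF resolvent[of x], of "scaleR r"]
    by (intro resolvent_unique[symmetric]) (simp add: pointwise_scaleR scaleR_add_right shift_scaleR)
  show "norm (resolvent A x) \<le> norm x * suminf (\<lambda>k. norm (mpow A k))" for x
    using norm_resolvent_le[of x] by (simp add: mult.commute)
qed

lemma resolvent_start:
  assumes "\<And>i. i < N \<Longrightarrow> u $$ i = 0" "i \<le> N"
  shows "resolvent A u $$ i = 0"
proof (rule half_line_zero[OF A norm_ell2_nth_le _ assms(2)])
  show "resolvent A u $$ (i + 1) = A *v resolvent A u $$ i" if "i < N" for i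
    using arg_cong[OF resolvent[of u], of "\<lambda>x. x $$ i"] assms(1)[OF that] by simp
qed

text \<open>The same bound for absolute sums, so that Fourier series of impulse responses converge
  absolutely.\<close>

lemma resolvent_abs_summable:
  assumes u: "(\<lambda>i. norm (u $$ i)) summable_on UNIV"
  shows "(\<lambda>i. norm (resolvent A u $$ i)) summable_on UNIV"
proof (rule nonneg_bdd_above_summable_on)
  let ?S = "infsum (\<lambda>i. norm (u $$ i)) UNIV"
  show "bdd_above (sum (\<lambda>i. norm (resolvent A u $$ i)) ` {F. F \<subseteq> UNIV \<and> finite F})"
  proof (rule bdd_aboveI2)
    fix I :: "int set" assume I: "I \<in> {F. F \<subseteq> UNIV \<and> finite F}"
    have le: "norm (mpow A k *v u $$ (i - 1 - int k)) \<le> norm (mpow A k) * norm (u $$ (i - 1 - int k))" for i k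
      by (rule norm_matrix_vector_le)
    have sm: "summable (\<lambda>k. norm (mpow A k) * ?S)"
      using A unfolding powers_summable_def by (rule summable_mult2)
    have "(\<Sum>i\<in>I. norm (resolvent A u $$ i)) \<le> (\<Sum>i\<in>I. \<Sum>k. norm (mpow A k *v u $$ (i - 1 - int k)))"
      unfolding resolvent_nth by (intro sum_mono summable_norm resolvent_summable)
    also have "\<dots> = (\<Sum>k. \<Sum>i\<in>I. norm (mpow A k *v u $$ (i - 1 - int k)))"
      by (intro suminf_sum[symmetric] resolvent_summable)
    also have "\<dots> \<le> (\<Sum>k. norm (mpow A k) * ?S)"
    proof (rule suminf_le[OF _ summable_sum[OF resolvent_summable] sm])
      fix k
      have "(\<Sum>i\<in>I. norm (u $$ (i - 1 - int k))) = (\<Sum>i\<in>(\<lambda>i. i - 1 - int k) ` I. norm (u $$ i))"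
        by (simp add: sum.reindex inj_on_def)
      also have "\<dots> \<le> ?S"
        using I by (intro finite_sum_le_infsum u) auto
      finally show "(\<Sum>i\<in>I. norm (mpow A k *v u $$ (i - 1 - int k))) \<le> norm (mpow A k) * ?S"
        by (intro order_trans[OF sum_mono[OF le]]) (simp add: sum_distrib_left[symmetric] mult_left_mono)
    qed
    finally show "(\<Sum>i\<in>I. norm (resolvent A u $$ i)) \<le> (\<Sum>k. norm (mpow A k) * ?S)" .
  qed
qed simp

end

text \<open>The resolvent in reversed time. The inner \<open>shift 1\<close> makes the value at
  \<open>i\<close> include the input at \<open>i\<close>, unlike the strictly causal
  \<open>resolvent\<close>.\<close>

definition anti_resolvent :: "complex^'n^'n \<Rightarrow> (complex^'n) ell2 \<Rightarrow> (complex^'n) ell2" where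
  "anti_resolvent A u = reverse (resolvent A (shift 1 (reverse u)))"

lemma reverse_reverse [simp]: "reverse (reverse x) = x"
  by (rule ell2_eqI) simp

lemma half_line_zero_anti:
  fixes x :: "int \<Rightarrow> complex^'n"
  assumes A: "powers_summable A" and b: "\<And>i. norm (x i) \<le> c"
    and rec: "\<And>i. N \<le> i \<Longrightarrow> x i = A *v x (i + 1)" and i: "N \<le> i"
  shows "x i = 0"
  using half_line_zero[of A "\<lambda>i. x (- i)" c "- N" "- i"] rec[of "- _ - 1"] A b i by simp

context
  fixes A :: "complex^'n^'n"
  assumes A: "powers_summable A"
begin

lemma anti_resolvent: "anti_resolvent A u = A \<rhd> shift 1 (anti_resolvent A u) + u"
proof (rule ell2_eqI)
  fix i
  show "anti_resolvent A u $$ i = (A \<rhd> shift 1 (anti_resolvent A u) + u) $$ i"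
    using arg_cong[OF resolvent[OF A, of "shift 1 (reverse u)"], of "\<lambda>x. x $$ (- i - 1)"]
    by (simp add: anti_resolvent_def)
qed

lemma resolvent_nth_Suc: "resolvent A u $$ (i + 1) = A *v (resolvent A u $$ i) + u $$ i"
  using arg_cong[OF resolvent[OF A], of "\<lambda>x. x $$ i"] by simp

lemma anti_resolvent_unique:
  assumes "x = A \<rhd> shift 1 x + u"
  shows "x = anti_resolvent A u"
proof -
  have "reverse x = resolvent A (shift 1 (reverse u))"
  proof (rule resolvent_unique[OF A], rule ell2_eqI)
    fix i
    show "shift 1 (reverse x) $$ i = (A \<rhd> reverse x + shift 1 (reverse u)) $$ i"
      using arg_cong[OF assms, of "\<lambda>x. x $$ (- i - 1)"] by simp
  qed
  then show ?thesis
    by (metis anti_resolvent_def reverse_reverse)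
qed

lemma bounded_linear_anti_resolvent: "bounded_linear (anti_resolvent A)"
  unfolding anti_resolvent_def
  by (rule bounded_linear_compose[OF bounded_linear_reverse
        bounded_linear_compose[OF bounded_linear_resolvent[OF A]
        bounded_linear_compose[OF bounded_linear_shift bounded_linear_reverse]]])

lemma anti_resolvent_start:
  assumes "\<And>i. N \<le> i \<Longrightarrow> u $$ i = 0" "N \<le> i"
  shows "anti_resolvent A u $$ i = 0"
  using resolvent_start[OF A, of "- N" "shift 1 (reverse u)" "- i"] assms by (simp add: anti_resolvent_def)

lemma anti_resolvent_shift: "anti_resolvent A (shift k u) = shift k (anti_resolvent A u)"
proof (rule anti_resolvent_unique[symmetric])
  show "shift k (anti_resolvent A u) = A \<rhd> shift 1 (shift k (anti_resolvent A u)) + shift k u"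
    by (subst (1) anti_resolvent) (simp add: shift_add shift_pointwise shift_shift add.commute)
qed

lemma anti_resolvent_abs_summable:
  assumes u: "(\<lambda>i. norm (u $$ i)) summable_on UNIV"
  shows "(\<lambda>i. norm (anti_resolvent A u $$ i)) summable_on UNIV"
proof -
  have m: "(\<lambda>i. norm (v $$ (- i))) summable_on UNIV" if "(\<lambda>i. norm (v $$ i)) summable_on UNIV"
    for v :: "(complex^'n) ell2"
    using summable_on_reindex_bij_betw[of "\<lambda>i. - i" UNIV UNIV "\<lambda>i. norm (v $$ i)"] that
    by (simp add: bij_uminus)
  have "(\<lambda>i. norm (shift 1 (reverse u) $$ i)) summable_on UNIV"
    using summable_on_reindex_bij_betw[of "\<lambda>i. i + 1" UNIV UNIV "\<lambda>i. norm (u $$ (- i))"] m[OF u]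
    by (simp add: bij_plus_right)
  then show ?thesis
    unfolding anti_resolvent_def using m[OF resolvent_abs_summable[OF A]] by simp
qed

end

section \<open>Adjoints and block matrices\<close>

text \<open>The coefficients are read off from impulses; testing the functional with their own
  truncations bounds their norm by \<open>K\<close>.\<close>

lemma ell2_riesz:
  fixes \<phi> :: "'a::euclidean_space ell2 \<Rightarrow> real"
  assumes \<phi>: "bounded_linear \<phi>"
  obtains c where "\<And>x. \<phi> x = c \<bullet> x"
proof -
  interpret bounded_linear \<phi> by fact
  obtain K where K: "\<And>x. norm (\<phi> x) \<le> norm x * K" "0 < K"
    using pos_bounded by blast
  define c where "c j = (\<Sum>b\<in>Basis. \<phi> (single j b) *\<^sub>R b)" for j
  have cj: "\<phi> (single j a) = c j \<bullet> a" for j a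
  proof -
    have "\<phi> (single j a) = \<phi> (single j (\<Sum>b\<in>Basis. (a \<bullet> b) *\<^sub>R b))"
      by (simp add: euclidean_representation)
    also have "\<dots> = (\<Sum>b\<in>Basis. (a \<bullet> b) * \<phi> (single j b))"
      by (simp add: linear_sum[OF bounded_linear.linear[OF bounded_linear_single]]
          linear_scale[OF bounded_linear.linear[OF bounded_linear_single]] sum scaleR)
    also have "\<dots> = c j \<bullet> a"
      by (simp add: c_def inner_sum_left inner_commute[of a] mult.commute)
    finally show ?thesis .
  qed
  have "L2_set (\<lambda>i. norm (c i)) I \<le> K" if I: "finite I" for I
  proof -
    let ?x = "\<Sum>j\<in>I. single j (c j)"
    let ?N = "L2_set (\<lambda>i. norm (c i)) I"
    have xi: "?x $$ i = (if i \<in> I then c i else 0)" for i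
      using I by (simp add: ell2_nth_sum)
    have "(norm ?x)\<^sup>2 = (\<Sum>i\<in>I. (norm (c i))\<^sup>2)"
    proof -
      have "?x = window I ?x"
        by (rule ell2_eqI) (simp add: xi)
      then have "(norm ?x)\<^sup>2 = (\<Sum>i\<in>I. (norm (?x $$ i))\<^sup>2)"
        using norm_window_finite[OF I] by metis
      then show ?thesis
        by (simp add: xi)
    qed
    then have nx: "norm ?x = ?N"
      by (metis L2_set_def norm_ge_zero real_sqrt_abs abs_of_nonneg)
    have "?N\<^sup>2 = \<phi> ?x"
      by (simp add: sum cj L2_set_def sum_nonneg power2_norm_eq_inner)
    also have "\<dots> \<le> ?N * K"
      using K(1)[of ?x] nx by simp
    finally show ?thesis
      using K(2) L2_set_nonneg[of "\<lambda>i. norm (c i)" I]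
      by (cases "?N = 0") (auto simp: power2_eq_square less_le mult_le_cancel_left_pos)
  qed
  from ell2_of_bounded(2)[OF this] obtain y where y: "\<And>i. y $$ i = c i"
    by blast
  have "\<phi> x = y \<bullet> x" for x
  proof -
    have "((\<lambda>j. \<phi> (single j (x $$ j))) has_sum \<phi> x) UNIV"
      using has_sum_bounded_linear[OF \<phi> single_has_sum] by (simp add: o_def)
    then show ?thesis
      using inner_ell2_has_sum[of y x] by (simp add: cj y has_sum_unique)
  qed
  then show ?thesis
    using that by blast
qed

text \<open>\<open>adjoint\<close> is defined by choice; the Riesz representation shows that there
  is something to choose.\<close>

lemma ell2_adjoint:
  fixes f :: "'a::euclidean_space ell2 \<Rightarrow> 'b::real_inner"
  assumes f: "bounded_linear f"
  shows "f x \<bullet> y = x \<bullet> adjoint f y"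
proof -
  have "\<exists>c. \<forall>x. f x \<bullet> y = x \<bullet> c" for y
  proof -
    have "bounded_linear (\<lambda>x. f x \<bullet> y)"
      using bounded_linear_compose[OF bounded_linear_inner_left f] .
    then obtain c where "\<And>x. f x \<bullet> y = c \<bullet> x"
      using ell2_riesz by blast
    then show ?thesis
      by (metis inner_commute)
  qed
  then have "\<exists>g. \<forall>x y. f x \<bullet> y = x \<bullet> g y"
    by metis
  from someI_ex[OF this] show ?thesis
    unfolding adjoint_def by blast
qed

lemma bounded_linear_adjoint:
  fixes f :: "'a::euclidean_space ell2 \<Rightarrow> 'b::real_inner"
  assumes f: "bounded_linear f"
  shows "bounded_linear (adjoint f)"
proof -
  note adj = ell2_adjoint[OF f]
  obtain K where K: "\<And>x. norm (f x) \<le> norm x * K" "0 < K"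
    using bounded_linear.pos_bounded[OF f] by blast
  show ?thesis
  proof (rule bounded_linear_intro[where K=K])
    show "adjoint f (x + y) = adjoint f x + adjoint f y" for x y
    proof -
      have "z \<bullet> adjoint f (x + y) = z \<bullet> (adjoint f x + adjoint f y)" for z
        by (simp add: inner_add_right adj[symmetric])
      then show ?thesis
        using vector_eq_ldot by blast
    qed
    show "adjoint f (r *\<^sub>R x) = r *\<^sub>R adjoint f x" for r x
    proof -
      have "z \<bullet> adjoint f (r *\<^sub>R x) = z \<bullet> (r *\<^sub>R adjoint f x)" for z
        by (simp add: adj[symmetric])
      then show ?thesis
        using vector_eq_ldot by blast
    qed
    fix y
    let ?z = "adjoint f y"
    have "norm ?z * norm ?z = f ?z \<bullet> y"
      by (simp add: adj power2_norm_eq_inner[symmetric] power2_eq_square)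
    also have "\<dots> \<le> norm (f ?z) * norm y"
      by (rule norm_cauchy_schwarz)
    also have "\<dots> \<le> norm ?z * K * norm y"
      by (intro mult_right_mono K) simp
    finally have "norm ?z * norm ?z \<le> norm ?z * (norm y * K)"
      by (simp add: mult_ac)
    then show "norm ?z \<le> norm y * K"
      using K(2) by (cases "norm ?z = 0") auto
  qed
qed

text \<open>For a difference of two Gram operators, which is self-adjoint, the operator norm is the
  numerical radius.\<close>

lemma onorm_gram_difference_le_iff:
  fixes S T :: "'a::euclidean_space ell2 \<Rightarrow> 'b::real_inner"
  assumes S: "bounded_linear S" and T: "bounded_linear T" and c: "0 \<le> c"
  shows "onorm (\<lambda>d. adjoint S (S d) - adjoint T (T d)) \<le> c \<longleftrightarrow>
    (\<forall>d. \<bar>(norm (S d))\<^sup>2 - (norm (T d))\<^sup>2\<bar> \<le> c * (norm d)\<^sup>2)"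
proof -
  let ?R = "\<lambda>d. adjoint S (S d) - adjoint T (T d)"
  have R: "bounded_linear ?R"
    by (intro bounded_linear_sub bounded_linear_compose[OF bounded_linear_adjoint] S T)
  interpret R: bounded_linear ?R by fact
  have form: "x \<bullet> ?R y = S x \<bullet> S y - T x \<bullet> T y" for x y
    by (simp add: inner_diff_right ell2_adjoint[OF S] ell2_adjoint[OF T])
  have quad: "d \<bullet> ?R d = (norm (S d))\<^sup>2 - (norm (T d))\<^sup>2" for d
    by (simp add: form power2_norm_eq_inner)
  have sym: "x \<bullet> ?R y = y \<bullet> ?R x" for x y
    by (simp add: form inner_commute)
  show ?thesis
  proof
    assume o: "onorm ?R \<le> c"
    show "\<forall>d. \<bar>(norm (S d))\<^sup>2 - (norm (T d))\<^sup>2\<bar> \<le> c * (norm d)\<^sup>2"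
    proof
      fix d
      have "\<bar>d \<bullet> ?R d\<bar> \<le> norm d * norm (?R d)"
        by (rule Cauchy_Schwarz_ineq2)
      also have "\<dots> \<le> norm d * (c * norm d)"
        using order_trans[OF onorm[OF R] mult_right_mono[OF o]] by (intro mult_left_mono) auto
      finally show "\<bar>(norm (S d))\<^sup>2 - (norm (T d))\<^sup>2\<bar> \<le> c * (norm d)\<^sup>2"
        by (simp add: quad power2_eq_square mult_ac)
    qed
  next
    assume q: "\<forall>d. \<bar>(norm (S d))\<^sup>2 - (norm (T d))\<^sup>2\<bar> \<le> c * (norm d)\<^sup>2"
    \<comment> \<open>Polarization: the bilinear value is a difference of two values of the
      quadratic form, each bounded by assumption.\<close>
    have polar: "2 * (x \<bullet> ?R y) \<le> c * ((norm x)\<^sup>2 + (norm y)\<^sup>2)" for x y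
    proof -
      have "4 * (x \<bullet> ?R y) = (x + y) \<bullet> ?R (x + y) - (x - y) \<bullet> ?R (x - y)"
        using sym[of x y] unfolding R.add R.diff by (simp add: inner_add_left inner_add_right inner_diff_left inner_diff_right)
      also have "\<dots> \<le> c * (norm (x + y))\<^sup>2 + c * (norm (x - y))\<^sup>2"
        using q[rule_format, of "x + y"] q[rule_format, of "x - y"] unfolding quad by linarith
      also have "\<dots> = 2 * (c * ((norm x)\<^sup>2 + (norm y)\<^sup>2))"
        by (simp add: power2_norm_eq_inner inner_add_left inner_add_right inner_diff_left inner_diff_right
            inner_commute algebra_simps)
      finally show ?thesis
        by simp
    qed
    show "onorm ?R \<le> c"
    proof (rule onorm_bound[OF c])
      fix x
      show "norm (?R x) \<le> c * norm x"
      proof (cases "x = 0 \<or> ?R x = 0")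
        case True
        then show ?thesis
          using c R.zero by auto
      next
        case False
        \<comment> \<open>The direction of \<open>?R x\<close> at the length of \<open>x\<close>,
          for which the polarized bound is a bound on the norm of \<open>?R x\<close>.\<close>
        define y where "y = (norm x / norm (?R x)) *\<^sub>R ?R x"
        have "y \<bullet> ?R x = norm x * norm (?R x)"
          using False by (simp add: y_def power2_norm_eq_inner[symmetric] power2_eq_square)
        moreover have "norm y = norm x"
          using False by (simp add: y_def)
        ultimately have "2 * (norm x * norm (?R x)) \<le> c * (2 * (norm x)\<^sup>2)"
          using polar[of y x] by simp
        then have "norm x * norm (?R x) \<le> norm x * (c * norm x)"
          by (simp add: power2_eq_square mult_ac)
        then show ?thesis
          using False by simp
      qed
    qed
  qed
qed

lemma block_apply_start:
  assumes "causal M" and d: "\<And>j. j < N \<Longrightarrow> d $$ j = 0"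
  shows "block_apply M d i = (\<Sum>j\<in>{N..i}. M i j *v d $$ j)"
proof -
  have "((\<lambda>j. M i j *v d $$ j) has_sum (\<Sum>j\<in>{N..i}. M i j *v d $$ j)) {N..i}"
    by simp
  then have "((\<lambda>j. M i j *v d $$ j) has_sum (\<Sum>j\<in>{N..i}. M i j *v d $$ j)) UNIV"
  proof (rule has_sum_cong_neutral[THEN iffD1, rotated -1])
    fix j assume "j \<in> UNIV - {N..i}"
    then show "M i j *v d $$ j = 0"
      using assms(1) d[of j] by (cases "i < j") (auto simp: causal_def)
  qed auto
  then show ?thesis
    by (simp add: block_apply_def infsumI)
qed

lemma block_op_nth: "block_bounded M \<Longrightarrow> block_op M d $$ i = block_apply M d i"
  by (simp add: block_bounded_def block_op_def Abs_ell2_inverse)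

text \<open>A bounded operator is determined by its values on impulses, which are the block
  columns.\<close>

lemma block_op_eqI:
  fixes \<Phi> :: "(complex^'d) ell2 \<Rightarrow> (complex^'q) ell2"
  assumes \<Phi>: "bounded_linear \<Phi>" and M: "\<And>i j a. M i j *v a = \<Phi> (single j a) $$ i"
  shows "block_op M = \<Phi>"
proof -
  have h: "((\<lambda>j. M i j *v d $$ j) has_sum \<Phi> d $$ i) UNIV" for i d
    using has_sum_bounded_linear[OF bounded_linear_compose[OF bounded_linear_nth \<Phi>] single_has_sum[of d], of i]
    by (simp add: M o_def)
  then have ap: "block_apply M d = Rep_ell2 (\<Phi> d)" for d
    by (simp add: block_apply_def fun_eq_iff infsumI)
  then show ?thesis
    by (intro ext) (simp only: block_op_def Rep_ell2_inverse)
qed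

section \<open>Energy identities\<close>

lemma pointwise_adjoint_swap: "u \<bullet> (M \<rhd> v) = v \<bullet> (M\<^sup>\<dagger> \<rhd> u)"
  by (metis inner_commute inner_pointwise cadj_cadj)

text \<open>Common core of the \<open>P\<close> and \<open>Q\<close> identities. By shift invariance
  \<open>lam\<close> and \<open>l\<close> carry the same \<open>X\<close> energy; expanding both
  sides leaves the claim, the cross terms cancelling by \<open>AXC\<close>. The adjoint system is
  thus isometric for the weights.\<close>

lemma adjoint_energy:
  assumes lam: "lam = A\<^sup>\<dagger> \<rhd> l + C\<^sup>\<dagger> \<rhd> u" and l: "l = shift 1 lam"
    and X: "X = A ** X ** A\<^sup>\<dagger> + B1 ** S1 ** B1\<^sup>\<dagger> + B2 ** S2 ** B2\<^sup>\<dagger>"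
    and AXC: "A ** X ** C\<^sup>\<dagger> + B2 ** S2 = 0" and CXC: "C ** X ** C\<^sup>\<dagger> + S2 = R"
    and herm: "hermitian X" "hermitian S2"
  shows "(B1\<^sup>\<dagger> \<rhd> l) \<bullet> (S1 \<rhd> B1\<^sup>\<dagger> \<rhd> l) + (u + B2\<^sup>\<dagger> \<rhd> l) \<bullet> (S2 \<rhd> (u + B2\<^sup>\<dagger> \<rhd> l)) = u \<bullet> (R \<rhd> u)"
proof -
  have 1: "l \<bullet> (X \<rhd> l) = lam \<bullet> (X \<rhd> lam)"
    unfolding l by (simp add: shift_pointwise[symmetric] inner_shift)
  have 2: "l \<bullet> (X \<rhd> l) = l \<bullet> ((A ** X ** A\<^sup>\<dagger>) \<rhd> l) + (B1\<^sup>\<dagger> \<rhd> l) \<bullet> (S1 \<rhd> B1\<^sup>\<dagger> \<rhd> l) + (B2\<^sup>\<dagger> \<rhd> l) \<bullet> (S2 \<rhd> B2\<^sup>\<dagger> \<rhd> l)"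
    by (subst X) (simp add: pointwise_add_left inner_add_right inner_pointwise pointwise_mult matrix_mul_assoc)
  have 3: "lam \<bullet> (X \<rhd> lam) = l \<bullet> ((A ** X ** A\<^sup>\<dagger>) \<rhd> l) + l \<bullet> ((A ** X ** C\<^sup>\<dagger>) \<rhd> u)
      + u \<bullet> ((C ** X ** A\<^sup>\<dagger>) \<rhd> l) + u \<bullet> ((C ** X ** C\<^sup>\<dagger>) \<rhd> u)"
    unfolding lam by (simp add: pointwise_add inner_add_left inner_add_right inner_pointwise pointwise_mult matrix_mul_assoc)
  have 4: "u \<bullet> ((C ** X ** A\<^sup>\<dagger>) \<rhd> l) = l \<bullet> ((A ** X ** C\<^sup>\<dagger>) \<rhd> u)"
    using herm(1) by (subst pointwise_adjoint_swap) (simp add: cadj_mult hermitian_def matrix_mul_assoc)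
  have 5: "A ** X ** C\<^sup>\<dagger> = - (B2 ** S2)"
    using AXC by (simp add: add_eq_0_iff2)
  have 6: "u \<bullet> (S2 \<rhd> B2\<^sup>\<dagger> \<rhd> l) = l \<bullet> ((B2 ** S2) \<rhd> u)"
    using herm(2) by (simp add: pointwise_mult) (subst pointwise_adjoint_swap, simp add: cadj_mult hermitian_def)
  have 7: "(B2\<^sup>\<dagger> \<rhd> l) \<bullet> (S2 \<rhd> u) = l \<bullet> ((B2 ** S2) \<rhd> u)"
    by (simp add: inner_pointwise pointwise_mult)
  have 8: "u \<bullet> ((C ** X ** C\<^sup>\<dagger>) \<rhd> u) = u \<bullet> (R \<rhd> u) - u \<bullet> (S2 \<rhd> u)"
    unfolding CXC[symmetric] by (simp add: pointwise_add_left inner_add_right)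
  show ?thesis
    using 1 2 3 4 6 7 8 unfolding 5
    by (simp add: inner_add_left inner_add_right pointwise_add pointwise_minus_left)
qed

text \<open>Summation by parts between a forward state and a backward costate; on the doubly
  infinite time axis there are no boundary terms.\<close>

lemma adjoint_pairing:
  assumes lam: "lam = A\<^sup>\<dagger> \<rhd> l + C\<^sup>\<dagger> \<rhd> u" and l: "l = shift 1 lam"
    and x: "shift 1 x = A \<rhd> x + B1 \<rhd> w + B2 \<rhd> g"
  shows "(C \<rhd> x + g) \<bullet> u = w \<bullet> (B1\<^sup>\<dagger> \<rhd> l) + g \<bullet> (u + B2\<^sup>\<dagger> \<rhd> l)"
proof -
  have "(C \<rhd> x) \<bullet> u = x \<bullet> (lam - A\<^sup>\<dagger> \<rhd> l)"
    using lam by (simp add: inner_pointwise)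
  also have "\<dots> = shift 1 x \<bullet> l - (A \<rhd> x) \<bullet> l"
    unfolding l by (simp add: inner_diff_right inner_shift inner_pointwise)
  also have "\<dots> = w \<bullet> (B1\<^sup>\<dagger> \<rhd> l) + g \<bullet> (B2\<^sup>\<dagger> \<rhd> l)"
    unfolding x by (simp add: inner_add_left inner_pointwise)
  finally show ?thesis
    by (simp add: inner_add_left inner_add_right)
qed

lemma two_inner_le: "2 * (x \<bullet> y) \<le> c * (norm x)\<^sup>2 + (norm y)\<^sup>2 / c" if "c > 0" for c :: real
proof -
  have "0 \<le> (c *\<^sub>R x - y) \<bullet> (c *\<^sub>R x - y)"
    by simp
  also have "\<dots> = c * (c * (norm x)\<^sup>2 - 2 * (x \<bullet> y) + (norm y)\<^sup>2 / c)"
    using that by (simp add: power2_norm_eq_inner inner_diff_left inner_diff_right inner_commute algebra_simps)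
  finally show ?thesis
    using that by (simp add: zero_le_mult_iff)
qed

text \<open>Completing the square in the metric \<open>R\<close>, with \<open>matrix_inv R\<close>
  as the dual metric.\<close>

lemma weighted_young:
  assumes R: "posdef R" and c: "c > 0"
  shows "2 * (x \<bullet> y) \<le> c * (x \<bullet> (R \<rhd> x)) + (y \<bullet> (matrix_inv R \<rhd> y)) / c"
proof -
  let ?z = "matrix_inv R \<rhd> y"
  have z: "R \<rhd> ?z = y"
    using R by (simp add: pointwise_mult matrix_inv_right_left posdef_def)
  have "0 \<le> (c *\<^sub>R x - ?z) \<bullet> (R \<rhd> (c *\<^sub>R x - ?z))"
    using R by (simp add: pointwise_psd posdef_def)
  also have "\<dots> = c * (c * (x \<bullet> (R \<rhd> x))) - 2 * c * (x \<bullet> y) + y \<bullet> ?z"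
  proof -
    have "?z \<bullet> (R \<rhd> x) = x \<bullet> y"
      using R z pointwise_inner_commute[of R ?z x] by (simp add: posdef_def psd_def)
    then show ?thesis
      by (simp add: inner_diff_left inner_diff_right pointwise_diff pointwise_scaleR z inner_commute)
  qed
  finally have "c * (2 * (x \<bullet> y)) \<le> c * (c * (x \<bullet> (R \<rhd> x)) + (y \<bullet> ?z) / c)"
    using c by (simp add: algebra_simps)
  then show ?thesis
    using c by simp
qed

text \<open>\<open>Y\<close> is the observability Gramian, called \<Pi> in the theorem.\<close>

locale regret_data =
  fixes F :: "complex^'n^'n" and G :: "complex^'m^'n"
    and H :: "complex^'n^'p" and L :: "complex^'n^'q"
    and P W Q U Y Z :: "complex^'n^'n" and \<gamma> :: real
  assumes \<gamma>: "\<gamma> > 0"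
    and stab_P: "stabilizing_P F G H P"
    and stab_W: "stabilizing_W F G H L \<gamma> W"
    and stab_Q: "stabilizing_Q F G L \<gamma> W Q"
    and U_eq: "U = K_Q F G L \<gamma> W Q ** L ** P ** (F_P F H P)\<^sup>\<dagger>
             + F_Q F G L \<gamma> W Q ** U ** (F_P F H P)\<^sup>\<dagger>"
    and Y_eq: "Y = (F_P F H P)\<^sup>\<dagger> ** Y ** F_P F H P
             + H\<^sup>\<dagger> ** matrix_inv (R_P H P) ** H"
    and Z_eq: "Z = F_P F H P ** Z ** (F_P F H P)\<^sup>\<dagger>
             + F_P F H P ** (P - U)\<^sup>\<dagger> ** L\<^sup>\<dagger> ** matrix_inv (R_Q L \<gamma> Q) ** L ** (P - U) ** (F_P F H P)\<^sup>\<dagger>"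
begin

abbreviation "FP \<equiv> F_P F H P"
abbreviation "KP \<equiv> K_P F H P"
abbreviation "RP \<equiv> R_P H P"
abbreviation "RPi \<equiv> matrix_inv RP"
abbreviation "FW \<equiv> F_W F G W"
abbreviation "KW \<equiv> K_W F G W"
abbreviation "RW \<equiv> R_W G W"
abbreviation "RWi \<equiv> matrix_inv RW"
abbreviation "FQ \<equiv> F_Q F G L \<gamma> W Q"
abbreviation "KQ \<equiv> K_Q F G L \<gamma> W Q"
abbreviation "RQ \<equiv> R_Q L \<gamma> Q"
abbreviation "RQi \<equiv> matrix_inv RQ"

lemma powers_FP: "powers_summable FP" and powers_FW: "powers_summable FW" and powers_FQ: "powers_summable FQ"
  using stab_P stab_W stab_Q stable_powers_summable
  by (auto simp: stabilizing_P_def stabilizing_W_def stabilizing_Q_def)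

lemma herm_P: "hermitian P" and herm_W: "hermitian W" and herm_Q: "hermitian Q"
  and inv_RP: "invertible RP" and inv_RW: "invertible RW" and inv_RQ: "invertible RQ"
  using stab_P stab_W stab_Q by (auto simp: stabilizing_P_def stabilizing_W_def stabilizing_Q_def)

lemma adj_PWQ [simp]: "P\<^sup>\<dagger> = P" "W\<^sup>\<dagger> = W" "Q\<^sup>\<dagger> = Q"
  using herm_P herm_W herm_Q by (auto simp: hermitian_def)

lemma herm_RP: "hermitian RP" and herm_RW: "hermitian RW" and herm_RQ: "hermitian RQ"
  by (simp_all add: hermitian_def R_P_def R_W_def R_Q_def cadj_add cadj_mult cadj_scaleR matrix_mul_assoc)

lemma KP_RP: "KP ** RP = F ** P ** H\<^sup>\<dagger>"
  by (simp add: K_P_def matrix_mul_assoc[symmetric] matrix_inv_right_left[OF inv_RP])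

lemma RW_KW: "RW ** KW = G\<^sup>\<dagger> ** W ** F"
  by (simp add: K_W_def matrix_mul_assoc matrix_inv_right_left[OF inv_RW])

lemma KQ_RQ: "KQ ** RQ = FW ** Q ** L\<^sup>\<dagger>"
  by (simp add: K_Q_def matrix_mul_assoc[symmetric] matrix_inv_right_left[OF inv_RQ])

section \<open>Closed-loop forms of the Riccati equations\<close>

lemma FP_P_H: "FP ** P ** H\<^sup>\<dagger> = KP"
proof -
  have "KP ** (H ** P ** H\<^sup>\<dagger>) = KP ** RP - KP"
    by (simp add: R_P_def matrix_algebra)
  then show ?thesis
    by (simp add: F_P_def matrix_algebra KP_RP)
qed

lemma P_FP_F: "P = G ** G\<^sup>\<dagger> + FP ** P ** F\<^sup>\<dagger>"
proof -
  have "P = G ** G\<^sup>\<dagger> + F ** P ** F\<^sup>\<dagger> - F ** P ** H\<^sup>\<dagger> ** RPi ** H ** P ** F\<^sup>\<dagger>"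
    using stab_P unfolding stabilizing_P_def by blast
  also have "\<dots> = G ** G\<^sup>\<dagger> + FP ** P ** F\<^sup>\<dagger>"
    by (simp add: F_P_def K_P_def matrix_algebra)
  finally show ?thesis .
qed

lemma F_P_FP_adj: "F ** P ** FP\<^sup>\<dagger> = P - G ** G\<^sup>\<dagger>"
  using arg_cong[OF P_FP_F, of cadj] by (simp add: cadj_add cadj_mult matrix_mul_assoc algebra_simps)

lemma H_P_FP_adj: "H ** P ** FP\<^sup>\<dagger> = KP\<^sup>\<dagger>"
  using arg_cong[OF FP_P_H, of cadj] by (simp add: cadj_mult matrix_mul_assoc)

text \<open>The Joseph form: a Lyapunov equation in \<open>FP\<close> with a sum of squares as
  source, as \<open>adjoint_energy\<close> requires.\<close>

lemma P_joseph: "P = FP ** P ** FP\<^sup>\<dagger> + G ** G\<^sup>\<dagger> + KP ** KP\<^sup>\<dagger>"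
proof -
  have F: "F\<^sup>\<dagger> = FP\<^sup>\<dagger> + H\<^sup>\<dagger> ** KP\<^sup>\<dagger>"
    by (simp add: F_P_def cadj_diff cadj_mult)
  have "FP ** P ** F\<^sup>\<dagger> = FP ** P ** FP\<^sup>\<dagger> + KP ** KP\<^sup>\<dagger>"
    unfolding F by (simp add: matrix_add_ldistrib matrix_mul_assoc FP_P_H)
  then show ?thesis
    by (intro trans[OF P_FP_F]) (simp add: add_ac)
qed

lemma G_W_FW: "G\<^sup>\<dagger> ** W ** FW = KW"
proof -
  have "(G\<^sup>\<dagger> ** W ** G) ** KW = RW ** KW - KW"
    by (simp add: R_W_def matrix_algebra)
  then show ?thesis
    by (simp add: F_W_def matrix_algebra RW_KW)
qed

lemma W_joseph: "W = H\<^sup>\<dagger> ** H + (1 / \<gamma>\<^sup>2) *\<^sub>R (L\<^sup>\<dagger> ** L) + FW\<^sup>\<dagger> ** W ** FW + KW\<^sup>\<dagger> ** KW"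
proof -
  have F: "F = FW + G ** KW"
    by (simp add: F_W_def)
  have adj: "FW\<^sup>\<dagger> ** W ** G = KW\<^sup>\<dagger>"
    using arg_cong[OF G_W_FW, of cadj] by (simp add: cadj_mult matrix_mul_assoc)
  have "F\<^sup>\<dagger> ** W ** F - KW\<^sup>\<dagger> ** RW ** KW = FW\<^sup>\<dagger> ** W ** F"
  proof -
    have "KW\<^sup>\<dagger> ** RW ** KW = KW\<^sup>\<dagger> ** (G\<^sup>\<dagger> ** W ** F)"
      by (simp only: RW_KW[symmetric] matrix_mul_assoc)
    then show ?thesis
      unfolding F_W_def by (simp add: cadj_diff cadj_mult matrix_algebra)
  qed
  also have "\<dots> = FW\<^sup>\<dagger> ** W ** FW + KW\<^sup>\<dagger> ** KW"
    by (subst (2) F) (simp add: matrix_add_ldistrib matrix_mul_assoc adj)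
  finally have "F\<^sup>\<dagger> ** W ** F - KW\<^sup>\<dagger> ** RW ** KW = FW\<^sup>\<dagger> ** W ** FW + KW\<^sup>\<dagger> ** KW" .
  moreover have "W = H\<^sup>\<dagger> ** H + (1 / \<gamma>\<^sup>2) *\<^sub>R (L\<^sup>\<dagger> ** L) + F\<^sup>\<dagger> ** W ** F - KW\<^sup>\<dagger> ** RW ** KW"
    using stab_W unfolding stabilizing_W_def by blast
  ultimately show ?thesis
    by (elim trans) (simp add: add.assoc add_diff_eq[symmetric])
qed

lemma FW_FQ: "FW = FQ + KQ ** L"
  by (simp add: F_Q_def)

text \<open>The equation for \<open>U\<close> rewritten with \<open>FW\<close>. Along a costate
  \<open>p\<close>, up to a term in the current innovation, \<open>U p\<close> is then a state of
  \<open>FW\<close> driven through \<open>KQ\<close> by the anticausal signal later called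
  \<open>NQ p\<close>.\<close>

lemma U_step: "U = (KQ ** L ** (P - U) + FW ** U) ** FP\<^sup>\<dagger>"
proof -
  have "KQ ** L ** (P - U) + FW ** U = KQ ** L ** P + FQ ** U"
    unfolding FW_FQ by (simp add: matrix_algebra)
  then show ?thesis
    by (intro trans[OF U_eq]) (simp add: matrix_add_rdistrib')
qed

section \<open>Energy identities and definiteness of the weights\<close>

lemma innovation_energy:
  assumes "p = FP\<^sup>\<dagger> \<rhd> l + H\<^sup>\<dagger> \<rhd> \<nu>" "l = shift 1 p"
  shows "(norm (G\<^sup>\<dagger> \<rhd> l))\<^sup>2 + (norm (\<nu> - KP\<^sup>\<dagger> \<rhd> l))\<^sup>2 = \<nu> \<bullet> (RP \<rhd> \<nu>)"
proof -
  have X: "P = FP ** P ** FP\<^sup>\<dagger> + G ** mat 1 ** G\<^sup>\<dagger> + (- KP) ** mat 1 ** (- KP)\<^sup>\<dagger>"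
    by (rule trans[OF P_joseph]) (simp add: cadj_uminus matrix_mult_uminus_left matrix_mult_uminus_right)
  have "(G\<^sup>\<dagger> \<rhd> l) \<bullet> (mat 1 \<rhd> G\<^sup>\<dagger> \<rhd> l) + (\<nu> + (- KP)\<^sup>\<dagger> \<rhd> l) \<bullet> (mat 1 \<rhd> (\<nu> + (- KP)\<^sup>\<dagger> \<rhd> l)) = \<nu> \<bullet> (RP \<rhd> \<nu>)"
    by (rule adjoint_energy[OF assms X]) (simp_all add: FP_P_H herm_P R_P_def hermitian_def add.commute)
  then show ?thesis
    by (simp add: power2_norm_eq_inner cadj_uminus pointwise_minus_left)
qed

text \<open>An impulse turns \<open>innovation_energy\<close> into a sum of squares;
  \<open>stabilizing_P\<close> itself supplies only symmetry and invertibility.\<close>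

lemma posdef_RP: "posdef RP"
  unfolding posdef_def
proof (intro conjI psdI herm_RP inv_RP)
  fix a
  let ?p = "anti_resolvent (FP\<^sup>\<dagger>) (H\<^sup>\<dagger> \<rhd> single 0 a)"
  have "0 \<le> single 0 a \<bullet> (RP \<rhd> single 0 a)"
    unfolding innovation_energy[OF anti_resolvent[OF powers_summable_cadj[OF powers_FP]] refl, of "single 0 a", symmetric]
    by simp
  then show "0 \<le> a \<bullet> (RP *v a)"
    by (simp add: inner_single)
qed

text \<open>Completion of squares with the shift-invariant storage
  \<open>x \<bullet> (W \<rhd> x)\<close>; \<open>om\<close> is the deviation of the input from the
  feedback \<open>- (KW \<rhd> x)\<close>.\<close>

lemma regulator_energy:
  assumes x: "shift 1 x = FW \<rhd> x + G \<rhd> om"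
  shows "(norm (om - KW \<rhd> x))\<^sup>2 + (norm (H \<rhd> x))\<^sup>2 + (norm (L \<rhd> x))\<^sup>2 / \<gamma>\<^sup>2 = om \<bullet> (RW \<rhd> om)"
proof -
  have 1: "x \<bullet> (W \<rhd> x) = shift 1 x \<bullet> (W \<rhd> shift 1 x)"
    by (simp add: shift_pointwise[symmetric] inner_shift)
  have 2: "x \<bullet> (W \<rhd> x) = (norm (H \<rhd> x))\<^sup>2 + (norm (L \<rhd> x))\<^sup>2 / \<gamma>\<^sup>2 + x \<bullet> ((FW\<^sup>\<dagger> ** W ** FW) \<rhd> x) + (norm (KW \<rhd> x))\<^sup>2"
    by (subst W_joseph)
      (simp add: pointwise_add_left pointwise_scaleR_left inner_add_right power2_norm_eq_inner
        inner_pointwise pointwise_mult)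
  have 3: "shift 1 x \<bullet> (W \<rhd> shift 1 x) = x \<bullet> ((FW\<^sup>\<dagger> ** W ** FW) \<rhd> x) + 2 * (om \<bullet> (KW \<rhd> x)) + om \<bullet> ((G\<^sup>\<dagger> ** W ** G) \<rhd> om)"
  proof -
    have "x \<bullet> ((FW\<^sup>\<dagger> ** W ** G) \<rhd> om) = om \<bullet> (KW \<rhd> x)"
      by (subst pointwise_adjoint_swap) (simp add: cadj_mult matrix_mul_assoc G_W_FW)
    then show ?thesis
      unfolding x by (simp add: pointwise_add inner_add_left inner_add_right inner_pointwise pointwise_mult
          matrix_mul_assoc G_W_FW)
  qed
  have 4: "om \<bullet> (RW \<rhd> om) = (norm om)\<^sup>2 + om \<bullet> ((G\<^sup>\<dagger> ** W ** G) \<rhd> om)"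
    by (simp add: R_W_def pointwise_add_left inner_add_right power2_norm_eq_inner)
  have 5: "(norm (om - KW \<rhd> x))\<^sup>2 = (norm om)\<^sup>2 - 2 * (om \<bullet> (KW \<rhd> x)) + (norm (KW \<rhd> x))\<^sup>2"
    by (simp add: power2_norm_eq_inner inner_diff_left inner_diff_right inner_commute)
  show ?thesis
    using 1 2 3 4 5 by linarith
qed

lemma posdef_RW: "posdef RW"
  unfolding posdef_def
proof (intro conjI psdI herm_RW inv_RW)
  fix a
  have "0 \<le> single 0 a \<bullet> (RW \<rhd> single 0 a)"
    unfolding regulator_energy[OF resolvent[OF powers_FW], symmetric] by simp
  then show "0 \<le> a \<bullet> (RW *v a)"
    by (simp add: inner_single)
qed

text \<open>The storage is \<open>- Q\<close>, whose equation is a Lyapunov equation with sources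
  weighted by \<open>RWi\<close> and \<open>RQ\<close>. If \<open>T\<close> and \<open>M\<close> map
  \<open>om\<close> and \<open>g\<close> to \<open>L x + g\<close>, with \<open>x\<close> driven by
  both through \<open>FW\<close>, this is the spectral factorization
  \<open>\<gamma>\<^sup>2 = T RWi T' + M RQ M'\<close>, primes denoting adjoints.\<close>

lemma Q_energy:
  assumes "lam = FW\<^sup>\<dagger> \<rhd> l + L\<^sup>\<dagger> \<rhd> u" "l = shift 1 lam"
  shows "(G\<^sup>\<dagger> \<rhd> l) \<bullet> (RWi \<rhd> G\<^sup>\<dagger> \<rhd> l) + (u + KQ\<^sup>\<dagger> \<rhd> l) \<bullet> (RQ \<rhd> (u + KQ\<^sup>\<dagger> \<rhd> l)) = \<gamma>\<^sup>2 * (norm u)\<^sup>2"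
proof -
  have "Q = - (G ** RWi ** G\<^sup>\<dagger>) + FW ** Q ** FW\<^sup>\<dagger> - KQ ** RQ ** KQ\<^sup>\<dagger>"
    using stab_Q unfolding stabilizing_Q_def by blast
  then have "- Q = - (- (G ** RWi ** G\<^sup>\<dagger>) + FW ** Q ** FW\<^sup>\<dagger> - KQ ** RQ ** KQ\<^sup>\<dagger>)"
    by (rule arg_cong)
  also have "\<dots> = FW ** (- Q) ** FW\<^sup>\<dagger> + G ** RWi ** G\<^sup>\<dagger> + KQ ** RQ ** KQ\<^sup>\<dagger>"
    by (simp add: matrix_mult_uminus_left matrix_mult_uminus_right)
  finally have X: "- Q = FW ** (- Q) ** FW\<^sup>\<dagger> + G ** RWi ** G\<^sup>\<dagger> + KQ ** RQ ** KQ\<^sup>\<dagger>" .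
  have CXC: "L ** (- Q) ** L\<^sup>\<dagger> + RQ = \<gamma>\<^sup>2 *\<^sub>R mat 1"
    by (simp add: R_Q_def matrix_mult_uminus_left matrix_mult_uminus_right)
  have "hermitian (- Q)"
    by (simp add: hermitian_def cadj_uminus)
  then have "(G\<^sup>\<dagger> \<rhd> l) \<bullet> (RWi \<rhd> G\<^sup>\<dagger> \<rhd> l) + (u + KQ\<^sup>\<dagger> \<rhd> l) \<bullet> (RQ \<rhd> (u + KQ\<^sup>\<dagger> \<rhd> l)) = u \<bullet> ((\<gamma>\<^sup>2 *\<^sub>R mat 1) \<rhd> u)"
    by (intro adjoint_energy[OF assms X _ CXC])
       (simp_all add: KQ_RQ herm_RQ matrix_mult_uminus_left matrix_mult_uminus_right)
  then show ?thesis
    by (simp add: pointwise_scaleR_left power2_norm_eq_inner)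
qed

lemmas Q_pairing = adjoint_pairing[where A=FW and C=L and ?B1.0=G and ?B2.0=KQ]

text \<open>With \<open>u\<close> as in the conclusion, the combination
  \<open>u + KQ\<^sup>\<dagger> \<rhd> l\<close> weighed by \<open>RQ\<close> in
  \<open>Q_energy\<close> is the prescribed \<open>g\<close>. This inverts the adjoint of
  \<open>M\<close>, using the stable \<open>FQ\<close>.\<close>

lemma FQ_costate:
  assumes "lam = FQ\<^sup>\<dagger> \<rhd> l + L\<^sup>\<dagger> \<rhd> g"
  shows "lam = FW\<^sup>\<dagger> \<rhd> l + L\<^sup>\<dagger> \<rhd> (g - KQ\<^sup>\<dagger> \<rhd> l)"
proof -
  have "FW\<^sup>\<dagger> = FQ\<^sup>\<dagger> + L\<^sup>\<dagger> ** KQ\<^sup>\<dagger>"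
    using arg_cong[OF FW_FQ, of cadj] by (simp add: cadj_add cadj_mult)
  then show ?thesis
    by (simp add: assms pointwise_algebra pointwise_mult)
qed

text \<open>The \<open>W\<close> identity bounds \<open>om \<mapsto> L x\<close> by \<gamma> in the
  weight \<open>RW\<close>, hence the \<open>RWi\<close> term of \<open>Q_energy\<close> by its
  right-hand side. What remains is the \<open>RQ\<close> form at a prescribed
  \<open>g\<close>.\<close>

lemma posdef_RQ: "posdef RQ"
  unfolding posdef_def
proof (intro conjI psdI herm_RQ inv_RQ)
  fix a
  define g :: "(complex^'q) ell2" where "g = single 0 a"
  define lam where "lam = anti_resolvent (FQ\<^sup>\<dagger>) (L\<^sup>\<dagger> \<rhd> g)"
  define l where "l = shift 1 lam"
  define u where "u = g - KQ\<^sup>\<dagger> \<rhd> l"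
  have lam: "lam = FW\<^sup>\<dagger> \<rhd> l + L\<^sup>\<dagger> \<rhd> u"
    unfolding u_def l_def lam_def
    by (rule FQ_costate[OF anti_resolvent[OF powers_summable_cadj[OF powers_FQ]]])
  define s where "s = (G\<^sup>\<dagger> \<rhd> l) \<bullet> (RWi \<rhd> G\<^sup>\<dagger> \<rhd> l)"
  define om where "om = RWi \<rhd> G\<^sup>\<dagger> \<rhd> l"
  define x where "x = resolvent FW (G \<rhd> om)"
  have x: "shift 1 x = FW \<rhd> x + G \<rhd> om"
    unfolding x_def by (rule resolvent[OF powers_FW])
  have "RW \<rhd> om = G\<^sup>\<dagger> \<rhd> l"
    by (simp add: om_def pointwise_mult matrix_mul_assoc matrix_inv_right_left[OF inv_RW])
  then have s: "om \<bullet> (RW \<rhd> om) = s" "om \<bullet> (G\<^sup>\<dagger> \<rhd> l) = s"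
    by (simp_all add: s_def om_def inner_commute)
  have "(L \<rhd> x) \<bullet> u = s"
    using Q_pairing[OF lam l_def, of x om 0] x s by simp
  moreover have "2 * ((L \<rhd> x) \<bullet> u) \<le> (norm (L \<rhd> x))\<^sup>2 / \<gamma>\<^sup>2 + \<gamma>\<^sup>2 * (norm u)\<^sup>2"
    using two_inner_le[of "1 / \<gamma>\<^sup>2" "L \<rhd> x" u] \<gamma> by (simp add: mult.commute)
  moreover have "(norm (L \<rhd> x))\<^sup>2 / \<gamma>\<^sup>2 \<le> s"
    using regulator_energy[OF x] s by (metis add_increasing le_add_same_cancel2 order_refl zero_le_power2 add_nonneg_nonneg)
  ultimately have "s \<le> \<gamma>\<^sup>2 * (norm u)\<^sup>2"
    by linarith
  moreover have "s + g \<bullet> (RQ \<rhd> g) = \<gamma>\<^sup>2 * (norm u)\<^sup>2"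
    using Q_energy[OF lam l_def] by (simp add: s_def u_def)
  ultimately have "0 \<le> g \<bullet> (RQ \<rhd> g)"
    by linarith
  then show "0 \<le> a \<bullet> (RQ *v a)"
    by (simp add: g_def inner_single)
qed

text \<open>Pair the output \<open>h\<close> with itself through the adjoint system and split both
  pairings by Young's inequality. By \<open>Q_energy\<close> the dual energies add up to one copy of
  the squared norm of \<open>h\<close>, out of two on the left.\<close>

lemma bounded_real:
  assumes x: "shift 1 x = FW \<rhd> x + G \<rhd> om + KQ \<rhd> g"
  shows "(norm (L \<rhd> x + g))\<^sup>2 \<le> \<gamma>\<^sup>2 * (om \<bullet> (RW \<rhd> om) + g \<bullet> (RQi \<rhd> g))"
proof -
  define h where "h = L \<rhd> x + g"
  define lam where "lam = anti_resolvent (FW\<^sup>\<dagger>) (L\<^sup>\<dagger> \<rhd> h)"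
  define l where "l = shift 1 lam"
  have lam: "lam = FW\<^sup>\<dagger> \<rhd> l + L\<^sup>\<dagger> \<rhd> h"
    unfolding l_def lam_def by (rule anti_resolvent[OF powers_summable_cadj[OF powers_FW]])
  let ?a = "G\<^sup>\<dagger> \<rhd> l" and ?b = "h + KQ\<^sup>\<dagger> \<rhd> l"
  have g2: "\<gamma>\<^sup>2 > 0"
    using \<gamma> by simp
  have "(norm h)\<^sup>2 = om \<bullet> ?a + g \<bullet> ?b"
    using Q_pairing[OF lam l_def x] by (simp add: power2_norm_eq_inner h_def[symmetric])
  moreover have "2 * (om \<bullet> ?a) \<le> \<gamma>\<^sup>2 * (om \<bullet> (RW \<rhd> om)) + (?a \<bullet> (RWi \<rhd> ?a)) / \<gamma>\<^sup>2"
    by (rule weighted_young[OF posdef_RW g2])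
  moreover have "matrix_inv RQi = RQ"
    by (rule matrix_inv_eqI) (rule matrix_inv_right_left[OF inv_RQ])
  then have "2 * (g \<bullet> ?b) \<le> \<gamma>\<^sup>2 * (g \<bullet> (RQi \<rhd> g)) + (?b \<bullet> (RQ \<rhd> ?b)) / \<gamma>\<^sup>2"
    using weighted_young[OF posdef_inv[OF posdef_RQ] g2, of g ?b] by simp
  moreover have "(?a \<bullet> (RWi \<rhd> ?a)) / \<gamma>\<^sup>2 + (?b \<bullet> (RQ \<rhd> ?b)) / \<gamma>\<^sup>2 = (norm h)\<^sup>2"
    using Q_energy[OF lam l_def] \<gamma> by (simp add: add_divide_distrib[symmetric])
  ultimately show ?thesis
    unfolding h_def by (simp add: distrib_left)
qed

end

section \<open>Fourier series\<close>

text \<open>The z-transform at \<open>z = cis t\<close>; this sign of the exponent makes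
  \<open>shift 1\<close> a multiplication by \<open>z\<close>.\<close>

definition fourier :: "(complex^'n) ell2 \<Rightarrow> real \<Rightarrow> complex^'n" where
  "fourier u t = (\<Sum>\<^sub>\<infinity>i. cis (- of_int i * t) *s u $$ i)"

definition abs_sum :: "(complex^'n) ell2 \<Rightarrow> bool" where
  "abs_sum u \<longleftrightarrow> (\<lambda>i. norm (u $$ i)) summable_on UNIV"

lemma norm_vec_smult: "norm (c *s v) = norm c * norm v" for v :: "complex^'n"
  by (simp add: norm_vec_def norm_mult L2_set_right_distrib)

lemma fourier_has_sum:
  assumes "abs_sum u"
  shows "((\<lambda>i. cis (- of_int i * t) *s u $$ i) has_sum fourier u t) UNIV"
  unfolding fourier_def
  by (rule has_sum_infsum, rule abs_summable_summable)
     (use assms in \<open>simp add: abs_sum_def norm_vec_smult\<close>)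

lemma abs_sum_bound:
  "g summable_on UNIV \<Longrightarrow> (\<And>i. norm (u $$ i) \<le> g i) \<Longrightarrow> abs_sum u"
  unfolding abs_sum_def by (erule summable_on_comparison_test) auto

lemma abs_sum_pointwise: "abs_sum u \<Longrightarrow> abs_sum (A \<rhd> u)"
  by (rule abs_sum_bound[where g="\<lambda>i. norm A * norm (u $$ i)"])
     (auto simp: abs_sum_def norm_matrix_vector_le intro: summable_on_cmult_right)

lemma abs_sum_add: "abs_sum u \<Longrightarrow> abs_sum v \<Longrightarrow> abs_sum (u + v)"
  and abs_sum_diff: "abs_sum u \<Longrightarrow> abs_sum v \<Longrightarrow> abs_sum (u - v)"
  by (rule abs_sum_bound[where g="\<lambda>i. norm (u $$ i) + norm (v $$ i)"];
      auto simp: abs_sum_def intro: summable_on_add norm_triangle_ineq norm_triangle_ineq4)+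

lemma abs_sum_shift: "abs_sum u \<Longrightarrow> abs_sum (shift k u)"
  unfolding abs_sum_def
  using summable_on_reindex_bij_betw[of "\<lambda>i. i + k" UNIV UNIV "\<lambda>i. norm (u $$ i)"]
  by (simp add: bij_plus_right)

lemma abs_sum_single: "abs_sum (single j a)"
  unfolding abs_sum_def
  using has_sum_imp_summable[OF has_sum_single_index[of j "\<lambda>i. norm (single j a $$ i)"]] by simp

lemma fourier_pointwise: "abs_sum u \<Longrightarrow> fourier (A \<rhd> u) t = A *v fourier u t"
  using has_sum_bounded_linear[OF bounded_linear_matrix_vector[of A] fourier_has_sum[of u t]]
    fourier_has_sum[OF abs_sum_pointwise[of u A], of t]
  by (simp add: o_def vector_scalar_commute has_sum_unique)

lemma fourier_add: "abs_sum u \<Longrightarrow> abs_sum v \<Longrightarrow> fourier (u + v) t = fourier u t + fourier v t"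
  using has_sum_add[OF fourier_has_sum[of u t] fourier_has_sum[of v t]] fourier_has_sum[OF abs_sum_add[of u v], of t]
  by (simp add: vec.scale_right_distrib has_sum_unique)

lemma fourier_diff: "abs_sum u \<Longrightarrow> abs_sum v \<Longrightarrow> fourier (u - v) t = fourier u t - fourier v t"
  using fourier_add[of "u - v" v t] abs_sum_diff[of u v] by (simp add: algebra_simps)

lemma fourier_shift:
  assumes "abs_sum u"
  shows "fourier (shift 1 u) t = cis t *s fourier u t"
proof -
  have "((\<lambda>i. cis (- of_int (i + 1) * t) *s u $$ (i + 1)) has_sum fourier u t) UNIV"
    using has_sum_reindex_bij_betw[of "\<lambda>i. i + 1" UNIV UNIV "\<lambda>i. cis (- of_int i * t) *s u $$ i"]
      fourier_has_sum[OF assms, of t] by (simp add: bij_plus_right)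
  moreover have "bounded_linear (\<lambda>x :: complex^'a. cis t *s x)"
    by (rule bounded_linear_intro[where K=1]) (auto simp: norm_vec_smult vec.scale_right_distrib vec_eq_iff)
  ultimately have "((\<lambda>i. cis t *s (cis (- of_int (i + 1) * t) *s u $$ (i + 1))) has_sum (cis t *s fourier u t)) UNIV"
    by (rule has_sum_bounded_linear[rotated, unfolded o_def])
  moreover have "cis t *s (cis (- of_int (i + 1) * t) *s u $$ (i + 1)) = cis (- of_int i * t) *s shift 1 u $$ i" for i
    by (simp add: vector_smult_assoc cis_mult algebra_simps)
  ultimately have "((\<lambda>i. cis (- of_int i * t) *s shift 1 u $$ i) has_sum (cis t *s fourier u t)) UNIV"
    by (simp only:)
  then show ?thesis
    by (rule has_sum_unique[OF fourier_has_sum[OF abs_sum_shift[OF assms]]])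
qed

lemma fourier_single: "fourier (single j a) t = cis (- of_int j * t) *s a"
  using has_sum_unique[OF fourier_has_sum[OF abs_sum_single[of j a], of t]
      has_sum_single_index[of j "\<lambda>i. cis (- of_int i * t) *s single j a $$ i"]] by simp

lemma has_integral_cis:
  "((\<lambda>t. cis (of_int k * t)) has_integral (if k = 0 then 2 * of_real pi else 0)) {-pi..pi}"
proof (cases "k = 0")
  case True
  then show ?thesis
    using has_integral_const_real[of "1::complex" "-pi" pi] by (simp add: scaleR_conv_of_real)
next
  case False
  have "((\<lambda>t. cis (of_int k * t)) has_integral
      (cis (of_int k * pi) / (\<i> * of_int k) - cis (of_int k * (- pi)) / (\<i> * of_int k))) {-pi..pi}"
  proof (rule fundamental_theorem_of_calculus)
    fix t :: real
    have "((\<lambda>t. cis (of_int k * t)) has_vector_derivative (of_int k * \<i> * cis (of_int k * t))) (at t within {-pi..pi})"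
      unfolding has_vector_derivative_def
      by (rule derivative_eq_intros refl)+ (auto simp: fun_eq_iff scaleR_conv_of_real mult_ac)
    then show "((\<lambda>t. cis (of_int k * t) / (\<i> * of_int k)) has_vector_derivative cis (of_int k * t)) (at t within {-pi..pi})"
      using False has_vector_derivative_divide[of _ _ _ "\<i> * of_int k"] by fastforce
  qed simp
  moreover have "cis (of_int k * pi) = cis (of_int k * (- pi))"
    using sin_zero_iff_int2[of "of_int k * pi"] by (auto simp: complex_eq_iff)
  ultimately show ?thesis
    using False by simp
qed

text \<open>The Weierstrass test permits termwise integration, and \<open>has_integral_cis\<close>
  keeps one term.\<close>

lemma fourier_inversion:
  assumes u: "abs_sum u"
  shows "((\<lambda>t. cis (of_int i * t) * fourier u t $ a) has_integral 2 * of_real pi * (u $$ i $ a)) {-pi..pi}"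
proof -
  let ?f = "\<lambda>k t. cis (of_int (i - k) * t) * (u $$ k $ a)"
  let ?F = "finite_subsets_at_top (UNIV :: int set)"
  have ft: "((\<lambda>k. ?f k t) has_sum (cis (of_int i * t) * fourier u t $ a)) UNIV" for t
  proof -
    have "((\<lambda>k. (cis (- of_int k * t) *s u $$ k) $ a) has_sum fourier u t $ a) UNIV"
      using has_sum_bounded_linear[OF bounded_linear_vec_nth fourier_has_sum[OF u]] by (simp add: o_def)
    then have "((\<lambda>k. cis (of_int i * t) * ((cis (- of_int k * t) *s u $$ k) $ a)) has_sum
        (cis (of_int i * t) * fourier u t $ a)) UNIV"
      by (rule has_sum_cmult_right)
    then show ?thesis
      by (simp add: mult.assoc[symmetric] cis_mult algebra_simps)
  qed
  have lim: "uniform_limit {-pi..pi} (\<lambda>X t. \<Sum>k\<in>X. ?f k t) (\<lambda>t. cis (of_int i * t) * fourier u t $ a) ?F"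
  proof (rule Weierstrass_m_test_general'[where M="\<lambda>k. norm (u $$ k)"])
    show "norm (?f k t) \<le> norm (u $$ k)" for k t
      by (simp add: norm_mult component_le_norm_cart Finite_Cartesian_Product.norm_nth_le)
  qed (use u ft in \<open>auto simp: abs_sum_def\<close>)
  have cont: "continuous_on {-pi..pi} (\<lambda>t. \<Sum>k\<in>X. ?f k t)" for X
    by (intro continuous_intros)
  obtain I J where IJ: "\<And>X. ((\<lambda>t. \<Sum>k\<in>X. ?f k t) has_integral I X) {-pi..pi}"
    "((\<lambda>t. cis (of_int i * t) * fourier u t $ a) has_integral J) {-pi..pi}" "(I \<longlongrightarrow> J) ?F"
    by (rule uniform_limit_integral[OF lim cont finite_subsets_at_top_neq_bot]) blast
  have I: "I X = 2 * of_real pi * (u $$ i $ a)" if "finite X" "i \<in> X" for X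
  proof -
    have "((\<lambda>t. \<Sum>k\<in>X. ?f k t) has_integral (\<Sum>k\<in>X. (if i - k = 0 then 2 * of_real pi else 0) * (u $$ k $ a))) {-pi..pi}"
      by (intro has_integral_sum that has_integral_mult_left has_integral_cis)
    then have "I X = (\<Sum>k\<in>X. (if i - k = 0 then 2 * of_real pi else 0) * (u $$ k $ a))"
      using IJ(1) has_integral_unique by blast
    also have "\<dots> = (\<Sum>k\<in>X. if k = i then 2 * of_real pi * (u $$ i $ a) else 0)"
      by (intro sum.cong) auto
    finally show ?thesis
      using that by simp
  qed
  have "(I \<longlongrightarrow> 2 * of_real pi * (u $$ i $ a)) ?F"
  proof (rule tendsto_eventually, unfold eventually_finite_subsets_at_top, intro exI[of _ "{i}"] conjI allI impI)
    fix X assume "finite X \<and> {i} \<subseteq> X \<and> X \<subseteq> UNIV"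
    then show "I X = 2 * of_real pi * (u $$ i $ a)"
      using I[of X] by auto
  qed auto
  then have "J = 2 * of_real pi * (u $$ i $ a)"
    using tendsto_unique[OF finite_subsets_at_top_neq_bot IJ(3)] by blast
  then show ?thesis
    using IJ(2) by simp
qed

text \<open>\<open>Arg\<close> inverts \<open>cis\<close> on the half-open interval, and
  \<open>- pi\<close> is the point left over.\<close>

lemma finite_cis_vimage:
  assumes "finite E"
  shows "finite {t \<in> {-pi..pi}. cis t \<in> E}"
proof (rule finite_subset)
  show "{t \<in> {-pi..pi}. cis t \<in> E} \<subseteq> insert (- pi) (Arg ` E)"
  proof
    fix t assume t: "t \<in> {t \<in> {-pi..pi}. cis t \<in> E}"
    show "t \<in> insert (- pi) (Arg ` E)"
    proof (cases "t = - pi")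
      case False
      then have "Arg (cis t) = t"
        using t by (intro cis_Arg_unique) (auto simp: sgn_if)
      then show ?thesis
        using t by force
    qed simp
  qed
qed (use assms in simp)

section \<open>The optimal smoother\<close>

text \<open>The coordinate projections as matrices, so that stacked disturbances are handled by
  \<open>\<rhd>\<close> and adjoints instead of case distinctions.\<close>

definition inl_row :: "complex^('a::finite + 'b::finite)^'a" where
  "inl_row = block_row (mat 1) 0"

definition inr_row :: "complex^('a::finite + 'b::finite)^'b" where
  "inr_row = block_row 0 (mat 1)"

lemma inl_row_mult: "inl_row *v d = (\<chi> i. d $ Inl i)"
  and inr_row_mult: "inr_row *v d = (\<chi> i. d $ Inr i)"
  by (simp_all add: inl_row_def inr_row_def block_row_mult)

lemma block_row_split: "block_row A B *v d = A *v (inl_row *v d) + B *v (inr_row *v d)"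
  by (simp add: inl_row_mult inr_row_mult block_row_mult)

lemma inl_row_adj_nth: "(inl_row\<^sup>\<dagger> *v w) $ i = (case i of Inl a \<Rightarrow> w $ a | Inr b \<Rightarrow> 0)"
  and inr_row_adj_nth: "(inr_row\<^sup>\<dagger> *v v) $ i = (case i of Inl a \<Rightarrow> 0 | Inr b \<Rightarrow> v $ b)"
  by (cases i; simp add: inl_row_def inr_row_def block_row_def cadj_def matrix_vector_mult_def mat_def
      if_distrib[of cnj] if_distrib[of "\<lambda>x. x * _"] cong: if_cong)+

lemma inl_inr_cancel:
  "inl_row *v (inl_row\<^sup>\<dagger> *v w) = w" "inr_row *v (inr_row\<^sup>\<dagger> *v v) = v"
  "inl_row *v (inr_row\<^sup>\<dagger> *v v) = 0" "inr_row *v (inl_row\<^sup>\<dagger> *v w) = 0"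
  by (simp_all add: inl_row_mult inr_row_mult vec_eq_iff inl_row_adj_nth inr_row_adj_nth)

lemma inl_inr_id: "inl_row\<^sup>\<dagger> *v (inl_row *v d) + inr_row\<^sup>\<dagger> *v (inr_row *v d) = d"
  by (simp add: inl_row_mult inr_row_mult vec_eq_iff inl_row_adj_nth inr_row_adj_nth split: sum.split)

definition stack :: "(complex^'a::finite) ell2 \<Rightarrow> (complex^'b::finite) ell2 \<Rightarrow> (complex^('a + 'b)) ell2" where
  "stack w v = inl_row\<^sup>\<dagger> \<rhd> w + inr_row\<^sup>\<dagger> \<rhd> v"

lemma stack_parts [simp]: "inl_row \<rhd> stack w v = w" "inr_row \<rhd> stack w v = v"
  by (auto intro!: ell2_eqI simp: stack_def matrix_vector_right_distrib inl_inr_cancel)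

lemma stack_collapse: "stack (inl_row \<rhd> d) (inr_row \<rhd> d) = d"
  by (rule ell2_eqI) (simp add: stack_def inl_inr_id)

lemma norm_stack: "(norm d)\<^sup>2 = (norm (inl_row \<rhd> d))\<^sup>2 + (norm (inr_row \<rhd> d))\<^sup>2"
proof -
  have "d \<bullet> d = d \<bullet> stack (inl_row \<rhd> d) (inr_row \<rhd> d)"
    by (simp add: stack_collapse)
  then show ?thesis
    by (simp add: stack_def power2_norm_eq_inner inner_add_right inner_pointwise)
qed

lemma invertible_gram: "invertible (mat 1 + X ** X\<^sup>\<dagger>)" for X :: "complex^'m^'p"
proof -
  have "y = 0" if "(mat 1 + X ** X\<^sup>\<dagger>) *v y = 0" for y
  proof -
    have "0 = y \<bullet> ((mat 1 + X ** X\<^sup>\<dagger>) *v y)"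
      using that by simp
    also have "\<dots> = y \<bullet> y + (X\<^sup>\<dagger> *v y) \<bullet> (X\<^sup>\<dagger> *v y)"
      by (simp add: matrix_vector_mult_add_rdistrib inner_add_right inner_matrix_vector matrix_vector_mul_assoc)
    finally have "y \<bullet> y = 0"
      using inner_ge_zero[of y] inner_ge_zero[of "X\<^sup>\<dagger> *v y"] by linarith
    then show ?thesis
      by simp
  qed
  then show ?thesis
    by (meson invertible_left_inverse matrix_left_invertible_ker)
qed

lemma mat_mult_vec: "mat c *v x = c *s x" for x :: "complex^'n"
  by (simp add: mat_def matrix_vector_mult_def vec_eq_iff if_distrib[of "\<lambda>x. x * _"] cong: if_cong)

lemma invertible_if_not_eigenval: "\<not> eigenval A z \<Longrightarrow> invertible (mat z - A)"
proof -
  assume "\<not> eigenval A z"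
  then have "x = 0" if "(mat z - A) *v x = 0" for x
  proof -
    show ?thesis
      using that \<open>\<not> eigenval A z\<close> by (auto simp: eigenval_def matrix_vector_mult_diff_rdistrib mat_mult_vec)
  qed
  then show ?thesis
    by (meson invertible_left_inverse matrix_left_invertible_ker)
qed

context regret_data
begin

text \<open>The Bryson-Frazier smoothing equations at one instant: removing \<open>P p\<close> from
  the prediction error leaves a plant step with zero output. \<open>q\<close> is a separate variable
  so that it can be the next costate in time or \<open>z *s p\<close> in frequency.\<close>

lemma smoother_step:
  assumes x': "x' = FP *v x + G *v w - KP *v v" and e: "e = H *v x + v"
    and p: "p = FP\<^sup>\<dagger> *v q + H\<^sup>\<dagger> *v (RPi *v e)" and mu: "\<mu> = RPi *v e - KP\<^sup>\<dagger> *v q"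
  shows "x' - P *v q = F *v (x - P *v p) + G *v (w - G\<^sup>\<dagger> *v q)" (is ?A)
    and "H *v (x - P *v p) + (v - \<mu>) = 0" (is ?B)
    and "p = F\<^sup>\<dagger> *v q + H\<^sup>\<dagger> *v \<mu>" (is ?C)
proof -
  have 1: "F *v (P *v p) = P *v q - G *v (G\<^sup>\<dagger> *v q) + KP *v e"
    unfolding p by (simp add: matrix_vector_right_distrib matrix_vector_mul_assoc matrix_mul_assoc
        matrix_vector_mult_diff_rdistrib K_P_def F_P_FP_adj)
  have "KP *v e = KP *v (H *v x) + KP *v v"
    unfolding e by (simp add: matrix_vector_right_distrib)
  then show ?A
    unfolding x' by (simp add: matrix_vector_mult_diff_distrib 1)
      (simp add: F_P_def matrix_vector_mult_diff_rdistrib matrix_vector_mul_assoc algebra_simps)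
  have "H ** P ** H\<^sup>\<dagger> ** RPi = mat 1 - RPi"
  proof -
    have "(mat 1 + H ** P ** H\<^sup>\<dagger>) ** RPi = mat 1"
      using matrix_inv_right_left(1)[OF inv_RP] by (simp add: R_P_def)
    then show ?thesis
      by (simp add: matrix_algebra algebra_simps)
  qed
  then have "H *v (P *v p) = KP\<^sup>\<dagger> *v q + e - RPi *v e"
    unfolding p by (simp add: matrix_vector_right_distrib matrix_vector_mul_assoc matrix_mul_assoc
        matrix_vector_mult_diff_rdistrib H_P_FP_adj)
  then show ?B
    unfolding mu e by (simp add: matrix_vector_mult_diff_distrib)
  show ?C
    unfolding p mu F_P_def
    by (simp add: cadj_diff cadj_mult matrix_vector_mult_diff_rdistrib matrix_vector_mult_diff_distrib
        matrix_vector_mul_assoc matrix_mul_assoc)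
qed

text \<open>The Kalman one-step prediction error rather than the prediction: governed by the stable
  \<open>FP\<close>, it stays square-summable for unstable \<open>F\<close>.\<close>

definition predictor :: "(complex^('m + 'p)) ell2 \<Rightarrow> (complex^'n) ell2" where
  "predictor d = resolvent FP (G \<rhd> inl_row \<rhd> d - KP \<rhd> inr_row \<rhd> d)"

definition innovation :: "(complex^('m + 'p)) ell2 \<Rightarrow> (complex^'p) ell2" where
  "innovation d = H \<rhd> predictor d + inr_row \<rhd> d"

definition costate :: "(complex^'p) ell2 \<Rightarrow> (complex^'n) ell2" where
  "costate \<nu> = anti_resolvent (FP\<^sup>\<dagger>) (H\<^sup>\<dagger> \<rhd> \<nu>)"

text \<open>The smoothing error of the state, by the Bryson-Frazier formula.\<close>

definition smoother :: "(complex^('m + 'p)) ell2 \<Rightarrow> (complex^'n) ell2" where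
  "smoother d = predictor d - P \<rhd> costate (RPi \<rhd> innovation d)"

lemma predictor: "shift 1 (predictor d) = FP \<rhd> predictor d + (G \<rhd> inl_row \<rhd> d - KP \<rhd> inr_row \<rhd> d)"
  unfolding predictor_def by (rule resolvent[OF powers_FP])

lemma costate: "costate \<nu> = FP\<^sup>\<dagger> \<rhd> shift 1 (costate \<nu>) + H\<^sup>\<dagger> \<rhd> \<nu>"
  unfolding costate_def by (rule anti_resolvent[OF powers_summable_cadj[OF powers_FP]])

lemma bounded_linear_predictor: "bounded_linear predictor"
  unfolding predictor_def
  by (intro bounded_linear_compose[OF bounded_linear_resolvent[OF powers_FP]] bounded_linear_sub
      bounded_linear_compose[OF bounded_linear_pointwise] bounded_linear_pointwise)

lemma bounded_linear_innovation: "bounded_linear innovation"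
  unfolding innovation_def
  by (intro bounded_linear_add bounded_linear_compose[OF bounded_linear_pointwise] bounded_linear_pointwise
      bounded_linear_predictor)

lemma bounded_linear_costate: "bounded_linear costate"
  unfolding costate_def
  by (intro bounded_linear_compose[OF bounded_linear_anti_resolvent[OF powers_summable_cadj[OF powers_FP]]]
      bounded_linear_pointwise)

lemma bounded_linear_smoother: "bounded_linear smoother"
  unfolding smoother_def
  by (intro bounded_linear_sub bounded_linear_predictor bounded_linear_compose[OF bounded_linear_pointwise]
      bounded_linear_compose[OF bounded_linear_costate] bounded_linear_innovation)

text \<open>Eliminating state and costate from \<open>smoother_step\<close> expresses \<mu> by the
  inverse of \<open>mat 1 + Hz ** Hz\<^sup>\<dagger>\<close>, which is the inverse in the noncausal
  estimator.\<close>

lemma noncausal_symbol: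
  assumes z: "norm z = 1" "\<not> eigenval F z"
    and x: "z *s x = FP *v x + G *v w - KP *v v" and e: "e = H *v x + v"
    and p: "p = FP\<^sup>\<dagger> *v (z *s p) + H\<^sup>\<dagger> *v (RPi *v e)"
  shows "L *v (x - P *v p) = (transfer_matrix F G L z - noncausal_estimator F G H L z ** transfer_matrix F G H z) *v w
    + (- noncausal_estimator F G H L z) *v v"
proof -
  define M where "M = matrix_inv (mat z - F)"
  have inv: "M ** (mat z - F) = mat 1" "(mat z - F) ** M = mat 1"
    unfolding M_def by (rule matrix_inv_right_left[OF invertible_if_not_eigenval[OF z(2)]])+
  define q where "q = z *s p"
  define \<mu> where "\<mu> = RPi *v e - KP\<^sup>\<dagger> *v q"
  define y where "y = x - P *v p"
  define Hz Lz where "Hz = transfer_matrix F G H z" and "Lz = transfer_matrix F G L z"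
  note step = smoother_step[OF x e p[folded q_def] \<mu>_def]
  \<comment> \<open>On the circle \<open>cnj z\<close> is the inverse of \<open>z\<close>; this
    turns the backward recursion into an adjoint resolvent of \<open>F\<close>.\<close>
  have zq: "cnj z *s q = p"
    using z(1) by (simp add: q_def vector_smult_assoc complex_norm_square[symmetric] mult.commute)
  have "z *s y = F *v y + G *v (w - G\<^sup>\<dagger> *v q)"
    using step(1) by (simp add: y_def q_def vec.scale_right_diff_distrib vector_scalar_commute)
  then have "(mat z - F) *v y = G *v (w - G\<^sup>\<dagger> *v q)"
    by (simp add: matrix_vector_mult_diff_rdistrib mat_mult_vec)
  then have "M *v ((mat z - F) *v y) = M *v (G *v (w - G\<^sup>\<dagger> *v q))"
    by simp
  then have y: "y = M *v (G *v (w - G\<^sup>\<dagger> *v q))"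
    by (simp add: matrix_vector_mul_assoc inv)
  have "(mat z - F)\<^sup>\<dagger> *v q = H\<^sup>\<dagger> *v \<mu>"
    using step(3) zq by (simp add: cadj_diff matrix_vector_mult_diff_rdistrib mat_mult_vec)
  then have "M\<^sup>\<dagger> *v ((mat z - F)\<^sup>\<dagger> *v q) = M\<^sup>\<dagger> *v (H\<^sup>\<dagger> *v \<mu>)"
    by simp
  moreover have "M\<^sup>\<dagger> ** (mat z - F)\<^sup>\<dagger> = mat 1"
    using arg_cong[OF inv(2), of cadj] by (simp add: cadj_mult)
  ultimately have q: "q = M\<^sup>\<dagger> *v (H\<^sup>\<dagger> *v \<mu>)"
    by (simp add: matrix_vector_mul_assoc)
  have Gq: "G\<^sup>\<dagger> *v q = Hz\<^sup>\<dagger> *v \<mu>"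
    unfolding q Hz_def transfer_matrix_def M_def[symmetric]
    by (simp add: cadj_mult matrix_vector_mul_assoc matrix_mul_assoc)
  have Hy: "H *v y = Hz *v (w - Hz\<^sup>\<dagger> *v \<mu>)" and Ly: "L *v y = Lz *v (w - Hz\<^sup>\<dagger> *v \<mu>)"
    unfolding y Gq by (simp_all add: Hz_def Lz_def transfer_matrix_def M_def matrix_vector_mul_assoc matrix_mul_assoc)
  have "(mat 1 + Hz ** Hz\<^sup>\<dagger>) *v \<mu> = Hz *v w + v"
    using step(2) Hy
    by (simp add: y_def[symmetric] matrix_vector_mult_add_rdistrib matrix_vector_mult_diff_distrib
        matrix_vector_mul_assoc algebra_simps)
  then have "matrix_inv (mat 1 + Hz ** Hz\<^sup>\<dagger>) *v ((mat 1 + Hz ** Hz\<^sup>\<dagger>) *v \<mu>) =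
      matrix_inv (mat 1 + Hz ** Hz\<^sup>\<dagger>) *v (Hz *v w + v)"
    by simp
  then have mu: "\<mu> = matrix_inv (mat 1 + Hz ** Hz\<^sup>\<dagger>) *v (Hz *v w + v)"
    by (simp add: matrix_vector_mul_assoc matrix_inv_right_left[OF invertible_gram])
  have K: "noncausal_estimator F G H L z = Lz ** Hz\<^sup>\<dagger> ** matrix_inv (mat 1 + Hz ** Hz\<^sup>\<dagger>)"
    by (simp add: noncausal_estimator_def Hz_def Lz_def Let_def)
  have "L *v y = Lz *v w - noncausal_estimator F G H L z *v (Hz *v w + v)"
    unfolding Ly K by (subst mu) (simp add: matrix_vector_mult_diff_distrib matrix_vector_mul_assoc matrix_mul_assoc)
  then show ?thesis
    by (simp add: y_def Hz_def Lz_def matrix_vector_mult_diff_rdistrib matrix_vector_right_distrib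
        matrix_vector_mul_assoc matrix_vector_uminus)
qed

text \<open>The transforms of the impulse responses agree with the symbol wherever
  \<open>cis t\<close> is no eigenvalue of \<open>F\<close>, and a finite set does not affect the
  integrals.\<close>

lemma block_op_noncausal:
  "block_op (noncausal_error_matrix F G H L) = (\<lambda>d. L \<rhd> smoother d)"
proof (rule block_op_eqI)
  show "bounded_linear (\<lambda>d. L \<rhd> smoother d)"
    by (rule bounded_linear_compose[OF bounded_linear_pointwise bounded_linear_smoother])
  fix i j :: int and a :: "complex^('m + 'p)"
  define \<Phi> where "\<Phi> = (\<lambda>z. block_row
       (transfer_matrix F G L z - noncausal_estimator F G H L z ** transfer_matrix F G H z)
       (- noncausal_estimator F G H L z))"
  have sym: "fourier (L \<rhd> smoother (single j a)) t = \<Phi> (cis t) *v (cis (- of_int j * t) *s a)"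
    and sm: "abs_sum (L \<rhd> smoother (single j a))"
    if "\<not> eigenval F (cis t)" for t a
  proof -
    let ?d = "single j a"
    let ?u = "G \<rhd> inl_row \<rhd> ?d - KP \<rhd> inr_row \<rhd> ?d"
    have 1: "abs_sum ?d" "abs_sum (inl_row \<rhd> ?d)" "abs_sum (inr_row \<rhd> ?d)" "abs_sum (G \<rhd> inl_row \<rhd> ?d)" "abs_sum (KP \<rhd> inr_row \<rhd> ?d)" "abs_sum ?u"
      by (intro abs_sum_single abs_sum_pointwise abs_sum_diff)+
    have 2: "abs_sum (predictor ?d)"
      unfolding predictor_def abs_sum_def
      by (rule resolvent_abs_summable[OF powers_FP 1(6)[unfolded abs_sum_def]])
    have 3: "abs_sum (innovation ?d)"
      unfolding innovation_def by (intro abs_sum_add abs_sum_pointwise 1 2)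
    let ?\<nu> = "RPi \<rhd> innovation ?d"
    have 4: "abs_sum (costate ?\<nu>)"
      using abs_sum_pointwise[OF abs_sum_pointwise[OF 3]] unfolding costate_def abs_sum_def
      by (rule anti_resolvent_abs_summable[OF powers_summable_cadj[OF powers_FP]])
    show "abs_sum (L \<rhd> smoother ?d)"
      unfolding smoother_def by (intro abs_sum_pointwise abs_sum_diff 2 4)
    let ?z = "cis t" and ?w = "fourier (inl_row \<rhd> ?d) t" and ?v = "fourier (inr_row \<rhd> ?d) t"
    let ?x = "fourier (predictor ?d) t" and ?e = "fourier (innovation ?d) t" and ?p = "fourier (costate ?\<nu>) t"
    have "fourier (shift 1 (predictor ?d)) t = FP *v ?x + (G *v ?w - KP *v ?v)"
      unfolding predictor by (simp add: fourier_add fourier_diff fourier_pointwise 1 2 abs_sum_pointwise)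
    then have x: "?z *s ?x = FP *v ?x + G *v ?w - KP *v ?v"
      by (simp add: fourier_shift 2)
    have e: "?e = H *v ?x + ?v"
      unfolding innovation_def by (simp add: fourier_add fourier_pointwise 1 2 abs_sum_pointwise)
    have p: "?p = FP\<^sup>\<dagger> *v (?z *s ?p) + H\<^sup>\<dagger> *v (RPi *v ?e)"
      by (subst (1) costate)
        (simp add: fourier_add fourier_pointwise fourier_shift 3 4 abs_sum_pointwise abs_sum_shift)
    have "fourier (L \<rhd> smoother ?d) t = L *v (?x - P *v ?p)"
      unfolding smoother_def by (simp add: fourier_pointwise fourier_diff 2 4 abs_sum_pointwise abs_sum_diff)
    also have "\<dots> = \<Phi> ?z *v fourier ?d t"
      unfolding \<Phi>_def block_row_split
      using noncausal_symbol[OF _ that x e p] by (simp add: fourier_pointwise 1)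
    finally show "fourier (L \<rhd> smoother ?d) t = \<Phi> (cis t) *v (cis (- of_int j * t) *s a)"
      by (simp add: fourier_single)
  qed
  let ?S = "{t \<in> {-pi..pi}. cis t \<in> {\<mu>. eigenval F \<mu>}}"
  have fin: "finite ?S"
    by (rule finite_cis_vimage[OF finite_eigenvals])
  \<comment> \<open>\<open>sm\<close> was proved together with \<open>sym\<close> and shares its
    premise, so one parameter off the spectrum is needed.\<close>
  obtain t0 where t0: "\<not> eigenval F (cis t0)"
  proof -
    have "infinite {-pi..pi}"
      using pi_gt_zero by simp
    then have "{-pi..pi} - ?S \<noteq> {}"
      using fin by (metis finite.emptyI finite_Diff2)
    then obtain t where "t \<in> {-pi..pi} - ?S"
      by blast
    then show ?thesis
      by (intro that[of t]) auto
  qed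
  have int: "((\<lambda>t. cis (of_int (i - j) * t) * (\<Phi> (cis t) *v a) $ c) has_integral
      2 * of_real pi * ((L \<rhd> smoother (single j a)) $$ i $ c)) {-pi..pi}" for c a
  proof (rule has_integral_spike_finite[OF fin _ fourier_inversion[OF sm[OF t0]]])
    fix t assume "t \<in> {-pi..pi} - ?S"
    then have "fourier (L \<rhd> smoother (single j a)) t = \<Phi> (cis t) *v (cis (- of_int j * t) *s a)"
      by (intro sym) auto
    then show "cis (of_int (i - j) * t) * (\<Phi> (cis t) *v a) $ c =
        cis (of_int i * t) * fourier (L \<rhd> smoother (single j a)) t $ c"
      by (simp add: vector_scalar_commute mult.assoc[symmetric] cis_mult algebra_simps)
  qed
  let ?M = "noncausal_error_matrix F G H L i j"
  \<comment> \<open>Integrability comes from \<open>int\<close> at a unit vector; without it the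
    \<open>integral\<close> in \<open>laurent\<close> would be a default value.\<close>
  have M: "((\<lambda>t. cis (of_int (i - j) * t) * \<Phi> (cis t) $ c $ b) has_integral 2 * of_real pi * ?M $ c $ b) {-pi..pi}" for c b
  proof -
    have "((\<lambda>t. cis (of_int (i - j) * t) * \<Phi> (cis t) $ c $ b) has_integral
        2 * of_real pi * ((L \<rhd> smoother (single j (axis b 1))) $$ i $ c)) {-pi..pi}"
      using int[of "axis b 1" c] by (simp add: matrix_vector_mul_component_axis)
    then have "(\<lambda>t. cis (of_int (i - j) * t) * \<Phi> (cis t) $ c $ b) integrable_on {-pi..pi}"
      by blast
    then show ?thesis
      by (simp add: noncausal_error_matrix_def laurent_def \<Phi>_def[symmetric] integrable_integral)
  qed
  show "?M *v a = (L \<rhd> smoother (single j a)) $$ i"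
  proof (rule vec_eq_iff[THEN iffD2], rule allI)
    fix c
    have "((\<lambda>t. \<Sum>b\<in>UNIV. cis (of_int (i - j) * t) * \<Phi> (cis t) $ c $ b * a $ b) has_integral
        (\<Sum>b\<in>UNIV. 2 * of_real pi * ?M $ c $ b * a $ b)) {-pi..pi}"
      by (intro has_integral_sum has_integral_mult_left M) simp
    then have "((\<lambda>t. cis (of_int (i - j) * t) * (\<Phi> (cis t) *v a) $ c) has_integral
        2 * of_real pi * (?M *v a) $ c) {-pi..pi}"
      by (simp add: matrix_vector_mult_def sum_distrib_left mult.assoc)
    from has_integral_unique[OF this int[of a c]]
    show "(?M *v a) $ c = (L \<rhd> smoother (single j a)) $$ i $ c"
      by simp
  qed
qed

end

section \<open>Causal block matrices on sequences with a starting time\<close>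

text \<open>A formal action on sequences starting at \<open>N\<close>: earlier values are never read
  and all sums are finite, so the matrix may be unbounded.\<close>

definition causal_apply :: "int \<Rightarrow> (int \<Rightarrow> int \<Rightarrow> complex^'p^'q) \<Rightarrow> (int \<Rightarrow> complex^'p) \<Rightarrow> int \<Rightarrow> complex^'q" where
  "causal_apply N M y i = (\<Sum>j\<in>{N..i}. M i j *v y j)"

definition state :: "int \<Rightarrow> complex^'n^'n \<Rightarrow> (int \<Rightarrow> complex^'n) \<Rightarrow> int \<Rightarrow> complex^'n" where
  "state N A u i = (\<Sum>j\<in>{N..<i}. mpow A (nat (i - j - 1)) *v u j)"

lemma state_start: "i \<le> N \<Longrightarrow> state N A u i = 0"
  by (simp add: state_def)

lemma matrix_vector_mult_sum: "A *v (\<Sum>k\<in>I. x k) = (\<Sum>k\<in>I. A *v x k)" for A :: "complex^'n^'m"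
  by (rule linear_sum[OF linear_matrix_vector])

lemma state_Suc:
  assumes "N \<le> i"
  shows "state N A u (i + 1) = A *v state N A u i + u i"
proof -
  have "{N..<i + 1} = insert i {N..<i}"
    using assms by auto
  then have "state N A u (i + 1) = u i + (\<Sum>j\<in>{N..<i}. mpow A (nat (i + 1 - j - 1)) *v u j)"
    by (simp add: state_def)
  also have "(\<Sum>j\<in>{N..<i}. mpow A (nat (i + 1 - j - 1)) *v u j) = A *v state N A u i"
    unfolding state_def matrix_vector_mult_sum
  proof (rule sum.cong[OF refl])
    fix j assume "j \<in> {N..<i}"
    then have "nat (i + 1 - j - 1) = Suc (nat (i - j - 1))"
      by auto
    then show "mpow A (nat (i + 1 - j - 1)) *v u j = A *v (mpow A (nat (i - j - 1)) *v u j)"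
      by (simp add: mpow_Suc matrix_vector_mul_assoc)
  qed
  finally show ?thesis
    by simp
qed

lemma state_unique:
  assumes "\<And>i. i \<le> N \<Longrightarrow> x i = 0" "\<And>i. N \<le> i \<Longrightarrow> x (i + 1) = A *v x i + u i"
  shows "x i = state N A u i"
proof (cases "i \<le> N")
  case False
  then have "N \<le> i" by simp
  then show ?thesis
    by (induction i rule: int_ge_induct) (use assms in \<open>auto simp: state_start state_Suc\<close>)
qed (use assms in \<open>simp add: state_start\<close>)

lemma causal_apply_plant: "causal_apply N (plant F G C) w i = C *v state N F (\<lambda>i. G *v w i) i"
proof -
  have "causal_apply N (plant F G C) w i = (\<Sum>j\<in>{N..<i}. plant F G C i j *v w j)"
    unfolding causal_apply_def by (rule sum.mono_neutral_right) (auto simp: plant_def)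
  also have "\<dots> = C *v state N F (\<lambda>i. G *v w i) i"
    unfolding state_def matrix_vector_mult_sum
    by (rule sum.cong) (auto simp: plant_def matrix_vector_mul_assoc matrix_mul_assoc)
  finally show ?thesis .
qed

text \<open>Exchange of a triangular double sum; it makes products with an unbounded plant
  legitimate.\<close>

lemma causal_apply_prod: "causal_apply N (causal_prod A B) y i = causal_apply N A (causal_apply N B y) i"
proof -
  have "causal_apply N (causal_prod A B) y i = (\<Sum>j\<in>{N..i}. \<Sum>k\<in>{j..i}. A i k *v (B k j *v y j))"
    unfolding causal_apply_def causal_prod_def by (simp add: matrix_vector_mult_sum_rdistrib matrix_vector_mul_assoc)
  also have "\<dots> = (\<Sum>j\<in>{N..i}. \<Sum>k\<in>{k \<in> {N..i}. j \<le> k}. A i k *v (B k j *v y j))"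
    by (intro sum.cong) auto
  also have "\<dots> = (\<Sum>k\<in>{N..i}. \<Sum>j\<in>{j \<in> {N..i}. j \<le> k}. A i k *v (B k j *v y j))"
    by (rule sum.swap_restrict) auto
  also have "\<dots> = (\<Sum>k\<in>{N..i}. A i k *v causal_apply N B y k)"
    unfolding causal_apply_def matrix_vector_mult_sum by (intro sum.cong) auto
  finally show ?thesis
    by (simp add: causal_apply_def)
qed

lemma causal_apply_add: "causal_apply N (\<lambda>i j. A i j + B i j) y i = causal_apply N A y i + causal_apply N B y i"
  by (simp add: causal_apply_def matrix_vector_mult_add_rdistrib sum.distrib)

lemma causal_apply_add_right: "causal_apply N M (\<lambda>i. x i + y i) i = causal_apply N M x i + causal_apply N M y i"
  by (simp add: causal_apply_def matrix_vector_right_distrib sum.distrib)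

lemma causal_error_matrix:
  assumes "causal K"
  shows "causal (error_matrix F G H L K)"
  unfolding causal_def
proof (intro allI impI)
  fix i j :: int
  assume "i < j"
  with assms have "K i j = 0" "causal_prod K (plant F G H) i j = 0" "plant F G L i j = 0"
    by (simp_all add: causal_def causal_prod_def plant_def)
  then show "error_matrix F G H L K i j = 0"
    unfolding error_matrix_def block_row_def by (simp add: vec_eq_iff split: sum.split)
qed

text \<open>With a starting time the estimator can be applied to the actual measurements, even if
  these grow without bound.\<close>

lemma error_matrix_apply:
  fixes F :: "complex^'n^'n" and G :: "complex^'m^'n"
  assumes K: "causal K" and d: "\<And>j. j < N \<Longrightarrow> d $$ j = 0"
  defines "x \<equiv> state N F (\<lambda>i. G *v (inl_row *v d $$ i))"
  shows "block_apply (error_matrix F G H L K) d i =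
    L *v x i - causal_apply N K (\<lambda>k. H *v x k + inr_row *v d $$ k) i"
proof -
  let ?w = "\<lambda>i. inl_row *v d $$ i" and ?v = "\<lambda>i. inr_row *v d $$ i"
  have "block_apply (error_matrix F G H L K) d i =
      causal_apply N (plant F G L) ?w i - causal_apply N (causal_prod K (plant F G H)) ?w i - causal_apply N K ?v i"
    unfolding causal_apply_def
    by (subst block_apply_start[OF causal_error_matrix[OF K] d])
      (simp_all add: error_matrix_def block_row_split matrix_vector_mult_diff_rdistrib matrix_vector_uminus
        sum.distrib sum_subtractf sum_negf)
  then show ?thesis
    unfolding causal_apply_prod causal_apply_plant causal_apply_add_right x_def by simp
qed

lemma inner_disjoint:
  assumes "\<And>i. x $$ i = 0 \<or> y $$ i = 0"
  shows "x \<bullet> (A \<rhd> y) = 0"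
proof -
  have "x $$ i \<bullet> (A \<rhd> y) $$ i = 0" for i
    using assms[of i] by auto
  then show ?thesis
    unfolding inner_ell2.rep_eq by (intro infsum_0) simp
qed

context regret_data
begin

lemma psd_Y: "psd Y" and psd_Z: "psd Z"
proof -
  have congr: "psd (M\<^sup>\<dagger> ** R ** M)" if "posdef R" for M :: "complex^'n^'k" and R
  proof (rule psdI)
    show "hermitian (M\<^sup>\<dagger> ** R ** M)"
      using that by (simp add: posdef_def psd_def hermitian_def cadj_mult matrix_mul_assoc)
    fix x
    have "x \<bullet> ((M\<^sup>\<dagger> ** R ** M) *v x) = (M *v x) \<bullet> (R *v (M *v x))"
      by (simp add: inner_matrix_vector[of M] matrix_vector_mul_assoc matrix_mul_assoc)
    then show "0 \<le> x \<bullet> ((M\<^sup>\<dagger> ** R ** M) *v x)"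
      using that psd_nonneg[of R "M *v x"] by (simp add: posdef_def)
  qed
  show "psd Y"
    by (rule lyapunov_psd[OF powers_FP Y_eq congr[OF posdef_inv[OF posdef_RP]]])
  have Z: "Z = (FP\<^sup>\<dagger>)\<^sup>\<dagger> ** Z ** FP\<^sup>\<dagger> + (L ** (P - U) ** FP\<^sup>\<dagger>)\<^sup>\<dagger> ** RQi ** (L ** (P - U) ** FP\<^sup>\<dagger>)"
    by (rule trans[OF Z_eq]) (simp add: cadj_mult matrix_mul_assoc)
  show "psd Z"
    by (rule lyapunov_psd[OF powers_summable_cadj[OF powers_FP] Z congr[OF posdef_inv[OF posdef_RQ]]])
qed

section \<open>Output-nulling trajectories and excitations\<close>

definition output_null :: "(complex^'m) ell2 \<Rightarrow> (complex^'p) ell2 \<Rightarrow> (complex^'n) ell2 \<Rightarrow> bool" where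
  "output_null w v x \<longleftrightarrow> shift 1 x = F \<rhd> x + G \<rhd> w \<and> H \<rhd> x + v = 0"

lemma F_FP: "F \<rhd> x = FP \<rhd> x + KP \<rhd> H \<rhd> x"
  by (simp add: F_P_def pointwise_diff_left pointwise_mult)

lemma F_FW: "F \<rhd> x = FW \<rhd> x + G \<rhd> KW \<rhd> x"
  by (simp add: F_W_def pointwise_diff_left pointwise_mult)

text \<open>Adding a multiple of the vanishing output replaces \<open>F\<close> by
  \<open>FP\<close>.\<close>

lemma output_null_predictor:
  assumes "output_null w v x"
  shows "shift 1 x = FP \<rhd> x + G \<rhd> w + (- KP) \<rhd> v"
proof -
  have "KP \<rhd> (H \<rhd> x + v) = 0"
    using assms by (simp add: output_null_def)
  then show ?thesis
    using assms by (simp add: output_null_def pointwise_minus_left pointwise_add F_FP add_eq_0_iff2)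
qed

lemma output_null_regulator:
  assumes "output_null w v x"
  shows "shift 1 x = FW \<rhd> x + G \<rhd> (w + KW \<rhd> x)"
    and "(norm w)\<^sup>2 + (norm v)\<^sup>2 + (norm (L \<rhd> x))\<^sup>2 / \<gamma>\<^sup>2 = (w + KW \<rhd> x) \<bullet> (RW \<rhd> (w + KW \<rhd> x))"
proof -
  show 1: "shift 1 x = FW \<rhd> x + G \<rhd> (w + KW \<rhd> x)"
    using assms by (simp add: output_null_def pointwise_add F_FW)
  have "v = - (H \<rhd> x)"
    using assms by (simp add: output_null_def add_eq_0_iff)
  then show "(norm w)\<^sup>2 + (norm v)\<^sup>2 + (norm (L \<rhd> x))\<^sup>2 / \<gamma>\<^sup>2 = (w + KW \<rhd> x) \<bullet> (RW \<rhd> (w + KW \<rhd> x))"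
    using regulator_energy[OF 1] by simp
qed

text \<open>As \<open>FW\<close> is stable, every square-summable \<open>om\<close> drives such an
  \<open>x\<close>; the output-nulling trajectories are freely parametrized by
  \<open>om\<close>.\<close>

lemma output_null_of_regulator:
  assumes "shift 1 x = FW \<rhd> x + G \<rhd> om"
  shows "output_null (om - KW \<rhd> x) (- (H \<rhd> x)) x"
  using assms by (simp add: output_null_def pointwise_diff F_FW)

text \<open>The adjoint of the normalized innovation map. Its range is the orthogonal complement of the
  output-nulling trajectories.\<close>

definition excitation :: "(complex^'p) ell2 \<Rightarrow> (complex^('m + 'p)) ell2" where
  "excitation \<nu> = stack (G\<^sup>\<dagger> \<rhd> shift 1 (costate \<nu>)) (\<nu> - KP\<^sup>\<dagger> \<rhd> shift 1 (costate \<nu>))"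

lemma norm_excitation: "(norm (excitation \<nu>))\<^sup>2 = \<nu> \<bullet> (RP \<rhd> \<nu>)"
  using innovation_energy[OF costate refl, of \<nu>] by (simp add: excitation_def norm_stack)

text \<open>Summation by parts reduces the inner product to that of the output with \<nu>, and the
  output vanishes.\<close>

lemma excitation_orthogonal:
  assumes "output_null w v x"
  shows "stack w v \<bullet> excitation \<nu> = 0"
proof -
  have "(H \<rhd> x + v) \<bullet> \<nu> = w \<bullet> (G\<^sup>\<dagger> \<rhd> shift 1 (costate \<nu>)) + v \<bullet> (\<nu> + (- KP)\<^sup>\<dagger> \<rhd> shift 1 (costate \<nu>))"
    by (rule adjoint_pairing[OF costate refl output_null_predictor[OF assms]])
  then have "0 = w \<bullet> (G\<^sup>\<dagger> \<rhd> shift 1 (costate \<nu>)) + v \<bullet> (\<nu> - KP\<^sup>\<dagger> \<rhd> shift 1 (costate \<nu>))"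
    using assms by (simp add: output_null_def cadj_uminus pointwise_minus_left)
  also have "\<dots> = stack w v \<bullet> excitation \<nu>"
    by (subst stack_def) (simp add: inner_add_left inner_pointwise excitation_def)
  finally show ?thesis by simp
qed

lemma norm_add_excitation:
  assumes "output_null w v x"
  shows "(norm (stack w v + excitation \<nu>))\<^sup>2 = (norm w)\<^sup>2 + (norm v)\<^sup>2 + \<nu> \<bullet> (RP \<rhd> \<nu>)"
proof -
  have "(norm (stack w v + excitation \<nu>))\<^sup>2 = (norm (stack w v))\<^sup>2 + (norm (excitation \<nu>))\<^sup>2"
    using excitation_orthogonal[OF assms, of \<nu>]
    by (simp add: power2_norm_eq_inner inner_add_left inner_add_right inner_commute)
  then show ?thesis
    by (simp add: norm_stack[of "stack w v"] norm_excitation)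
qed

lemma H_P_costate: "H \<rhd> P \<rhd> costate \<nu> = KP\<^sup>\<dagger> \<rhd> shift 1 (costate \<nu>) + RP \<rhd> \<nu> - \<nu>"
proof -
  have b: "H ** P ** H\<^sup>\<dagger> = RP - mat 1"
    by (simp add: R_P_def)
  show ?thesis
    by (subst costate) (simp add: pointwise_add pointwise_mult matrix_mul_assoc H_P_FP_adj b pointwise_diff_left)
qed

lemma P_costate_step:
  "shift 1 (P \<rhd> costate \<nu>) = F \<rhd> P \<rhd> costate \<nu> + G \<rhd> G\<^sup>\<dagger> \<rhd> shift 1 (costate \<nu>) - KP \<rhd> RP \<rhd> \<nu>"
proof -
  have "F \<rhd> P \<rhd> costate \<nu> = P \<rhd> shift 1 (costate \<nu>) - G \<rhd> G\<^sup>\<dagger> \<rhd> shift 1 (costate \<nu>) + KP \<rhd> RP \<rhd> \<nu>"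
    by (subst costate) (simp add: pointwise_add pointwise_mult matrix_mul_assoc KP_RP F_P_FP_adj pointwise_diff_left)
  then show ?thesis
    by (simp add: shift_pointwise)
qed

lemma smoother_null:
  assumes "output_null w v x"
  shows "smoother (stack w v) = x"
proof -
  have "predictor (stack w v) = x"
    unfolding predictor_def
    by (rule resolvent_unique[OF powers_FP, symmetric])
       (use output_null_predictor[OF assms] in \<open>simp add: pointwise_minus_left\<close>)
  then show ?thesis
    using assms linear_0[OF bounded_linear.linear[OF bounded_linear_costate]]
    by (simp add: smoother_def innovation_def output_null_def)
qed

text \<open>The prediction error caused by an excitation is \<open>P\<close> times its costate and
  its normalized innovation is \<nu> again, so smoothing removes exactly this error.\<close>

lemma smoother_excitation: "smoother (excitation \<nu>) = 0"
proof -
  let ?p = "costate \<nu>"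
  have "P \<rhd> ?p = predictor (excitation \<nu>)"
    unfolding predictor_def
  proof (rule resolvent_unique[OF powers_FP])
    show "shift 1 (P \<rhd> ?p) = FP \<rhd> P \<rhd> ?p + (G \<rhd> inl_row \<rhd> excitation \<nu> - KP \<rhd> inr_row \<rhd> excitation \<nu>)"
      unfolding P_costate_step by (simp add: excitation_def pointwise_add pointwise_diff H_P_costate F_FP)
  qed
  then have pr: "predictor (excitation \<nu>) = P \<rhd> ?p"
    by (rule sym)
  have "innovation (excitation \<nu>) = RP \<rhd> \<nu>"
    unfolding innovation_def pr H_P_costate by (simp add: excitation_def)
  then show ?thesis
    by (simp add: smoother_def pr pointwise_mult matrix_inv_right_left[OF inv_RP])
qed

text \<open>\<open>smoother_step\<close> read in time, with \<open>q\<close> the next costate: what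
  remains after removing the excitation is output-nulling, and its state is the smoothing
  error.\<close>

lemma decomposition:
  fixes d :: "(complex^('m + 'p)) ell2"
  defines "\<nu> \<equiv> RPi \<rhd> innovation d"
  obtains w v where "output_null w v (smoother d)" "d = stack w v + excitation \<nu>"
    "(norm d)\<^sup>2 = (norm w)\<^sup>2 + (norm v)\<^sup>2 + \<nu> \<bullet> (RP \<rhd> \<nu>)"
proof -
  let ?p = "costate \<nu>"
  define w where "w = inl_row \<rhd> d - inl_row \<rhd> excitation \<nu>"
  define v where "v = inr_row \<rhd> d - inr_row \<rhd> excitation \<nu>"
  have step: "predictor d $$ (i + 1) = FP *v (predictor d $$ i) + G *v (inl_row *v d $$ i) - KP *v (inr_row *v d $$ i)"
    "?p $$ i = FP\<^sup>\<dagger> *v (?p $$ (i + 1)) + H\<^sup>\<dagger> *v (RPi *v innovation d $$ i)"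
    "innovation d $$ i = H *v (predictor d $$ i) + inr_row *v d $$ i" for i
    using arg_cong[OF predictor, of "\<lambda>x. x $$ i" d] arg_cong[OF costate, of "\<lambda>x. x $$ i" \<nu>]
    by (simp_all add: \<nu>_def innovation_def)
  note sm = smoother_step[OF step(1,3,2) refl]
  have wi: "w $$ i = inl_row *v d $$ i - G\<^sup>\<dagger> *v (?p $$ (i + 1))" for i
    using arg_cong[OF stack_parts(1), of "\<lambda>x. x $$ i"] by (simp add: w_def excitation_def)
  have vi: "v $$ i = inr_row *v d $$ i - (RPi *v innovation d $$ i - KP\<^sup>\<dagger> *v (?p $$ (i + 1)))" for i
    using arg_cong[OF stack_parts(2), of "\<lambda>x. x $$ i"] by (simp add: v_def excitation_def \<nu>_def)
  have null: "output_null w v (smoother d)"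
    unfolding output_null_def
  proof (intro conjI ell2_eqI)
    fix i
    show "shift 1 (smoother d) $$ i = (F \<rhd> smoother d + G \<rhd> w) $$ i"
      using sm(1)[of i] by (simp add: smoother_def \<nu>_def[symmetric] wi)
    show "(H \<rhd> smoother d + v) $$ i = 0 $$ i"
      using sm(2)[of i] by (simp add: smoother_def \<nu>_def[symmetric] vi)
  qed
  have d: "d = stack w v + excitation \<nu>"
    using stack_collapse[of d] stack_collapse[of "excitation \<nu>"]
    by (simp add: w_def v_def stack_def pointwise_diff algebra_simps)
  have "(norm d)\<^sup>2 = (norm w)\<^sup>2 + (norm v)\<^sup>2 + \<nu> \<bullet> (RP \<rhd> \<nu>)"
    by (subst d) (rule norm_add_excitation[OF null])
  with null d that show ?thesis
    by blast
qed

end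

section \<open>Necessity\<close>

context regret_data
begin

text \<open>The balance of \<open>Y\<close> along an impulse response, which shows it to be the
  observability Gramian.\<close>

lemma observability_energy:
  defines "z \<equiv> \<lambda>j \<xi>. resolvent FP (single j \<xi>)"
  shows "(H \<rhd> z j \<xi>) \<bullet> (RPi \<rhd> H \<rhd> z j \<xi>) = \<xi> \<bullet> (Y *v \<xi>)"
proof -
  let ?z = "z j \<xi>"
  \<comment> \<open>The resolvent is strictly causal, so \<open>FP \<rhd> ?z\<close> and the impulse
    have disjoint supports and the cross terms vanish.\<close>
  have z0: "?z $$ j = 0"
    unfolding z_def by (intro resolvent_start[OF powers_FP, of j]) auto
  have "?z \<bullet> (Y \<rhd> ?z) = (FP \<rhd> ?z) \<bullet> (Y \<rhd> FP \<rhd> ?z) + (H \<rhd> ?z) \<bullet> (RPi \<rhd> H \<rhd> ?z)"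
    by (subst (1) Y_eq) (simp add: pointwise_add_left inner_add_right inner_pointwise pointwise_mult matrix_mul_assoc)
  moreover have "?z \<bullet> (Y \<rhd> ?z) = (FP \<rhd> ?z) \<bullet> (Y \<rhd> FP \<rhd> ?z) + \<xi> \<bullet> (Y *v \<xi>)"
  proof -
    have "?z \<bullet> (Y \<rhd> ?z) = shift 1 ?z \<bullet> (Y \<rhd> shift 1 ?z)"
      by (simp add: shift_pointwise[symmetric] inner_shift)
    also have "shift 1 ?z = FP \<rhd> ?z + single j \<xi>"
      unfolding z_def by (rule resolvent[OF powers_FP])
    finally show ?thesis
      using inner_disjoint[of "single j \<xi>" "FP \<rhd> ?z" Y] inner_disjoint[of "FP \<rhd> ?z" "single j \<xi>" Y] z0
      by (simp add: pointwise_add inner_add_left inner_add_right inner_single)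
  qed
  ultimately show ?thesis
    by simp
qed

context
  fixes K :: "int \<Rightarrow> int \<Rightarrow> complex^'p^'q"
  assumes K: "causal K" and bounded: "block_bounded (error_matrix F G H L K)"
begin

abbreviation "err \<equiv> block_op (error_matrix F G H L K)"

lemma bounded_linear_err: "bounded_linear err"
  using bounded by (simp add: block_bounded_def)

lemma err_causal:
  assumes "\<And>j. j < N \<Longrightarrow> d $$ j = 0" "i < N"
  shows "err d $$ i = 0"
proof -
  have "err d $$ i = (\<Sum>j\<in>{N..i}. error_matrix F G H L K i j *v d $$ j)"
    unfolding block_op_nth[OF bounded] by (rule block_apply_start[OF causal_error_matrix[OF K] assms(1)])
  then show ?thesis
    using assms(2) by simp
qed

text \<open>A trajectory with zero output is invisible to the estimator. Since \<open>F\<close> may be unstable, this is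
  first seen for trajectories with a starting time; these are dense, as \<open>F\<^sub>W\<close> is stable.\<close>

lemma err_output_null:
  assumes null: "output_null w v x"
  shows "err (stack w v) = L \<rhd> x"
proof -
  define om where "om = w + KW \<rhd> x"
  define X where "X = (\<lambda>o'. resolvent FW (G \<rhd> o'))"
  define D where "D = (\<lambda>o'. stack (o' - KW \<rhd> X o') (- (H \<rhd> X o')))"
  have X: "shift 1 (X o') = FW \<rhd> X o' + G \<rhd> o'" for o'
    unfolding X_def by (rule resolvent[OF powers_FW])
  have bX: "bounded_linear X"
    unfolding X_def
    by (rule bounded_linear_compose[OF bounded_linear_resolvent[OF powers_FW] bounded_linear_pointwise])
  have bD: "bounded_linear D"
    unfolding D_def stack_def
    by (intro bounded_linear_add bounded_linear_compose[OF bounded_linear_pointwise] bounded_linear_sub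
        bounded_linear_ident bX bounded_linear_minus)
  have x: "x = X om"
    using output_null_regulator(1)[OF null] resolvent_unique[OF powers_FW] by (simp add: X_def om_def)
  have wv: "stack w v = D om"
    unfolding D_def x[symmetric] using null by (simp add: om_def output_null_def add_eq_0_iff)
  have start: "err (D o') = L \<rhd> X o'" if o': "\<And>i. i < N \<Longrightarrow> o' $$ i = 0" for o' N
  proof (rule ell2_eqI)
    fix i
    have X0: "X o' $$ j = 0" if "j \<le> N" for j
      unfolding X_def using o' that by (intro resolvent_start[OF powers_FW, of N]) auto
    have D0: "D o' $$ j = 0" if "j < N" for j
      using that by (simp add: D_def stack_def X0 o')
    have nl: "output_null (o' - KW \<rhd> X o') (- (H \<rhd> X o')) (X o')"
      by (rule output_null_of_regulator[OF X])
    have parts: "inl_row *v D o' $$ j = (o' - KW \<rhd> X o') $$ j" "inr_row *v D o' $$ j = (- (H \<rhd> X o')) $$ j" for j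
      by (metis D_def stack_parts pointwise.rep_eq)+
    \<comment> \<open>Both states start at rest, so the square-summable state of \<open>FW\<close>
      is the finite-sum state of \<open>F\<close>; the estimator then sees a zero output.\<close>
    have st: "state N F (\<lambda>i. G *v (inl_row *v D o' $$ i)) j = X o' $$ j" for j
    proof (rule state_unique[symmetric])
      show "X o' $$ (i + 1) = F *v X o' $$ i + G *v (inl_row *v D o' $$ i)" for i
        using arg_cong[OF conjunct1[OF nl[unfolded output_null_def]], of "\<lambda>x. x $$ i"] unfolding parts by simp
    qed (rule X0)
    have "err (D o') $$ i = L *v state N F (\<lambda>i. G *v (inl_row *v D o' $$ i)) i -
        causal_apply N K (\<lambda>k. H *v state N F (\<lambda>i. G *v (inl_row *v D o' $$ i)) k + inr_row *v D o' $$ k) i"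
      unfolding block_op_nth[OF bounded] by (rule error_matrix_apply[OF K D0])
    then show "err (D o') $$ i = (L \<rhd> X o') $$ i"
      unfolding st unfolding parts by (simp add: causal_apply_def)
  qed
  have lim: "(\<lambda>N. f (window {- int N..} om)) \<longlonglongrightarrow> f om"
    if "bounded_linear f" for f :: "(complex^'m) ell2 \<Rightarrow> (complex^'q) ell2"
    by (rule bounded_linear.tendsto[OF that window_tendsto])
  have "(\<lambda>N. L \<rhd> X (window {- int N..} om)) \<longlonglongrightarrow> err (D om)"
  proof -
    have "err (D (window {- int N..} om)) = L \<rhd> X (window {- int N..} om)" for N
      by (rule start[of "- int N"]) simp
    then show ?thesis
      using lim[OF bounded_linear_compose[OF bounded_linear_err bD]] by simp
  qed
  then have "err (D om) = L \<rhd> X om"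
    using lim[OF bounded_linear_compose[OF bounded_linear_pointwise bX]] LIMSEQ_unique by blast
  then show ?thesis
    by (simp add: wv x)
qed

text \<open>Before the innovations start the estimator can only react to what an output-nulling
  trajectory already determines, so these errors are the same for every \<open>K\<close>.
  Subtracting disturbances supported from time 1 on makes the rest output-nulling.\<close>

lemma err_excitation:
  assumes \<nu>: "\<And>i. i < 1 \<Longrightarrow> \<nu> $$ i = 0" and i: "i \<le> 0"
  shows "err (excitation \<nu>) $$ i = L *v (P *v costate \<nu> $$ i)"
proof -
  \<comment> \<open>Absorbs the term \<open>KP \<rhd> RP \<rhd> \<nu>\<close> of
    \<open>P_costate_step\<close>; \<open>FW\<close> keeps it square-summable, at the price of the
    feedback in \<open>w\<close>.\<close>
  define chi where "chi = resolvent FW (- (KP \<rhd> RP \<rhd> \<nu>))"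
  have chi: "shift 1 chi = FW \<rhd> chi - KP \<rhd> RP \<rhd> \<nu>"
    using resolvent[OF powers_FW, of "- (KP \<rhd> RP \<rhd> \<nu>)"] by (simp add: chi_def)
  have chi0: "chi $$ j = 0" if "j \<le> 1" for j
    unfolding chi_def using \<nu> that by (intro resolvent_start[OF powers_FW, of 1]) auto
  define w where "w = - (KW \<rhd> chi)"
  define v where "v = RP \<rhd> \<nu> - H \<rhd> chi"
  have early: "err (stack w v) $$ i = 0"
    using i by (intro err_causal[of 1]) (auto simp: stack_def w_def v_def chi0 \<nu>)
  let ?l = "shift 1 (costate \<nu>)"
  have "output_null (G\<^sup>\<dagger> \<rhd> ?l - w) (\<nu> - KP\<^sup>\<dagger> \<rhd> ?l - v) (P \<rhd> costate \<nu> - chi)"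
    unfolding output_null_def
    by (simp add: shift_diff P_costate_step chi w_def v_def pointwise_diff pointwise_add pointwise_minus H_P_costate
        F_FW[of chi])
  from err_output_null[OF this]
  have "err (excitation \<nu> - stack w v) = L \<rhd> (P \<rhd> costate \<nu> - chi)"
    by (simp add: excitation_def stack_def pointwise_diff pointwise_add algebra_simps)
  then have "err (excitation \<nu>) = err (stack w v) + L \<rhd> (P \<rhd> costate \<nu> - chi)"
    by (simp add: linear_diff[OF bounded_linear.linear[OF bounded_linear_err]] algebra_simps)
  then show ?thesis
    using early i by (simp add: chi0 matrix_vector_mult_diff_distrib)
qed

context
  assumes regret: "onorm (regret_operator F G H L K) \<le> \<gamma>\<^sup>2"
begin

lemma regret_bound: "\<bar>(norm (err d))\<^sup>2 - (norm (L \<rhd> smoother d))\<^sup>2\<bar> \<le> \<gamma>\<^sup>2 * (norm d)\<^sup>2"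
proof -
  have "regret_operator F G H L K = (\<lambda>d. adjoint err (err d) - adjoint (\<lambda>d. L \<rhd> smoother d) (L \<rhd> smoother d))"
    by (simp add: regret_operator_def Let_def block_op_noncausal)
  then show ?thesis
    using onorm_gram_difference_le_iff[OF bounded_linear_err
      bounded_linear_compose[OF bounded_linear_pointwise bounded_linear_smoother], of "\<gamma>\<^sup>2" L] regret by simp
qed

text \<open>An excitation causes no smoothing error and an output-nulling trajectory is invisible to
  the estimator, so errors and energies add; the \<open>W\<close> identity then absorbs the
  noncausal error into the weight \<open>RW\<close>.\<close>

lemma regret_excitation_bound:
  assumes x: "shift 1 x = FW \<rhd> x + G \<rhd> om"
  shows "(norm (L \<rhd> x + err (excitation \<nu>)))\<^sup>2 \<le> \<gamma>\<^sup>2 * (om \<bullet> (RW \<rhd> om) + \<nu> \<bullet> (RP \<rhd> \<nu>))"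
proof -
  define w where "w = om - KW \<rhd> x"
  define v where "v = - (H \<rhd> x)"
  have null: "output_null w v x"
    unfolding w_def v_def by (rule output_null_of_regulator[OF x])
  have "smoother (stack w v + excitation \<nu>) = x"
    using linear_add[OF bounded_linear.linear[OF bounded_linear_smoother]]
    by (simp add: smoother_null[OF null] smoother_excitation)
  moreover have "err (stack w v + excitation \<nu>) = L \<rhd> x + err (excitation \<nu>)"
    using linear_add[OF bounded_linear.linear[OF bounded_linear_err]] by (simp add: err_output_null[OF null])
  moreover have "(norm (stack w v + excitation \<nu>))\<^sup>2 = (norm w)\<^sup>2 + (norm v)\<^sup>2 + \<nu> \<bullet> (RP \<rhd> \<nu>)"
    by (rule norm_add_excitation[OF null])
  ultimately have "(norm (L \<rhd> x + err (excitation \<nu>)))\<^sup>2 \<le>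
      (norm (L \<rhd> x))\<^sup>2 + \<gamma>\<^sup>2 * ((norm w)\<^sup>2 + (norm v)\<^sup>2 + \<nu> \<bullet> (RP \<rhd> \<nu>))"
    using regret_bound[of "stack w v + excitation \<nu>"] by simp
  also have "\<dots> = \<gamma>\<^sup>2 * ((norm w)\<^sup>2 + (norm v)\<^sup>2 + (norm (L \<rhd> x))\<^sup>2 / \<gamma>\<^sup>2 + \<nu> \<bullet> (RP \<rhd> \<nu>))"
    using \<gamma> by (simp add: distrib_left)
  also have "(norm w)\<^sup>2 + (norm v)\<^sup>2 + (norm (L \<rhd> x))\<^sup>2 / \<gamma>\<^sup>2 = om \<bullet> (RW \<rhd> om)"
    using output_null_regulator(2)[OF null] by (simp add: w_def)
  finally show ?thesis .
qed

text \<open>\<open>g\<close> is \<open>f\<close> filtered by the inverse of the factor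
  \<open>M\<close> from \<open>Q_energy\<close>, with state matrix \<open>FQ\<close>. For the
  extremal \<open>om\<close> the completed squares leave nothing over, and the \<open>om\<close>
  energy cancels.\<close>

lemma whitened_bound:
  fixes \<nu> :: "(complex^'p) ell2"
  defines "f \<equiv> err (excitation \<nu>)"
  defines "g \<equiv> f - L \<rhd> resolvent FQ (KQ \<rhd> f)"
  shows "g \<bullet> (RQi \<rhd> g) \<le> \<nu> \<bullet> (RP \<rhd> \<nu>)"
proof -
  define eta where "eta = resolvent FQ (KQ \<rhd> f)"
  have g: "g = f - L \<rhd> eta"
    by (simp add: g_def eta_def)
  have "FW \<rhd> eta = FQ \<rhd> eta + KQ \<rhd> L \<rhd> eta"
    by (subst FW_FQ) (simp add: pointwise_add_left pointwise_mult)
  then have eta: "shift 1 eta = FW \<rhd> eta + KQ \<rhd> g"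
    using resolvent[OF powers_FQ, of "KQ \<rhd> f"] by (simp add: eta_def[symmetric] g pointwise_diff)
  \<comment> \<open>Chosen so that \<open>u + KQ\<^sup>\<dagger> \<rhd> l = RQi \<rhd> g\<close>;
    the pairing and the dual energy then both equal \<open>s\<close>.\<close>
  define lam where "lam = anti_resolvent (FQ\<^sup>\<dagger>) (L\<^sup>\<dagger> \<rhd> RQi \<rhd> g)"
  define l where "l = shift 1 lam"
  define u where "u = RQi \<rhd> g - KQ\<^sup>\<dagger> \<rhd> l"
  have lam: "lam = FW\<^sup>\<dagger> \<rhd> l + L\<^sup>\<dagger> \<rhd> u"
    unfolding u_def l_def lam_def
    by (rule FQ_costate[OF anti_resolvent[OF powers_summable_cadj[OF powers_FQ]]])
  define om where "om = RWi \<rhd> G\<^sup>\<dagger> \<rhd> l"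
  have om: "RW \<rhd> om = G\<^sup>\<dagger> \<rhd> l" "RQ \<rhd> RQi \<rhd> g = g"
    by (simp_all add: om_def pointwise_mult matrix_mul_assoc matrix_inv_right_left[OF inv_RW]
        matrix_inv_right_left[OF inv_RQ])
  define x where "x = resolvent FW (G \<rhd> om)"
  have x: "shift 1 x = FW \<rhd> x + G \<rhd> om"
    unfolding x_def by (rule resolvent[OF powers_FW])
  define s where "s = om \<bullet> (RW \<rhd> om) + g \<bullet> (RQi \<rhd> g)"
  have "shift 1 (x + eta) = FW \<rhd> (x + eta) + G \<rhd> om + KQ \<rhd> g"
    by (simp add: shift_add x eta pointwise_add)
  from Q_pairing[OF lam l_def this]
  have "(L \<rhd> x + f) \<bullet> u = s"
    by (simp add: g pointwise_add s_def om u_def add_ac)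
  moreover have "s = \<gamma>\<^sup>2 * (norm u)\<^sup>2"
    using Q_energy[OF lam l_def] om by (simp add: s_def u_def om_def[symmetric] inner_commute)
  moreover have "2 * ((L \<rhd> x + f) \<bullet> u) \<le> (1 / \<gamma>\<^sup>2) * (norm (L \<rhd> x + f))\<^sup>2 + (norm u)\<^sup>2 / (1 / \<gamma>\<^sup>2)"
    using \<gamma> by (intro two_inner_le) simp
  ultimately have "s \<le> (norm (L \<rhd> x + f))\<^sup>2 / \<gamma>\<^sup>2"
    by (simp add: mult.commute)
  also have "\<dots> \<le> om \<bullet> (RW \<rhd> om) + \<nu> \<bullet> (RP \<rhd> \<nu>)"
    using regret_excitation_bound[OF x, of \<nu>] \<gamma> by (simp add: f_def field_simps)
  finally show ?thesis
    by (simp add: s_def)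
qed

text \<open>Innovations starting at time 1 leave the errors up to time 0 fixed by
  \<open>err_excitation\<close>. The equation for \<open>U\<close> turns them into \<open>N\<close>
  applied to the next costate, whose energy \<open>Z\<close> collects; later errors are
  discarded.\<close>

lemma hankel_bound:
  assumes \<nu>: "\<And>i. i < 1 \<Longrightarrow> \<nu> $$ i = 0"
  shows "costate \<nu> $$ 1 \<bullet> (Z *v costate \<nu> $$ 1) \<le> \<nu> \<bullet> (RP \<rhd> \<nu>)"
proof -
  define p where "p = costate \<nu>"
  define f where "f = err (excitation \<nu>)"
  define eta where "eta = resolvent FQ (KQ \<rhd> f)"
  define g where "g = f - L \<rhd> eta"
  define N where "N = L ** (P - U) ** FP\<^sup>\<dagger>"
  have p: "p $$ i = FP\<^sup>\<dagger> *v p $$ (i + 1)" if "i \<le> 0" for i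
    using arg_cong[OF costate, of "\<lambda>x. x $$ i" \<nu>] \<nu> that by (simp add: p_def)
  have f: "f $$ i = L *v (P *v p $$ i)" if "i \<le> 0" for i
    using err_excitation[OF \<nu> that] by (simp add: f_def p_def)
  \<comment> \<open>The defect \<open>eta - U \<rhd> p\<close> is bounded and solves the homogeneous
    recursion of \<open>FQ\<close> on the past, hence vanishes.\<close>
  have eta: "eta $$ i = U *v p $$ i" if "i \<le> 1" for i
  proof -
    have "(eta - U \<rhd> p) $$ (j + 1) = FQ *v (eta - U \<rhd> p) $$ j" if "j < 1" for j
    proof -
      have "U *v p $$ (j + 1) = (KQ ** L ** P) *v (FP\<^sup>\<dagger> *v p $$ (j + 1)) + (FQ ** U) *v (FP\<^sup>\<dagger> *v p $$ (j + 1))"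
        by (subst U_eq) (simp add: matrix_vector_mult_add_rdistrib matrix_vector_mul_assoc)
      moreover have "eta $$ (j + 1) = FQ *v eta $$ j + KQ *v f $$ j"
        using resolvent_nth_Suc[OF powers_FQ] by (simp add: eta_def)
      ultimately show ?thesis
        using that by (simp add: f p[symmetric] matrix_vector_mul_assoc matrix_vector_mult_diff_distrib matrix_mul_assoc)
    qed
    then have "(eta - U \<rhd> p) $$ i = 0"
      using that by (intro half_line_zero[OF powers_FQ norm_ell2_nth_le, where N=1]) auto
    then show ?thesis by simp
  qed
  have g: "g $$ i = N *v p $$ (i + 1)" if "i \<le> 0" for i
    using that by (simp add: g_def f eta N_def p[of i] matrix_vector_mul_assoc[symmetric]
        matrix_vector_mult_diff_rdistrib matrix_vector_mult_diff_distrib)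
  \<comment> \<open>Windows replace a telescoping series: the \<open>Z\<close> balance is taken over
    the whole past at once, and the boundary term at time 1 remains.\<close>
  let ?p1 = "window {..1} p" and ?p0 = "window {..0} p" and ?g0 = "window {..0} g" and ?g1 = "window (- {..0}) g"
  let ?l = "shift 1 ?p1"
  have l: "?p0 = FP\<^sup>\<dagger> \<rhd> ?l" "?g0 = N \<rhd> ?l"
    by (auto intro!: ell2_eqI simp: p g)
  have Z: "Z = FP ** Z ** FP\<^sup>\<dagger> + N\<^sup>\<dagger> ** RQi ** N"
    by (rule trans[OF Z_eq]) (simp add: N_def cadj_mult matrix_mul_assoc)
  have "?p1 \<bullet> (Z \<rhd> ?p1) = ?l \<bullet> (Z \<rhd> ?l)"
    by (simp add: shift_pointwise[symmetric] inner_shift)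
  also have "\<dots> = ?p0 \<bullet> (Z \<rhd> ?p0) + ?g0 \<bullet> (RQi \<rhd> ?g0)"
    unfolding l by (subst (1) Z) (simp add: pointwise_add_left inner_add_right inner_pointwise pointwise_mult matrix_mul_assoc)
  finally have 1: "?p1 \<bullet> (Z \<rhd> ?p1) = ?p0 \<bullet> (Z \<rhd> ?p0) + ?g0 \<bullet> (RQi \<rhd> ?g0)" .
  have "?p1 = ?p0 + single 1 (p $$ 1)"
    by (rule ell2_eqI) auto
  moreover have "?p0 \<bullet> (Z \<rhd> single 1 (p $$ 1)) = 0" "single 1 (p $$ 1) \<bullet> (Z \<rhd> ?p0) = 0"
    by (intro inner_disjoint; auto)+
  ultimately have 2: "?p1 \<bullet> (Z \<rhd> ?p1) = ?p0 \<bullet> (Z \<rhd> ?p0) + p $$ 1 \<bullet> (Z *v p $$ 1)"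
    by (simp add: pointwise_add inner_add_left inner_add_right inner_single)
  have gs: "g = ?g0 + ?g1"
    by (rule ell2_eqI) auto
  have "?g0 \<bullet> (RQi \<rhd> ?g1) = 0" "?g1 \<bullet> (RQi \<rhd> ?g0) = 0"
    by (intro inner_disjoint; auto)+
  then have "g \<bullet> (RQi \<rhd> g) = ?g0 \<bullet> (RQi \<rhd> ?g0) + ?g1 \<bullet> (RQi \<rhd> ?g1)"
    by (intro trans[OF arg_cong[OF gs, of "\<lambda>g. g \<bullet> (RQi \<rhd> g)"]])
      (simp only: pointwise_add inner_add_left inner_add_right add_0_left add_0_right)
  moreover have "0 \<le> ?g1 \<bullet> (RQi \<rhd> ?g1)"
    using posdef_inv[OF posdef_RQ] by (intro pointwise_psd) (simp add: posdef_def)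
  ultimately have "p $$ 1 \<bullet> (Z *v p $$ 1) \<le> g \<bullet> (RQi \<rhd> g)"
    using 1 2 by linarith
  also have "\<dots> \<le> \<nu> \<bullet> (RP \<rhd> \<nu>)"
    using whitened_bound[of \<nu>] by (simp add: g_def eta_def f_def)
  finally show ?thesis
    by (simp add: p_def)
qed

text \<open>The test innovations are the weighted output of the free response to \<xi>: they produce
  the costate \<open>Y *v \<xi>\<close> at time 1 at the cost
  \<open>\<xi> \<bullet> (Y *v \<xi>)\<close>.\<close>

lemma necessity_form: "(Y *v \<xi>) \<bullet> (Z *v (Y *v \<xi>)) \<le> \<xi> \<bullet> (Y *v \<xi>)"
proof -
  define z where "z = resolvent FP (single 0 \<xi>)"
  define \<nu> where "\<nu> = RPi \<rhd> H \<rhd> z"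
  have z0: "z $$ i = 0" if "i \<le> 0" for i
    unfolding z_def using that by (intro resolvent_start[OF powers_FP, of 0]) auto
  have z: "z $$ (i + 1) = FP *v z $$ i + single 0 \<xi> $$ i" for i
    using resolvent_nth_Suc[OF powers_FP] by (simp add: z_def)
  have z1: "z $$ 1 = \<xi>"
    using z[of 0] z0[of 0] by simp
  have \<nu>: "\<nu> $$ i = 0" if "i < 1" for i
    using that z0[of i] by (simp add: \<nu>_def)
  \<comment> \<open>After the impulse at 0 the response is free, so \<open>Y \<rhd> z\<close> solves
    the costate recursion from time 1 on; uniqueness towards the future identifies the two.\<close>
  have "(costate \<nu> - Y \<rhd> z) $$ 1 = 0"
  proof (rule half_line_zero_anti[OF powers_summable_cadj[OF powers_FP] norm_ell2_nth_le, where N=1])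
    fix i :: int
    assume i: "1 \<le> i"
    have "Y *v z $$ i = FP\<^sup>\<dagger> *v (Y *v (FP *v z $$ i)) + H\<^sup>\<dagger> *v (RPi *v (H *v z $$ i))"
      by (subst Y_eq) (simp add: matrix_vector_mult_add_rdistrib matrix_vector_mul_assoc matrix_mul_assoc)
    moreover have "FP *v z $$ i = z $$ (i + 1)"
      using z[of i] i by simp
    moreover have "costate \<nu> $$ i = FP\<^sup>\<dagger> *v costate \<nu> $$ (i + 1) + H\<^sup>\<dagger> *v \<nu> $$ i"
      using arg_cong[OF costate, of "\<lambda>x. x $$ i" \<nu>] by simp
    ultimately show "(costate \<nu> - Y \<rhd> z) $$ i = FP\<^sup>\<dagger> *v (costate \<nu> - Y \<rhd> z) $$ (i + 1)"
      by (simp add: \<nu>_def matrix_vector_mult_diff_distrib)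
  qed simp
  then have p1: "costate \<nu> $$ 1 = Y *v \<xi>"
    by (simp add: z1)
  have "RP \<rhd> \<nu> = H \<rhd> z"
    by (simp add: \<nu>_def pointwise_mult matrix_mul_assoc matrix_inv_right_left[OF inv_RP])
  then have "\<nu> \<bullet> (RP \<rhd> \<nu>) = \<xi> \<bullet> (Y *v \<xi>)"
    using observability_energy[of 0 \<xi>] by (simp add: \<nu>_def z_def inner_commute)
  then show ?thesis
    using hankel_bound[OF \<nu>] p1 by simp
qed

text \<open>On an eigenvector \<open>necessity_form\<close> compares the form of \<open>Y\<close>
  with \<open>t\<close> times itself; for \<open>t > 1\<close> it vanishes, so
  \<open>Y v = 0\<close>, contradicting a nonzero eigenvalue.\<close>

lemma necessity_eigenval:
  assumes "eigenval (Z ** Y) (complex_of_real t)"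
  shows "t \<le> 1"
proof (rule ccontr)
  assume t: "\<not> t \<le> 1"
  obtain v where v: "v \<noteq> 0" "(Z ** Y) *v v = complex_of_real t *s v"
    using assms by (auto simp: eigenval_def)
  then have ZY: "Z *v (Y *v v) = t *\<^sub>R v"
    by (simp add: matrix_vector_mul_assoc scaleR_eq_of_real_smult)
  have "t * (v \<bullet> (Y *v v)) \<le> v \<bullet> (Y *v v)"
    using necessity_form[of v] by (simp add: ZY inner_commute)
  then have "(t - 1) * (v \<bullet> (Y *v v)) \<le> 0"
    by (simp add: algebra_simps)
  then have "v \<bullet> (Y *v v) \<le> 0"
    using t by (simp add: mult_le_0_iff)
  then have "Y *v v = 0"
    by (rule psd_kernel[OF psd_Y])
  then show False
    using ZY v t by simp
qed

end

end

end

section \<open>Extension of contractions\<close>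

lemma quadratic_discriminant:
  fixes A B C :: real
  assumes q: "\<And>t. 0 \<le> t\<^sup>2 * B - 2 * t * A + C" and B: "0 \<le> B"
  shows "A\<^sup>2 \<le> B * C"
proof (cases "B = 0")
  case True
  have "A = 0"
  proof (rule ccontr)
    assume "A \<noteq> 0"
    then show False
      using q[of "(C + 1) / (2 * A)"] True by (simp add: field_simps)
  qed
  then show ?thesis
    using True by simp
next
  case False
  then show ?thesis
    using q[of "A / B"] B by (simp add: power2_eq_square field_simps)
qed

text \<open>A contraction on a subspace is extended by precomposition with the orthogonal projection. As the
  semi-inner product space need not be complete, only the image of the projection under the contraction
  is constructed, as a limit along a minimizing sequence.\<close>

lemma contraction_extension:
  fixes b :: "'v::real_vector \<Rightarrow> 'v \<Rightarrow> real" and \<zeta> :: "'v \<Rightarrow> 'w::banach" and r :: "'w \<Rightarrow> real"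
  assumes sym: "\<And>x y. b x y = b y x" and add: "\<And>x y z. b (x + y) z = b x z + b y z"
    and scale: "\<And>c x y. b (c *\<^sub>R x) y = c * b x y" and pos: "\<And>x. 0 \<le> b x x"
    and sub: "subspace S" and \<zeta>: "linear \<zeta>" and bound: "\<And>y. y \<in> S \<Longrightarrow> r (\<zeta> y) \<le> b y y"
    and k: "k > 0" "\<And>w. k * (norm w)\<^sup>2 \<le> r w" and cont: "continuous_on UNIV r"
  obtains \<zeta>' where "linear \<zeta>'" "\<And>y. y \<in> S \<Longrightarrow> \<zeta>' y = \<zeta> y" "\<And>x. r (\<zeta>' x) \<le> b x x"
proof -
  define s where "s x = sqrt (b x x)" for x
  have s0: "0 \<le> s x" and s2: "(s x)\<^sup>2 = b x x" for x
    using pos by (auto simp: s_def)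
  have diff: "b (x - y) z = b x z - b y z" for x y z
    using add[of "x - y" y z] by simp
  have add2: "b z (x + y) = b z x + b z y" for x y z
    using add[of x y z] sym by simp
  have diff2: "b z (x - y) = b z x - b z y" for x y z
    using diff[of x y z] sym by simp
  have scale2: "b z (c *\<^sub>R x) = c * b z x" for x z c
    using scale[of c x z] sym by simp
  have expand: "b (x - t *\<^sub>R y) (x - t *\<^sub>R y) = t\<^sup>2 * b y y - 2 * t * b x y + b x x" for x y t
    using sym[of y x] by (simp add: diff diff2 scale scale2 power2_eq_square algebra_simps)
  \<comment> \<open>Near-minimality along a line gives near-orthogonality to its direction;
    \<open>\<epsilon> = s x\<close> gives Cauchy-Schwarz.\<close>
  have disc: "\<bar>b x y\<bar> \<le> \<epsilon> * s y"
    if "\<And>t. b x x - \<epsilon>\<^sup>2 \<le> b (x - t *\<^sub>R y) (x - t *\<^sub>R y)" and \<epsilon>: "0 \<le> \<epsilon>" for x y \<epsilon>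
  proof -
    have "0 \<le> t\<^sup>2 * b y y - 2 * t * b x y + \<epsilon>\<^sup>2" for t
      using that(1)[of t] unfolding expand by linarith
    then have "(b x y)\<^sup>2 \<le> b y y * \<epsilon>\<^sup>2"
      by (rule quadratic_discriminant) (rule pos)
    then have "\<bar>b x y\<bar>\<^sup>2 \<le> (\<epsilon> * s y)\<^sup>2"
      by (simp add: power_mult_distrib s2 mult.commute)
    then show ?thesis
      by (rule power2_le_imp_le) (simp add: \<epsilon> s0)
  qed
  have cs: "\<bar>b x y\<bar> \<le> s x * s y" for x y
    by (rule disc) (simp_all add: s0 s2 pos)
  \<comment> \<open>\<open>c\<close> is the limit of images of approximate projections of
    \<open>e\<close> onto \<open>S\<close>; the projections themselves may diverge.\<close>
  define near where "near e c \<longleftrightarrow> (\<exists>y \<epsilon>. (\<forall>n. y n \<in> S) \<and> (\<forall>n. 0 \<le> \<epsilon> n) \<and> \<epsilon> \<longlonglongrightarrow> 0 \<and>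
    (\<forall>n. \<forall>v\<in>S. \<bar>b (e - y n) v\<bar> \<le> \<epsilon> n * s v) \<and> (\<lambda>n. \<zeta> (y n)) \<longlonglongrightarrow> c)" for e c
  define \<kappa> where "\<kappa> = 1 / sqrt k"
  have \<zeta>s: "norm (\<zeta> y) \<le> \<kappa> * s y" if "y \<in> S" for y
  proof (rule power2_le_imp_le)
    have "k * (norm (\<zeta> y))\<^sup>2 \<le> (s y)\<^sup>2"
      using k(2)[of "\<zeta> y"] bound[OF that] by (simp add: s2)
    then show "(norm (\<zeta> y))\<^sup>2 \<le> (\<kappa> * s y)\<^sup>2"
      using k(1) by (simp add: \<kappa>_def power_mult_distrib power_divide field_simps)
  qed (use k s0 in \<open>simp add: \<kappa>_def\<close>)
  \<comment> \<open>Two approximate projections differ by a small element of \<open>S\<close>, as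
    pairing the difference with itself shows. This serves both the Cauchy property and
    uniqueness.\<close>
  have close: "norm (\<zeta> y - \<zeta> y') \<le> \<kappa> * (\<epsilon> + \<epsilon>')"
    if "y \<in> S" "y' \<in> S" "\<forall>v\<in>S. \<bar>b (e - y) v\<bar> \<le> \<epsilon> * s v" "\<forall>v\<in>S. \<bar>b (e - y') v\<bar> \<le> \<epsilon>' * s v"
      "0 \<le> \<epsilon>" "0 \<le> \<epsilon>'" for e y y' \<epsilon> \<epsilon>'
  proof -
    let ?u = "y - y'"
    have u: "?u \<in> S"
      using that sub subspace_diff by blast
    have "(s ?u)\<^sup>2 = b (e - y') ?u - b (e - y) ?u"
      unfolding s2 by (simp add: diff)
    also have "\<dots> \<le> (\<epsilon> + \<epsilon>') * s ?u"
      using that(3)[rule_format, OF u] that(4)[rule_format, OF u] by (simp add: distrib_right)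
    finally have le: "s ?u * s ?u \<le> (\<epsilon> + \<epsilon>') * s ?u"
      by (simp add: power2_eq_square)
    have "s ?u \<le> \<epsilon> + \<epsilon>'"
      using le s0[of ?u] that(5,6) by (cases "s ?u = 0") auto
    then have "\<kappa> * s ?u \<le> \<kappa> * (\<epsilon> + \<epsilon>')"
      using k(1) by (intro mult_left_mono) (auto simp: \<kappa>_def)
    then show ?thesis
      using \<zeta>s[OF u] by (simp add: linear_diff[OF \<zeta>])
  qed
  have ex: "\<exists>c. near e c" for e
  proof -
    define D where "D = (\<lambda>y. b (e - y) (e - y)) ` S"
    have D: "bdd_below D" "D \<noteq> {}"
      using pos subspace_0[OF sub] by (auto simp: D_def intro!: bdd_belowI)
    define \<epsilon> where "\<epsilon> n = 1 / real (Suc n)" for n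
    \<comment> \<open>The excess over the infimum is squared because \<open>disc\<close> works with
      its square root.\<close>
    have "\<exists>y\<in>S. b (e - y) (e - y) < Inf D + (\<epsilon> n)\<^sup>2" for n
      using cInf_lessD[OF D(2), of "Inf D + (\<epsilon> n)\<^sup>2"] by (auto simp: D_def \<epsilon>_def)
    then obtain y where y: "\<And>n. y n \<in> S" "\<And>n. b (e - y n) (e - y n) < Inf D + (\<epsilon> n)\<^sup>2"
      by metis
    have near_y: "\<bar>b (e - y n) v\<bar> \<le> \<epsilon> n * s v" if v: "v \<in> S" for n v
    proof (rule disc)
      fix t
      have "y n + t *\<^sub>R v \<in> S"
        using y v sub by (simp add: subspace_add subspace_scale)
      then have "Inf D \<le> b (e - (y n + t *\<^sub>R v)) (e - (y n + t *\<^sub>R v))"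
        by (intro cInf_lower D) (auto simp: D_def)
      then show "b (e - y n) (e - y n) - (\<epsilon> n)\<^sup>2 \<le> b (e - y n - t *\<^sub>R v) (e - y n - t *\<^sub>R v)"
        using y(2)[of n] by (simp add: diff_diff_eq)
    qed (simp add: \<epsilon>_def)
    have \<epsilon>: "\<epsilon> \<longlonglongrightarrow> 0"
      unfolding \<epsilon>_def using LIMSEQ_inverse_real_of_nat by (simp add: inverse_eq_divide)
    have "Cauchy (\<lambda>n. \<zeta> (y n))"
    proof (rule metric_CauchyI)
      fix \<delta> :: real assume "0 < \<delta>"
      then have "\<delta> / (2 * (\<kappa> + 1)) > 0"
        using k(1) by (simp add: \<kappa>_def add_pos_pos)
      then obtain M where M: "\<And>n. M \<le> n \<Longrightarrow> \<epsilon> n < \<delta> / (2 * (\<kappa> + 1))"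
        using LIMSEQ_D[OF \<epsilon>] by (auto simp: \<epsilon>_def)
      have "dist (\<zeta> (y m)) (\<zeta> (y n)) < \<delta>" if mn: "M \<le> m" "M \<le> n" for m n
      proof -
        have "dist (\<zeta> (y m)) (\<zeta> (y n)) \<le> \<kappa> * (\<epsilon> m + \<epsilon> n)"
          unfolding dist_norm using near_y y by (intro close[where e=e]) (auto simp: \<epsilon>_def)
        also have "\<dots> \<le> (\<kappa> + 1) * (\<epsilon> m + \<epsilon> n)"
          by (intro mult_right_mono) (auto simp: \<epsilon>_def)
        also have "\<dots> < (\<kappa> + 1) * (\<delta> / (2 * (\<kappa> + 1)) + \<delta> / (2 * (\<kappa> + 1)))"
          using M[OF mn(1)] M[OF mn(2)] k(1) by (intro mult_strict_left_mono add_strict_mono) (auto simp: \<kappa>_def add_pos_pos)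
        also have "\<dots> = \<delta>"
          using k(1) by (simp add: \<kappa>_def field_simps add_pos_pos less_imp_neq[symmetric])
        finally show ?thesis .
      qed
      then show "\<exists>M. \<forall>m\<ge>M. \<forall>n\<ge>M. dist (\<zeta> (y m)) (\<zeta> (y n)) < \<delta>"
        by blast
    qed
    then obtain c where "(\<lambda>n. \<zeta> (y n)) \<longlonglongrightarrow> c"
      using Cauchy_convergent_iff convergent_def by blast
    then have "near e c"
      unfolding near_def using y(1) near_y \<epsilon> by (intro exI[of _ y] exI[of _ \<epsilon>]) (auto simp: \<epsilon>_def)
    then show ?thesis ..
  qed
  have uniq: "c = c'" if nc: "near e c" "near e c'" for e c c'
  proof -
    obtain y \<epsilon> where y: "\<forall>n. y n \<in> S" "\<forall>n. 0 \<le> \<epsilon> n" "\<epsilon> \<longlonglongrightarrow> 0"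
      "\<forall>n. \<forall>v\<in>S. \<bar>b (e - y n) v\<bar> \<le> \<epsilon> n * s v" "(\<lambda>n. \<zeta> (y n)) \<longlonglongrightarrow> c"
      using nc(1) unfolding near_def by blast
    obtain y' \<epsilon>' where y': "\<forall>n. y' n \<in> S" "\<forall>n. 0 \<le> \<epsilon>' n" "\<epsilon>' \<longlonglongrightarrow> 0"
      "\<forall>n. \<forall>v\<in>S. \<bar>b (e - y' n) v\<bar> \<le> \<epsilon>' n * s v" "(\<lambda>n. \<zeta> (y' n)) \<longlonglongrightarrow> c'"
      using nc(2) unfolding near_def by blast
    have "(\<lambda>n. \<zeta> (y n) - \<zeta> (y' n)) \<longlonglongrightarrow> 0"
    proof (rule Lim_null_comparison)
      show "\<forall>\<^sub>F n in sequentially. norm (\<zeta> (y n) - \<zeta> (y' n)) \<le> \<kappa> * (\<epsilon> n + \<epsilon>' n)"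
        using y y' by (intro always_eventually allI close[where e=e]) auto
      have "(\<lambda>n. \<kappa> * (\<epsilon> n + \<epsilon>' n)) \<longlonglongrightarrow> \<kappa> * (0 + 0)"
        by (intro tendsto_intros y y')
      then show "(\<lambda>n. \<kappa> * (\<epsilon> n + \<epsilon>' n)) \<longlonglongrightarrow> 0"
        by simp
    qed
    then have "c - c' = 0"
      using LIMSEQ_unique[OF tendsto_diff[OF y(5) y'(5)]] by blast
    then show ?thesis
      by simp
  qed
  have near_add: "near (e + e') (c + c')" if nc: "near e c" "near e' c'" for e e' c c'
  proof -
    obtain y \<epsilon> where y: "\<forall>n. y n \<in> S" "\<forall>n. 0 \<le> \<epsilon> n" "\<epsilon> \<longlonglongrightarrow> 0"
      "\<forall>n. \<forall>v\<in>S. \<bar>b (e - y n) v\<bar> \<le> \<epsilon> n * s v" "(\<lambda>n. \<zeta> (y n)) \<longlonglongrightarrow> c"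
      using nc(1) unfolding near_def by blast
    obtain y' \<epsilon>' where y': "\<forall>n. y' n \<in> S" "\<forall>n. 0 \<le> \<epsilon>' n" "\<epsilon>' \<longlonglongrightarrow> 0"
      "\<forall>n. \<forall>v\<in>S. \<bar>b (e' - y' n) v\<bar> \<le> \<epsilon>' n * s v" "(\<lambda>n. \<zeta> (y' n)) \<longlonglongrightarrow> c'"
      using nc(2) unfolding near_def by blast
    show ?thesis
      unfolding near_def
    proof (intro exI[of _ "\<lambda>n. y n + y' n"] exI[of _ "\<lambda>n. \<epsilon> n + \<epsilon>' n"] conjI allI ballI)
      show "(\<lambda>n. \<epsilon> n + \<epsilon>' n) \<longlonglongrightarrow> 0"
        using tendsto_add[OF y(3) y'(3)] by simp
      show "(\<lambda>n. \<zeta> (y n + y' n)) \<longlonglongrightarrow> c + c'"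
        using tendsto_add[OF y(5) y'(5)] by (simp add: linear_add[OF \<zeta>])
      fix n v assume v: "v \<in> S"
      have "b (e + e' - (y n + y' n)) v = b (e - y n) v + b (e' - y' n) v"
        by (simp add: add diff)
      then show "\<bar>b (e + e' - (y n + y' n)) v\<bar> \<le> (\<epsilon> n + \<epsilon>' n) * s v"
        using y(4)[rule_format, OF v, of n] y'(4)[rule_format, OF v, of n] by (simp add: distrib_right)
    qed (use y y' sub in \<open>auto simp: subspace_add\<close>)
  qed
  have near_scale: "near (a *\<^sub>R e) (a *\<^sub>R c)" if nc: "near e c" for a e c
  proof -
    obtain y \<epsilon> where y: "\<forall>n. y n \<in> S" "\<forall>n. 0 \<le> \<epsilon> n" "\<epsilon> \<longlonglongrightarrow> 0"
      "\<forall>n. \<forall>v\<in>S. \<bar>b (e - y n) v\<bar> \<le> \<epsilon> n * s v" "(\<lambda>n. \<zeta> (y n)) \<longlonglongrightarrow> c"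
      using nc(1) unfolding near_def by blast
    show ?thesis
      unfolding near_def
    proof (intro exI[of _ "\<lambda>n. a *\<^sub>R y n"] exI[of _ "\<lambda>n. \<bar>a\<bar> * \<epsilon> n"] conjI allI ballI)
      show "(\<lambda>n. \<bar>a\<bar> * \<epsilon> n) \<longlonglongrightarrow> 0"
        by (rule tendsto_mult_right_zero[OF y(3)])
      show "(\<lambda>n. \<zeta> (a *\<^sub>R y n)) \<longlonglongrightarrow> a *\<^sub>R c"
        using tendsto_scaleR[OF tendsto_const y(5)] by (simp add: linear_scale[OF \<zeta>])
      fix n v assume v: "v \<in> S"
      have "b (a *\<^sub>R e - a *\<^sub>R y n) v = a * b (e - y n) v"
        by (simp add: diff scale right_diff_distrib)
      then show "\<bar>b (a *\<^sub>R e - a *\<^sub>R y n) v\<bar> \<le> \<bar>a\<bar> * \<epsilon> n * s v"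
        using y(4)[rule_format, OF v, of n] by (simp add: abs_mult mult.assoc mult_left_mono)
    qed (use y sub in \<open>auto simp: subspace_scale\<close>)
  qed
  define \<zeta>' where "\<zeta>' e = (THE c. near e c)" for e
  have near: "near e (\<zeta>' e)" for e
    unfolding \<zeta>'_def using ex[of e] uniq by (auto intro: theI)
  show ?thesis
  proof
    show "linear \<zeta>'"
      using uniq[OF near near_add[OF near near]] uniq[OF near near_scale[OF near]]
      by (intro linearI) auto
    fix y assume "y \<in> S"
    then have "near y (\<zeta> y)"
      unfolding near_def using diff[of y y]
      by (intro exI[of _ "\<lambda>_. y"] exI[of _ "\<lambda>_. 0"]) auto
    then show "\<zeta>' y = \<zeta> y"
      using uniq near by blast
  next
    fix x
    obtain y \<epsilon> where y: "\<forall>n. y n \<in> S" "\<forall>n. 0 \<le> \<epsilon> n" "\<epsilon> \<longlonglongrightarrow> 0"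
      "\<forall>n. \<forall>v\<in>S. \<bar>b (x - y n) v\<bar> \<le> \<epsilon> n * s v" "(\<lambda>n. \<zeta> (y n)) \<longlonglongrightarrow> \<zeta>' x"
      using near[of x] unfolding near_def by blast
    have "r (\<zeta> (y n)) \<le> (s x + \<epsilon> n)\<^sup>2" for n
    proof -
      have "(s (y n))\<^sup>2 = b x (y n) - b (x - y n) (y n)"
        unfolding s2 by (simp add: diff)
      also have "\<dots> \<le> (s x + \<epsilon> n) * s (y n)"
        using cs[of x "y n"] y(4)[rule_format, of "y n" n] y(1) by (simp add: distrib_right abs_le_iff)
      finally have "s (y n) * s (y n) \<le> (s x + \<epsilon> n) * s (y n)"
        by (simp add: power2_eq_square)
      then have "s (y n) \<le> s x + \<epsilon> n"
        using s0[of "y n"] s0[of x] y(2) by (cases "s (y n) = 0") auto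
      then have "(s (y n))\<^sup>2 \<le> (s x + \<epsilon> n)\<^sup>2"
        using s0 by (intro power_mono) auto
      then show ?thesis
        using bound[of "y n"] y(1) by (simp add: s2 order_trans)
    qed
    moreover have "(\<lambda>n. (s x + \<epsilon> n)\<^sup>2) \<longlonglongrightarrow> (s x + 0)\<^sup>2"
      by (intro tendsto_intros y)
    moreover have "(\<lambda>n. r (\<zeta> (y n))) \<longlonglongrightarrow> r (\<zeta>' x)"
      by (rule continuous_on_tendsto_compose[OF cont y(5)]) auto
    ultimately have "r (\<zeta>' x) \<le> (s x + 0)\<^sup>2"
      by (intro LIMSEQ_le) auto
    then show "r (\<zeta>' x) \<le> b x x"
      by (simp add: s2)
  qed
qed

section \<open>The Nehari problem\<close>

lemma mat_commute: "A *v (mat c *v x) = mat c *v (A *v x)" for A :: "complex^'n^'m"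
  by (simp add: mat_mult_vec vector_scalar_commute)

lemma inner_mat_unit:
  fixes c :: complex and x :: "complex^'n"
  assumes "norm c = 1"
  shows "(mat c *v x) \<bullet> (A *v (mat c *v x)) = x \<bullet> (A *v x)"
proof -
  have "mat (cnj c) *v (mat c *v y) = y" for y :: "complex^'n"
    using assms by (simp add: mat_mult_vec vector_smult_assoc complex_norm_square[symmetric] mult.commute)
  then show ?thesis
    unfolding mat_commute[of A] inner_matrix_vector[of "mat c"] cadj_mat by simp
qed

lemma inner_mat_unit_pointwise: "norm c = 1 \<Longrightarrow> (mat c \<rhd> x) \<bullet> (A \<rhd> mat c \<rhd> x) = x \<bullet> (A \<rhd> x)"
  by (simp add: inner_ell2.rep_eq inner_mat_unit)

text \<open>Convexity of the form; it preserves the contraction bound under the average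
  below.\<close>

lemma psd_midpoint:
  assumes "psd R"
  shows "((1/2) *\<^sub>R (u + v)) \<bullet> (R *v ((1/2) *\<^sub>R (u + v))) \<le> (u \<bullet> (R *v u) + v \<bullet> (R *v v)) / 2"
proof -
  have "0 \<le> u \<bullet> (R *v u) + v \<bullet> (R *v v) - 2 * (u \<bullet> (R *v v))"
    using psd_nonneg[OF assms, of "u - v"] hermitian_inner[OF psd_hermitian[OF assms], of u v]
    by (simp add: matrix_vector_mult_diff_distrib inner_diff_left inner_diff_right)
  moreover have "((1/2) *\<^sub>R (u + v)) \<bullet> (R *v ((1/2) *\<^sub>R (u + v))) =
      (u \<bullet> (R *v u) + v \<bullet> (R *v v) + 2 * (u \<bullet> (R *v v))) / 4"
    using hermitian_inner[OF psd_hermitian[OF assms], of u v]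
    by (simp only: matrix_vector_scaleR matrix_vector_right_distrib inner_scaleR_left inner_scaleR_right
        inner_add_left inner_add_right) (simp add: field_simps)
  ultimately show ?thesis
    by simp
qed

text \<open>The complex-linear part of a real-linear map, which is therefore given by a
  matrix.\<close>

lemma complex_linear_average:
  fixes f :: "complex^'p \<Rightarrow> complex^'q"
  assumes "linear f"
  obtains M where "\<And>x. M *v x = (1/2) *\<^sub>R (f x + mat (- \<i>) *v f (mat \<i> *v x))"
proof -
  define h where "h x = (1/2) *\<^sub>R (f x + mat (- \<i>) *v f (mat \<i> *v x))" for x
  have add: "h (x + y) = h x + h y" for x y
    by (simp add: h_def linear_add[OF assms] matrix_vector_right_distrib algebra_simps)
  have scale: "h (r *\<^sub>R x) = r *\<^sub>R h x" for r x
    by (simp add: h_def linear_scale[OF assms] matrix_vector_scaleR scaleR_add_right mult.commute)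
  have i: "h (\<i> *s x) = \<i> *s h x" for x
  proof -
    have "f (\<i> *s (\<i> *s x)) = - f x"
      using linear_neg[OF assms, of x] by (simp add: vector_smult_assoc)
    then show ?thesis
      by (simp add: h_def mat_mult_vec vec_eq_iff algebra_simps)
  qed
  have "h (c *s x) = c *s h x" for c x
  proof -
    have "h (c *s x) = h (Re c *\<^sub>R x + Im c *\<^sub>R (\<i> *s x))"
      by (rule arg_cong[of _ _ h]) (simp add: vec_eq_iff complex_eq_iff)
    also have "\<dots> = c *s h x"
      unfolding add scale i by (simp add: vec_eq_iff complex_eq_iff)
    finally show ?thesis .
  qed
  then have "Vector_Spaces.linear (*s) (*s) h"
    by (intro Vector_Spaces.linear.intro module_hom.intro vec.vector_space_axioms
        module_hom_axioms.intro vec.module_axioms add) auto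
  then have "matrix h *v x = h x" for x
    by (rule matrix_works)
  then show ?thesis
    unfolding h_def by (rule that)
qed

context regret_data
begin

abbreviation "NQ \<equiv> L ** (P - U) ** FP\<^sup>\<dagger>"

abbreviation energy :: "complex^'q \<Rightarrow> real" where
  "energy w \<equiv> w \<bullet> (RQi *v w)"

text \<open>The error at time \<open>i\<close> when the anticausal signal \<open>NQ p\<^sub>i\<^sub>+\<^sub>1\<close>, with \<open>p\<close> the costate driven by \<open>\<nu>\<close>,
  is approximated by the causal convolution of \<open>\<nu>\<close> with \<open>c\<close>.\<close>

definition gap :: "(nat \<Rightarrow> complex^'p^'q) \<Rightarrow> (complex^'p) ell2 \<Rightarrow> nat \<Rightarrow> complex^'q" where
  "gap c \<nu> i = (\<Sum>l\<le>i. c l *v \<nu> $$ int (i - l)) - NQ *v costate \<nu> $$ (int i + 1)"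

text \<open>By the equation for \<open>Z\<close>, the first term is the energy of the anticausal
  signal before time 0, where the filter is silent. So the error energy over all times below
  \<open>k\<close> is compared with that of \<nu>; only \<open>c l\<close> with \<open>l < k\<close>
  enter.\<close>

definition admissible :: "nat \<Rightarrow> (nat \<Rightarrow> complex^'p^'q) \<Rightarrow> bool" where
  "admissible k c \<longleftrightarrow> (\<forall>\<nu>. (\<forall>i<0. \<nu> $$ i = 0) \<longrightarrow>
    costate \<nu> $$ 0 \<bullet> (Z *v costate \<nu> $$ 0) + (\<Sum>i<k. energy (gap c \<nu> i)) \<le> \<nu> \<bullet> (RP \<rhd> \<nu>))"

lemma psd_RQi: "psd RQi"
  using posdef_inv[OF posdef_RQ] by (simp add: posdef_def)

lemma Z_step: "p \<bullet> (Z *v p) = (FP\<^sup>\<dagger> *v p) \<bullet> (Z *v (FP\<^sup>\<dagger> *v p)) + energy (NQ *v p)"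
  by (subst (1) Z_eq)
    (simp add: matrix_vector_mult_add_rdistrib inner_add_right inner_matrix_vector cadj_mult
      matrix_vector_mul_assoc matrix_mul_assoc)

lemma costate_nth: "costate \<nu> $$ i = FP\<^sup>\<dagger> *v costate \<nu> $$ (i + 1) + H\<^sup>\<dagger> *v \<nu> $$ i"
  using arg_cong[OF costate[of \<nu>], of "\<lambda>x. x $$ i"] by simp

lemma costate_shift: "costate (shift k \<nu>) = shift k (costate \<nu>)"
  unfolding costate_def shift_pointwise[symmetric]
  by (rule anti_resolvent_shift[OF powers_summable_cadj[OF powers_FP]])

lemma costate_add: "costate (x + y) = costate x + costate y"
  and costate_scaleR: "costate (r *\<^sub>R x) = r *\<^sub>R costate x"
  using bounded_linear.linear[OF bounded_linear_costate] by (simp_all add: linear_add linear_scale)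

lemma costate_mat: "costate (mat c \<rhd> \<nu>) = mat c \<rhd> costate \<nu>"
  unfolding costate_def
proof (rule anti_resolvent_unique[OF powers_summable_cadj[OF powers_FP], symmetric], fold costate_def, rule ell2_eqI)
  fix i
  show "(mat c \<rhd> costate \<nu>) $$ i = (FP\<^sup>\<dagger> \<rhd> shift 1 (mat c \<rhd> costate \<nu>) + H\<^sup>\<dagger> \<rhd> mat c \<rhd> \<nu>) $$ i"
    by (simp add: costate_nth[of \<nu> i] mat_commute matrix_vector_right_distrib)
qed

lemma gap_add: "gap c (x + y) i = gap c x i + gap c y i"
  and gap_scaleR: "gap c (r *\<^sub>R x) i = r *\<^sub>R gap c x i"
  and gap_mat: "gap c (mat z \<rhd> x) i = mat z *v gap c x i"
  by (simp_all add: gap_def costate_add costate_scaleR costate_mat matrix_vector_right_distrib sum.distrib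
      matrix_vector_scaleR scaleR_sum_right scaleR_diff_right mat_commute matrix_vector_mult_sum
      matrix_vector_mult_diff_distrib)

text \<open>The newest coefficient multiplies the value at time 0, so it drops out; the one-step
  extension rests on this.\<close>

lemma gap_Suc:
  assumes "\<nu> $$ 0 = 0"
  shows "gap c \<nu> (Suc i) = gap c (shift 1 \<nu>) i"
proof -
  have "int (Suc i - l) = int (i - l) + 1" if "l \<le> i" for l
    using that by (simp add: Suc_diff_le)
  then have "(\<Sum>l\<le>Suc i. c l *v \<nu> $$ int (Suc i - l)) = (\<Sum>l\<le>i. c l *v \<nu> $$ (int (i - l) + 1))"
    using assms by (simp del: of_nat_Suc of_nat_diff)
  then show ?thesis
    by (simp add: gap_def costate_shift add.commute)
qed

lemma gap_cong: "(\<And>l. l \<le> i \<Longrightarrow> c l = c' l) \<Longrightarrow> gap c \<nu> i = gap c' \<nu> i"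
  by (simp add: gap_def)

text \<open>Contractivity of the Hankel operator: \<nu> is tested against the output of an impulse
  response with amplitude \<open>Z p\<close>, whose energy \<open>ZYZ\<close> bounds by the very
  form to be estimated.\<close>

lemma admissible_0:
  assumes ZYZ: "\<And>x. (Z *v x) \<bullet> (Y *v (Z *v x)) \<le> x \<bullet> (Z *v x)"
  shows "admissible 0 c"
  unfolding admissible_def
proof (intro allI impI)
  fix \<nu> :: "(complex^'p) ell2"
  define p where "p = costate \<nu>"
  define y where "y = Z *v p $$ 0"
  \<comment> \<open>Placed at -1 because a resolvent responds one step later; the pairing then picks
    out the costate at time 0.\<close>
  define z where "z = resolvent FP (single (- 1) y)"
  have "H\<^sup>\<dagger> \<rhd> \<nu> = p - FP\<^sup>\<dagger> \<rhd> shift 1 p"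
    unfolding p_def by (subst (1) costate) simp
  then have "\<nu> \<bullet> (H \<rhd> z) = z \<bullet> (p - FP\<^sup>\<dagger> \<rhd> shift 1 p)"
    by (simp add: inner_commute[of \<nu>] inner_pointwise)
  also have "\<dots> = (shift 1 z - FP \<rhd> z) \<bullet> shift 1 p"
    by (simp add: inner_diff_left inner_diff_right inner_shift inner_pointwise)
  also have "shift 1 z - FP \<rhd> z = single (- 1) y"
    using resolvent[OF powers_FP] by (simp add: z_def)
  finally have s: "\<nu> \<bullet> (H \<rhd> z) = p $$ 0 \<bullet> (Z *v p $$ 0)"
    unfolding inner_single by (simp add: y_def inner_commute)
  have "2 * (\<nu> \<bullet> (H \<rhd> z)) \<le> 1 * (\<nu> \<bullet> (RP \<rhd> \<nu>)) + ((H \<rhd> z) \<bullet> (RPi \<rhd> H \<rhd> z)) / 1"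
    by (rule weighted_young[OF posdef_RP]) simp
  also have "(H \<rhd> z) \<bullet> (RPi \<rhd> H \<rhd> z) = y \<bullet> (Y *v y)"
    unfolding z_def by (rule observability_energy)
  also have "y \<bullet> (Y *v y) \<le> p $$ 0 \<bullet> (Z *v p $$ 0)"
    unfolding y_def by (rule ZYZ)
  finally show "costate \<nu> $$ 0 \<bullet> (Z *v costate \<nu> $$ 0) + (\<Sum>i<0. energy (gap c \<nu> i)) \<le> \<nu> \<bullet> (RP \<rhd> \<nu>)"
    using s by (simp add: p_def)
qed

text \<open>The new coefficient comes from extending the contraction \<open>\<nu> \<mapsto> gap c \<nu> k\<close> off the subspace \<open>\<nu>\<^sub>0 = 0\<close>, where
  it does not depend on that coefficient and is bounded by admissibility applied to the shifted sequence.\<close>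

lemma admissible_Suc:
  assumes adm: "admissible k c"
  shows "\<exists>M. admissible (Suc k) (c(k := M))"
proof -
  define c0 where "c0 = c(k := 0)"
  have c0: "gap (c(k := M)) \<nu> i = gap c \<nu> i" if "i < k" for M \<nu> i
    using that by (intro gap_cong) auto
  let ?W = "window {0..}"
  \<comment> \<open>The slack in \<open>admissible k c\<close>, polarized. The window extends it to
    all of \<open>ell2\<close>, as the extension lemma wants a form on a whole vector space.\<close>
  define b where "b x y = ?W x \<bullet> (RP \<rhd> ?W y) - costate (?W x) $$ 0 \<bullet> (Z *v costate (?W y) $$ 0)
    - (\<Sum>i<k. gap c (?W x) i \<bullet> (RQi *v gap c (?W y) i))" for x y
  define \<zeta> where "\<zeta> x = gap c0 (?W x) k" for x
  define S where "S = {x :: (complex^'p) ell2. x $$ 0 = 0}"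
  have W: "?W (x + y) = ?W x + ?W y" "?W (r *\<^sub>R x) = r *\<^sub>R ?W x" "?W (mat z \<rhd> v) = mat z \<rhd> ?W v" for x y :: "(complex^'p) ell2" and r z v
    by (auto intro!: ell2_eqI)
  have "linear \<zeta>"
    by (rule linearI) (simp_all add: \<zeta>_def W gap_add gap_scaleR)
  have Wstart: "\<forall>i<0. ?W x $$ i = 0" for x :: "(complex^'p) ell2"
    by simp
  have bpos: "0 \<le> b x x" for x
    using adm[unfolded admissible_def, rule_format, OF Wstart[rule_format], of x] by (simp add: b_def)
  have bS: "energy (\<zeta> x) \<le> b x x" if "x \<in> S" for x
  proof -
    define \<nu> where "\<nu> = ?W x"
    define \<nu>' where "\<nu>' = shift 1 \<nu>"
    have \<nu>0: "\<nu> $$ 0 = 0"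
      using that by (simp add: S_def \<nu>_def)
    have start: "\<forall>i<0. \<nu>' $$ i = 0"
    proof (intro allI impI)
      fix i :: int assume "i < 0"
      then show "\<nu>' $$ i = 0"
        using \<nu>0 by (cases "i = - 1") (auto simp: \<nu>'_def \<nu>_def)
    qed
    let ?p = "costate \<nu>' $$ 0"
    have p: "costate \<nu> $$ 0 = FP\<^sup>\<dagger> *v ?p" "gap c0 \<nu> 0 = - (NQ *v ?p)"
      using costate_nth[of \<nu> 0] \<nu>0 by (simp_all add: \<nu>'_def costate_shift gap_def)
    \<comment> \<open>The gap at time 0 is purely anticausal; \<open>Z_step\<close> merges it with
      the \<open>Z\<close> term of \<nu> into that of the shifted sequence.\<close>
    have "(\<Sum>i<k. energy (gap c \<nu> i)) + energy (gap c0 \<nu> k) = (\<Sum>i<Suc k. energy (gap c0 \<nu> i))"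
      by (simp add: c0_def c0)
    also have "\<dots> = energy (NQ *v ?p) + (\<Sum>i<k. energy (gap c \<nu>' i))"
      unfolding sum.lessThan_Suc_shift using gap_Suc[OF \<nu>0, of c0]
      by (simp add: p matrix_vector_uminus \<nu>'_def[symmetric]) (simp add: c0_def c0)
    finally have "costate \<nu> $$ 0 \<bullet> (Z *v costate \<nu> $$ 0) + (\<Sum>i<k. energy (gap c \<nu> i)) + energy (gap c0 \<nu> k)
        = ?p \<bullet> (Z *v ?p) + (\<Sum>i<k. energy (gap c \<nu>' i))"
      using Z_step[of ?p] by (simp add: p)
    also have "\<dots> \<le> \<nu>' \<bullet> (RP \<rhd> \<nu>')"
      using adm start unfolding admissible_def by blast
    also have "\<nu>' \<bullet> (RP \<rhd> \<nu>') = \<nu> \<bullet> (RP \<rhd> \<nu>)"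
      by (simp add: \<nu>'_def shift_pointwise[symmetric] inner_shift)
    finally show ?thesis
      by (simp add: b_def \<zeta>_def \<nu>_def)
  qed
  obtain \<kappa> where \<kappa>: "\<kappa> > 0" "\<And>w. \<kappa> * (norm w)\<^sup>2 \<le> energy w"
    using posdef_coercive[OF posdef_inv[OF posdef_RQ]] by blast
  have cont: "continuous_on UNIV energy"
    by (intro continuous_intros linear_continuous_on[OF bounded_linear_matrix_vector])
  have subS: "subspace S"
    by (rule subspaceI) (auto simp: S_def)
  have sym: "b x y = b y x" for x y
  proof -
    have "gap c (?W x) i \<bullet> (RQi *v gap c (?W y) i) = gap c (?W y) i \<bullet> (RQi *v gap c (?W x) i)" for i
      by (rule hermitian_inner[OF psd_hermitian[OF psd_RQi]])
    then show ?thesis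
      unfolding b_def
      by (simp only: pointwise_inner_commute[OF herm_RP, of "?W x" "?W y"]
          hermitian_inner[OF psd_hermitian[OF psd_Z], of "costate (?W x) $$ 0" "costate (?W y) $$ 0"])
  qed
  have badd: "b (x + y) z = b x z + b y z" for x y z
    by (simp add: b_def W costate_add gap_add inner_add_left sum.distrib)
  have bscale: "b (r *\<^sub>R x) y = r * b x y" for x y r
    by (simp add: b_def W costate_scaleR gap_scaleR sum_distrib_left right_diff_distrib)
  obtain \<zeta>' where \<zeta>': "linear \<zeta>'" "\<And>y. y \<in> S \<Longrightarrow> \<zeta>' y = \<zeta> y" "\<And>x. energy (\<zeta>' x) \<le> b x x"
    using contraction_extension[where b=b and \<zeta>=\<zeta> and S=S and r=energy and k=\<kappa>,
        OF sym badd bscale bpos subS \<open>linear \<zeta>\<close> bS \<kappa> cont] by blast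
  \<comment> \<open>Off \<open>S\<close> only the value at time 0 matters, so the impulse response
    is the new coefficient, up to complex linearity.\<close>
  define g where "g a = \<zeta>' (single 0 a)" for a
  have g: "linear g"
    unfolding g_def using linear_compose[OF bounded_linear.linear[OF bounded_linear_single] \<zeta>'(1)] by (simp add: o_def)
  obtain M where M: "\<And>x. M *v x = (1/2) *\<^sub>R (g x + mat (- \<i>) *v g (mat \<i> *v x))"
    using complex_linear_average[OF g] by blast
  have split: "\<zeta>' x = g (x $$ 0) + \<zeta> x" for x
  proof -
    let ?y = "x - single 0 (x $$ 0)" and ?s = "single 0 (x $$ 0)"
    have "\<zeta> ?s = 0"
    proof -
      have Ws: "?W ?s = ?s"
        by (rule ell2_eqI) simp
      have "costate ?s $$ (int k + 1) = 0"
        unfolding costate_def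
        by (rule anti_resolvent_start[OF powers_summable_cadj[OF powers_FP], of 1]) auto
      moreover have "c0 l *v ?s $$ int (k - l) = 0" if "l \<le> k" for l
        using that by (cases "l = k") (auto simp: c0_def)
      ultimately show ?thesis
        unfolding \<zeta>_def gap_def Ws by (auto intro!: sum.neutral)
    qed
    then have "\<zeta> ?y = \<zeta> x"
      using linear_diff[OF \<open>linear \<zeta>\<close>, of x ?s] by simp
    moreover have "\<zeta>' x = g (x $$ 0) + \<zeta>' ?y"
      using linear_diff[OF \<zeta>'(1), of x ?s] by (simp add: g_def)
    moreover have "?y \<in> S"
      by (simp add: S_def)
    ultimately show ?thesis
      using \<zeta>'(2) by simp
  qed
  define c' where "c' = c(k := M)"
  have "admissible (Suc k) c'"
    unfolding admissible_def
  proof (intro allI impI)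
    fix \<nu> :: "(complex^'p) ell2"
    assume start: "\<forall>i<0. \<nu> $$ i = 0"
    let ?i\<nu> = "mat \<i> \<rhd> \<nu>"
    have W\<nu>: "?W \<nu> = \<nu>"
      using start by (intro window_zero) auto
    have i: "norm \<i> = 1" "norm (- \<i>) = 1"
      by simp_all
    have "mat (- \<i>) *v (mat \<i> *v w) = w" for w :: "complex^'q"
      by (simp add: mat_mult_vec vector_smult_assoc)
    \<comment> \<open>\<zeta> already commutes with complex scalars, so averaging \<zeta>' affects
      only its part \<open>g\<close>.\<close>
    then have "\<zeta> \<nu> = mat (- \<i>) *v \<zeta> ?i\<nu>"
      by (simp add: \<zeta>_def W gap_mat)
    moreover have "gap c' \<nu> k = M *v \<nu> $$ 0 + \<zeta> \<nu>"
    proof -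
      have "(\<Sum>l<k. c0 l *v \<nu> $$ int (k - l)) = (\<Sum>l<k. c l *v \<nu> $$ int (k - l))"
        by (simp add: c0_def)
      then show ?thesis
        by (simp add: \<zeta>_def W\<nu> gap_def lessThan_Suc_atMost[symmetric] c'_def) (simp add: c0_def)
    qed
    moreover have half: "(1/2) *\<^sub>R (x + y) + z = (1/2) *\<^sub>R ((x + z) + (y + z))" for x y z :: "complex^'q"
      by (simp add: vec_eq_iff) (simp add: scaleR_conv_of_real field_simps)
    ultimately have gap: "gap c' \<nu> k = (1/2) *\<^sub>R (\<zeta>' \<nu> + mat (- \<i>) *v \<zeta>' ?i\<nu>)"
      unfolding M split by (simp only: half matrix_vector_right_distrib pointwise.rep_eq)
    have "energy (gap c' \<nu> k) \<le> (energy (\<zeta>' \<nu>) + energy (mat (- \<i>) *v \<zeta>' ?i\<nu>)) / 2"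
      unfolding gap by (rule psd_midpoint[OF psd_RQi])
    also have "\<dots> \<le> (b \<nu> \<nu> + b ?i\<nu> ?i\<nu>) / 2"
      unfolding inner_mat_unit[OF i(2)] using \<zeta>'(3) by (intro divide_right_mono add_mono) auto
    also have "b ?i\<nu> ?i\<nu> = b \<nu> \<nu>"
      by (simp add: b_def W costate_mat gap_mat inner_mat_unit[OF i(1)] inner_mat_unit_pointwise[OF i(1)])
    finally have "energy (gap c' \<nu> k) \<le> b \<nu> \<nu>"
      by (rule order_trans) simp
    moreover have "(\<Sum>i<Suc k. energy (gap c' \<nu> i)) =
        (\<Sum>i<k. energy (gap c \<nu> i)) + energy (gap c' \<nu> k)"
      by (simp add: c'_def c0)
    ultimately show "costate \<nu> $$ 0 \<bullet> (Z *v costate \<nu> $$ 0) + (\<Sum>i<Suc k. energy (gap c' \<nu> i)) \<le> \<nu> \<bullet> (RP \<rhd> \<nu>)"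
      unfolding b_def W\<nu> by linarith
  qed
  then show ?thesis
    unfolding c'_def ..
qed

text \<open>Each step overwrites only the entry at its own index, so the chosen sequences agree on
  ever longer initial segments.\<close>

lemma nehari:
  assumes ZYZ: "\<And>x. (Z *v x) \<bullet> (Y *v (Z *v x)) \<le> x \<bullet> (Z *v x)"
  obtains c where "\<And>k. admissible k c"
proof -
  have "\<exists>C. \<forall>n. admissible n (C n) \<and> (\<exists>M. C (Suc n) = (C n)(n := M))"
    by (rule dependent_nat_choice) (use admissible_0[OF ZYZ] admissible_Suc in blast)+
  then obtain C where C: "\<And>n. admissible n (C n)" "\<And>n. \<exists>M. C (Suc n) = (C n)(n := M)"
    by blast
  have stable: "C (n + m) l = C n l" if "l < n" for n m l
  proof (induction m)
    case (Suc m)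
    then show ?case
      using C(2)[of "n + m"] that by auto
  qed simp
  define c where "c l = C (Suc l) l" for l
  have eq: "C k l = c l" if "l < k" for k l
    using stable[of l "Suc l" "k - Suc l"] that by (simp add: c_def)
  have "gap (C k) \<nu> i = gap c \<nu> i" if "i < k" for k \<nu> i
    using eq that by (intro gap_cong) simp
  then have "admissible k c" for k
    using C(1)[of k] by (simp add: admissible_def)
  then show ?thesis
    using that by blast
qed

end

section \<open>Construction of the estimator\<close>

lemma causal_apply_diag: "N \<le> i \<Longrightarrow> causal_apply N (\<lambda>i j. if i = j then M else 0) y i = M *v y i"
proof -
  assume i: "N \<le> i"
  have "causal_apply N (\<lambda>i j. if i = j then M else 0) y i = (\<Sum>j\<in>{N..i}. if i = j then M *v y j else 0)"
    unfolding causal_apply_def by (intro sum.cong) auto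
  then show ?thesis
    using i by simp
qed

lemma causal_apply_left: "causal_apply N (\<lambda>i j. A ** M i j) y i = A *v causal_apply N M y i"
  by (simp add: causal_apply_def matrix_vector_mult_sum matrix_vector_mul_assoc)

lemma causal_apply_cong: "(\<And>j. N \<le> j \<Longrightarrow> y j = y' j) \<Longrightarrow> causal_apply N M y i = causal_apply N M y' i"
  unfolding causal_apply_def by (intro sum.cong) auto

lemma state_cong: "(\<And>j. N \<le> j \<Longrightarrow> u j = u' j) \<Longrightarrow> state N A u i = state N A u' i"
  unfolding state_def by (intro sum.cong) auto

text \<open>In each coordinate, split a finite sum into its nonnegative and its negative terms; both
  parts are bounded, so convergence is absolute.\<close>

lemma sum_bound_summable:
  fixes x :: "'i \<Rightarrow> 'a::euclidean_space"
  assumes "\<And>J. finite J \<Longrightarrow> norm (\<Sum>j\<in>J. x j) \<le> B"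
  shows "x summable_on UNIV"
proof -
  have "(\<Sum>j\<in>J. norm (x j)) \<le> (\<Sum>b\<in>(Basis::'a set). 2 * B)" if J: "finite J" for J
  proof -
    have b: "(\<Sum>j\<in>J. \<bar>x j \<bullet> b\<bar>) \<le> 2 * B" if b: "b \<in> Basis" for b
    proof -
      have abs: "\<bar>\<Sum>j\<in>I. x j \<bullet> b\<bar> \<le> B" if "finite I" for I
        using Basis_le_norm[OF b, of "\<Sum>j\<in>I. x j"] assms[OF that] by (simp add: inner_sum_left)
      let ?I = "{j \<in> J. 0 \<le> x j \<bullet> b}" and ?I' = "{j \<in> J. \<not> 0 \<le> x j \<bullet> b}"
      have "(\<Sum>j\<in>J. \<bar>x j \<bullet> b\<bar>) = (\<Sum>j\<in>J. if 0 \<le> x j \<bullet> b then x j \<bullet> b else - (x j \<bullet> b))"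
        by (intro sum.cong) auto
      also have "\<dots> = (\<Sum>j\<in>?I. x j \<bullet> b) - (\<Sum>j\<in>?I'. x j \<bullet> b)"
        using J by (simp add: sum.If_cases sum_negf Int_def Collect_conj_eq[symmetric])
      also have "\<dots> \<le> 2 * B"
        using abs[of ?I] abs[of ?I'] J by simp
      finally show ?thesis .
    qed
    have "(\<Sum>j\<in>J. norm (x j)) \<le> (\<Sum>j\<in>J. \<Sum>b\<in>Basis. \<bar>x j \<bullet> b\<bar>)"
      by (intro sum_mono norm_le_l1)
    also have "\<dots> = (\<Sum>b\<in>Basis. \<Sum>j\<in>J. \<bar>x j \<bullet> b\<bar>)"
      by (rule sum.swap)
    also have "\<dots> \<le> (\<Sum>b\<in>(Basis::'a set). 2 * B)"
      by (intro sum_mono b)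
    finally show ?thesis .
  qed
  then have "(\<lambda>j. norm (x j)) summable_on UNIV"
    by (intro nonneg_bdd_above_summable_on) (auto intro!: bdd_aboveI2)
  then show ?thesis
    by (rule abs_summable_summable)
qed

text \<open>Density turns a uniform bound on inputs with a starting time into a bounded operator.
  Rows are summable because every finite truncation has a starting time.\<close>

lemma block_bounded_if_bounded_start:
  fixes M :: "int \<Rightarrow> int \<Rightarrow> complex^'d^'q"
  assumes M: "causal M"
    and b: "\<And>N d. (\<And>j. j < N \<Longrightarrow> d $$ j = 0) \<Longrightarrow>
      \<exists>y. (\<forall>i. y $$ i = block_apply M d i) \<and> norm y \<le> B * norm d"
  shows "block_bounded M"
proof -
  have "\<exists>y. (\<forall>i. y $$ i = block_apply M (single 0 (1 :: complex^'d)) i) \<and>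
      norm y \<le> B * norm (single 0 (1 :: complex^'d))"
    by (rule b[of 0]) simp
  then obtain y :: "(complex^'q) ell2" where "norm y \<le> B * norm (single 0 (1 :: complex^'d))"
    by blast
  then have "0 \<le> B * norm (1 :: complex^'d)"
    using order_trans[OF norm_ge_zero[of y]] by simp
  moreover have "norm (1 :: complex^'d) > 0"
    by (simp add: vec_eq_iff)
  ultimately have B: "0 \<le> B"
    by (simp add: zero_le_mult_iff)
  have sm: "(\<lambda>j. M i j *v d $$ j) summable_on UNIV" for d i
  proof (rule sum_bound_summable)
    fix J :: "int set" assume J: "finite J"
    define N where "N = Min (insert 0 J)"
    have N: "N \<le> j" if "j \<in> J" for j
      using J that by (simp add: N_def)
    let ?d = "window J d"
    have start: "?d $$ j = 0" if "j < N" for j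
      using that N by force
    obtain y where y: "\<forall>i. y $$ i = block_apply M ?d i" "norm y \<le> B * norm ?d"
      using b[OF start] by blast
    have "block_apply M ?d i = (\<Sum>j\<in>{N..i}. M i j *v ?d $$ j)"
      by (rule block_apply_start[OF M start])
    also have "\<dots> = (\<Sum>j\<in>J. M i j *v d $$ j)"
    proof -
      have "(\<Sum>j\<in>{N..i}. M i j *v ?d $$ j) = (\<Sum>j\<in>{N..i} \<inter> J. M i j *v d $$ j)"
        by (rule sum.mono_neutral_cong_right) auto
      also have "\<dots> = (\<Sum>j\<in>J. M i j *v d $$ j)"
      proof (rule sum.mono_neutral_left[OF J])
        show "\<forall>j\<in>J - {N..i} \<inter> J. M i j *v d $$ j = 0"
        proof
          fix j assume "j \<in> J - {N..i} \<inter> J"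
          then have "M i j = 0"
            using M N[of j] by (auto simp: causal_def not_le)
          then show "M i j *v d $$ j = 0"
            by simp
        qed
      qed auto
      finally show ?thesis .
    qed
    finally have "norm (\<Sum>j\<in>J. M i j *v d $$ j) = norm (y $$ i)"
      using y(1) by simp
    also have "\<dots> \<le> B * norm ?d"
      using norm_ell2_nth_le y(2) order_trans by blast
    also have "\<dots> \<le> B * norm d"
      using B norm_window_le by (intro mult_left_mono)
    finally show "norm (\<Sum>j\<in>J. M i j *v d $$ j) \<le> B * norm d" .
  qed
  have lim: "(\<lambda>n. block_apply M (window {- int n..} d) i) \<longlonglongrightarrow> block_apply M d i" for d i
  proof -
    have "(\<lambda>n. \<Sum>j\<in>{- int n..int n}. M i j *v d $$ j) \<longlonglongrightarrow> block_apply M d i"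
      unfolding block_apply_def
      by (rule filterlim_compose[OF infsum_tendsto[OF sm] filterlim_symmetric_intervals])
    moreover have "\<forall>\<^sub>F n in sequentially. (\<Sum>j\<in>{- int n..int n}. M i j *v d $$ j) = block_apply M (window {- int n..} d) i"
    proof (rule eventually_sequentiallyI)
      fix n assume n: "nat \<bar>i\<bar> \<le> n"
      have "block_apply M (window {- int n..} d) i = (\<Sum>j\<in>{- int n..i}. M i j *v window {- int n..} d $$ j)"
        by (rule block_apply_start[OF M]) simp
      also have "\<dots> = (\<Sum>j\<in>{- int n..int n}. M i j *v d $$ j)"
        using n M by (intro sum.mono_neutral_cong_left) (auto simp: causal_def)
      finally show "(\<Sum>j\<in>{- int n..int n}. M i j *v d $$ j) = block_apply M (window {- int n..} d) i" ..
    qed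
    ultimately show ?thesis
      by (rule Lim_transform_eventually)
  qed
  have L2: "L2_set (\<lambda>i. norm (block_apply M d i)) I \<le> B * norm d" if I: "finite I" for I d
  proof (rule LIMSEQ_le_const2)
    show "(\<lambda>n. L2_set (\<lambda>i. norm (block_apply M (window {- int n..} d) i)) I) \<longlonglongrightarrow> L2_set (\<lambda>i. norm (block_apply M d i)) I"
      unfolding L2_set_def by (intro tendsto_intros lim)
    have "L2_set (\<lambda>i. norm (block_apply M (window {- int n..} d) i)) I \<le> B * norm d" for n
    proof -
      have start: "window {- int n..} d $$ j = 0" if "j < - int n" for j
        using that by simp
      obtain y where y: "\<forall>i. y $$ i = block_apply M (window {- int n..} d) i" "norm y \<le> B * norm (window {- int n..} d)"
        using b[OF start] by blast
      have "B * norm (window {- int n..} d) \<le> B * norm d"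
        using B norm_window_le by (intro mult_left_mono)
      then show ?thesis
        using L2_set_ell2_le[OF I, of y] y by simp
    qed
    then show "\<exists>N. \<forall>n\<ge>N. L2_set (\<lambda>i. norm (block_apply M (window {- int n..} d) i)) I \<le> B * norm d"
      by blast
  qed
  have nth: "block_op M d $$ i = block_apply M d i" for d i
    using ell2_of_bounded(1)[OF L2] by (simp add: block_op_def Abs_ell2_inverse)
  have "bounded_linear (block_op M)"
  proof (rule bounded_linear_intro)
    show "block_op M (x + y) = block_op M x + block_op M y" for x y
      by (rule ell2_eqI) (simp add: nth block_apply_def matrix_vector_right_distrib infsum_add[OF sm sm])
    show "block_op M (r *\<^sub>R x) = r *\<^sub>R block_op M x" for r x
      by (rule ell2_eqI) (simp add: nth block_apply_def matrix_vector_scaleR infsum_scaleR_right)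
    show "norm (block_op M x) \<le> norm x * B" for x
    proof -
      obtain y where "\<forall>i. y $$ i = block_apply M x i" "norm y \<le> B * norm x"
        using ell2_of_bounded(2)[OF L2] by blast
      moreover from this have "block_op M x = y"
        by (intro ell2_eqI) (simp add: nth)
      ultimately show ?thesis
        by (simp add: mult.commute)
    qed
  qed
  then show ?thesis
    using sm ell2_of_bounded(1)[OF L2] by (simp add: block_bounded_def)
qed

definition convolution :: "(nat \<Rightarrow> complex^'p^'q) \<Rightarrow> int \<Rightarrow> int \<Rightarrow> complex^'p^'q" where
  "convolution c i j = (if j \<le> i then c (nat (i - j)) else 0)"

lemma causal_apply_convolution:
  "causal_apply N (convolution c) y (N + int k) = (\<Sum>l\<le>k. c l *v y (N + int (k - l)))"
  unfolding causal_apply_def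
  by (rule sum.reindex_bij_witness[where i="\<lambda>l. N + int (k - l)" and j="\<lambda>j. nat (N + int k - j)"])
     (auto simp: convolution_def of_nat_diff)

context regret_data
begin

text \<open>The gain \<open>C\<close> solves \<open>L P p - C \<nu> = (1 + L (S - F\<^sub>W)\<^sup>-\<^sup>1 K\<^sub>Q) (NQ S p - c * \<nu>)\<close>, with \<open>S\<close> the shift and \<open>p\<close> the
  costate of \<open>\<nu>\<close>; by the equation for \<open>U\<close> the anticausal parts cancel.\<close>

definition innovation_gain :: "(nat \<Rightarrow> complex^'p^'q) \<Rightarrow> int \<Rightarrow> int \<Rightarrow> complex^'p^'q" where
  "innovation_gain c i j = (if i = j then L ** (P - U) ** H\<^sup>\<dagger> else 0) + (convolution c i j +
    causal_prod (plant FW (mat 1) L) (\<lambda>i j. KQ ** convolution c i j + (if i = j then - (FW ** U ** H\<^sup>\<dagger>) else 0)) i j)"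

text \<open>\<open>L\<close> times the Kalman prediction plus the gain applied to the normalized
  innovations. \<open>plant FP (- KP)\<close> generates the negative of the prediction, whence the
  signs.\<close>

definition estimator :: "(nat \<Rightarrow> complex^'p^'q) \<Rightarrow> int \<Rightarrow> int \<Rightarrow> complex^'p^'q" where
  "estimator c i j = plant FP (- KP) (- L) i j + causal_prod (innovation_gain c)
    (\<lambda>i j. RPi ** ((if i = j then mat 1 else 0) + plant FP (- KP) H i j)) i j"

lemma causal_estimator: "causal (estimator c)"
  by (simp add: causal_def estimator_def causal_prod_def plant_def)

context
  fixes c :: "nat \<Rightarrow> complex^'p^'q"
  assumes adm: "\<And>k. admissible k c"
begin

text \<open>Admissibility for every \<open>k\<close> controls the errors from \<open>N\<close> on,
  and \<open>Z_step\<close> telescopes those before \<open>N\<close>; all finite sums stay below the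
  energy of \<nu>.\<close>

lemma gap_signal:
  fixes \<nu> :: "(complex^'p) ell2"
  assumes start: "\<And>i. i < N \<Longrightarrow> \<nu> $$ i = 0"
  obtains g where "\<And>i. g $$ i = NQ *v costate \<nu> $$ (i + 1) - causal_apply N (convolution c) (Rep_ell2 \<nu>) i"
    and "g \<bullet> (RQi \<rhd> g) \<le> \<nu> \<bullet> (RP \<rhd> \<nu>)"
proof -
  define e where "e i = NQ *v costate \<nu> $$ (i + 1) - causal_apply N (convolution c) (Rep_ell2 \<nu>) i" for i
  let ?p = "costate \<nu>" and ?s = "shift N \<nu>"
  have pN: "costate ?s $$ j = ?p $$ (N + j)" for j
    by (simp add: costate_shift add.commute)
  have late: "energy (e (N + int i)) = energy (gap c ?s i)" for i
  proof -
    have "gap c ?s i = - e (N + int i)"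
      by (simp add: gap_def e_def causal_apply_convolution pN add_ac)
    then show ?thesis
      by (simp add: matrix_vector_uminus)
  qed
  have early: "(\<Sum>j<m. energy (e (N - 1 - int j))) = ?p $$ N \<bullet> (Z *v ?p $$ N) - ?p $$ (N - int m) \<bullet> (Z *v ?p $$ (N - int m))" for m
  proof (induction m)
    case (Suc m)
    have "e (N - 1 - int m) = NQ *v ?p $$ (N - int m)"
      by (simp add: e_def causal_apply_def)
    moreover have "?p $$ (N - int (Suc m)) = FP\<^sup>\<dagger> *v ?p $$ (N - int m)"
      using costate_nth[of \<nu> "N - int (Suc m)"] start[of "N - int (Suc m)"] by simp
    ultimately show ?case
      using Suc Z_step[of "?p $$ (N - int m)"] by simp
  qed simp
  have nonneg: "0 \<le> energy w" for w
    by (rule psd_nonneg[OF psd_RQi])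
  have bound: "(\<Sum>i\<in>I. energy (e i)) \<le> \<nu> \<bullet> (RP \<rhd> \<nu>)" if I: "finite I" for I
  proof -
    define k where "k = nat (Max (insert 0 ((\<lambda>i. \<bar>i - N\<bar>) ` I))) + 1"
    have "I \<subseteq> (\<lambda>j. N - 1 - int j) ` {..<k} \<union> (\<lambda>i. N + int i) ` {..<k}"
    proof
      fix i assume "i \<in> I"
      then have "\<bar>i - N\<bar> \<le> Max (insert 0 ((\<lambda>i. \<bar>i - N\<bar>) ` I))"
        using I by (intro Max_ge) auto
      moreover have "0 \<le> Max (insert 0 ((\<lambda>i. \<bar>i - N\<bar>) ` I))"
        using I by (intro Max_ge) auto
      ultimately have "\<bar>i - N\<bar> < int k"
        by (simp add: k_def)
      then show "i \<in> (\<lambda>j. N - 1 - int j) ` {..<k} \<union> (\<lambda>i. N + int i) ` {..<k}"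
      proof (cases "N \<le> i")
        case True
        with \<open>\<bar>i - N\<bar> < int k\<close> have "i = N + int (nat (i - N))" "nat (i - N) < k"
          by auto
        then show ?thesis by blast
      next
        case False
        with \<open>\<bar>i - N\<bar> < int k\<close> have "i = N - 1 - int (nat (N - 1 - i))" "nat (N - 1 - i) < k"
          by auto
        then show ?thesis by blast
      qed
    qed
    then have "(\<Sum>i\<in>I. energy (e i)) \<le> (\<Sum>i\<in>(\<lambda>j. N - 1 - int j) ` {..<k} \<union> (\<lambda>i. N + int i) ` {..<k}. energy (e i))"
      using nonneg by (intro sum_mono2) auto
    also have "\<dots> = (\<Sum>j<k. energy (e (N - 1 - int j))) + (\<Sum>i<k. energy (gap c ?s i))"
      by (subst sum.union_disjoint) (auto simp: sum.reindex inj_on_def late)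
    \<comment> \<open>Telescoping leaves a nonnegative \<open>Z\<close> term at time
      \<open>N - k\<close>, which is dropped.\<close>
    also have "\<dots> \<le> costate ?s $$ 0 \<bullet> (Z *v costate ?s $$ 0) + (\<Sum>i<k. energy (gap c ?s i))"
      using psd_nonneg[OF psd_Z] unfolding early pN by simp
    also have "\<dots> \<le> ?s \<bullet> (RP \<rhd> ?s)"
      using adm[of k] start unfolding admissible_def by simp
    finally show ?thesis
      by (simp add: shift_pointwise[symmetric] inner_shift)
  qed
  obtain \<kappa> where \<kappa>: "\<kappa> > 0" "\<And>w. \<kappa> * (norm w)\<^sup>2 \<le> energy w"
    using posdef_coercive[OF posdef_inv[OF posdef_RQ]] by blast
  have "L2_set (\<lambda>i. norm (e i)) I \<le> sqrt ((\<nu> \<bullet> (RP \<rhd> \<nu>)) / \<kappa>)" if "finite I" for I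
  proof -
    have "\<kappa> * (\<Sum>i\<in>I. (norm (e i))\<^sup>2) \<le> (\<Sum>i\<in>I. energy (e i))"
      unfolding sum_distrib_left by (intro sum_mono \<kappa>)
    then have "(\<Sum>i\<in>I. (norm (e i))\<^sup>2) \<le> (\<nu> \<bullet> (RP \<rhd> \<nu>)) / \<kappa>"
      using bound[OF that] \<kappa>(1) by (simp add: field_simps)
    then show ?thesis
      by (simp add: L2_set_def)
  qed
  from ell2_of_bounded(2)[OF this] obtain g where g: "\<And>i. g $$ i = e i"
    by blast
  have "g \<bullet> (RQi \<rhd> g) \<le> \<nu> \<bullet> (RP \<rhd> \<nu>)"
    using bound by (intro has_sum_le_finite_sums[OF inner_ell2_has_sum]) (simp add: g)
  with g show ?thesis
    using that[of g] by (simp add: e_def)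
qed

text \<open>Neither \<open>U p\<close> nor \<open>th\<close> is causal, but by \<open>U_step\<close>
  their anticausal driving terms coincide. The difference \<open>chi\<close> is driven by \<nu> and
  its causal filter alone.\<close>

lemma innovation_gain_apply:
  fixes \<nu> :: "(complex^'p) ell2"
  assumes start: "\<And>i. i < N \<Longrightarrow> \<nu> $$ i = 0"
    and g: "\<And>i. g $$ i = NQ *v costate \<nu> $$ (i + 1) - causal_apply N (convolution c) (Rep_ell2 \<nu>) i"
  defines "th \<equiv> resolvent FW (KQ \<rhd> g)"
  shows "causal_apply N (innovation_gain c) (Rep_ell2 \<nu>) i = (L \<rhd> P \<rhd> costate \<nu> - (g + L \<rhd> th)) $$ i"
proof -
  let ?p = "costate \<nu>"
  define D where "D = causal_apply N (convolution c) (Rep_ell2 \<nu>)"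
  define chi where "chi = U \<rhd> ?p - th"
  define u where "u i = KQ *v D i + (- (FW ** U ** H\<^sup>\<dagger>)) *v \<nu> $$ i" for i
  have D0: "D i = 0" if "i < N" for i
    using that by (simp add: D_def causal_apply_def)
  have FPp: "FP\<^sup>\<dagger> *v ?p $$ (i + 1) = ?p $$ i - H\<^sup>\<dagger> *v \<nu> $$ i" for i
    using costate_nth[of \<nu> i] by simp
  have gi: "g $$ i = NQ *v ?p $$ (i + 1) - D i" for i
    using g by (simp add: D_def)
  have chi: "chi $$ (i + 1) = FW *v chi $$ i + u i" for i
  proof -
    have "U *v ?p $$ (i + 1) = KQ *v (NQ *v ?p $$ (i + 1)) + (FW ** U) *v (FP\<^sup>\<dagger> *v ?p $$ (i + 1))"
      by (subst U_step) (simp add: matrix_add_rdistrib' matrix_vector_mult_add_rdistrib matrix_vector_mul_assoc matrix_mul_assoc)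
    moreover have "th $$ (i + 1) = FW *v th $$ i + KQ *v g $$ i"
      unfolding th_def using resolvent_nth_Suc[OF powers_FW] by simp
    ultimately show ?thesis
      by (simp add: chi_def FPp gi u_def matrix_vector_mult_diff_distrib matrix_vector_uminus matrix_vector_mul_assoc
          matrix_vector_mult_diff_rdistrib matrix_mul_assoc)
  qed
  \<comment> \<open>Before \<open>N\<close> the recursion is homogeneous, so a bounded
    \<open>chi\<close> starts at rest; the causal realization rests on this.\<close>
  have chi0: "chi $$ i = 0" if "i \<le> N" for i
  proof (rule half_line_zero[OF powers_FW norm_ell2_nth_le _ that])
    show "chi $$ (j + 1) = FW *v chi $$ j" if "j < N" for j
      using that by (simp add: chi u_def D0 start)
  qed
  have state: "chi $$ i = state N FW u i" for i
    by (rule state_unique) (simp_all add: chi0 chi)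
  have "causal_apply N (innovation_gain c) (Rep_ell2 \<nu>) i = (L ** (P - U) ** H\<^sup>\<dagger>) *v \<nu> $$ i + (D i + L *v chi $$ i)"
  proof (cases "N \<le> i")
    case True
    have inner: "causal_apply N (\<lambda>i j. KQ ** convolution c i j + (if i = j then - (FW ** U ** H\<^sup>\<dagger>) else 0)) (Rep_ell2 \<nu>) k = u k"
      if "N \<le> k" for k
      unfolding causal_apply_add causal_apply_left causal_apply_diag[OF that] u_def D_def ..
    have "causal_apply N (causal_prod (plant FW (mat 1) L)
        (\<lambda>i j. KQ ** convolution c i j + (if i = j then - (FW ** U ** H\<^sup>\<dagger>) else 0))) (Rep_ell2 \<nu>) i = L *v chi $$ i"
      unfolding causal_apply_prod causal_apply_plant state
      by (intro arg_cong[of _ _ "(*v) L"] state_cong) (simp add: inner)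
    then show ?thesis
      unfolding innovation_gain_def causal_apply_add causal_apply_diag[OF True] D_def by simp
  next
    case False
    then show ?thesis
      using start[of i] D0[of i] chi0[of i] by (simp add: causal_apply_def)
  qed
  also have "\<dots> = (L \<rhd> P \<rhd> costate \<nu> - (g + L \<rhd> th)) $$ i"
    by (simp add: chi_def gi matrix_vector_mult_diff_distrib matrix_vector_mult_diff_rdistrib
        matrix_vector_mul_assoc[symmetric] FPp)
  finally show ?thesis .
qed

text \<open>Prediction leaves \<open>L\<close> times the prediction error, and the gain subtracts
  \<open>L P p\<close> up to the filtered Nehari error. Prediction error minus \<open>P p\<close> is
  the smoothing error.\<close>

lemma estimator_error:
  assumes start: "\<And>j. j < N \<Longrightarrow> d $$ j = 0"
  defines "\<nu> \<equiv> RPi \<rhd> innovation d"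
  obtains g where "g \<bullet> (RQi \<rhd> g) \<le> \<nu> \<bullet> (RP \<rhd> \<nu>)"
    "\<And>i. block_apply (error_matrix F G H L (estimator c)) d i =
      (L \<rhd> smoother d + (g + L \<rhd> resolvent FW (KQ \<rhd> g))) $$ i"
proof -
  define x where "x = state N F (\<lambda>i. G *v (inl_row *v d $$ i))"
  define y where "y = (\<lambda>k. H *v x k + inr_row *v d $$ k)"
  \<comment> \<open>The negative of the Kalman prediction, computed from the measurements
    alone.\<close>
  define q where "q = state N FP (\<lambda>i. (- KP) *v y i)"
  have pred0: "predictor d $$ i = 0" if "i \<le> N" for i
    unfolding predictor_def using start that by (intro resolvent_start[OF powers_FP, of N]) auto
  have q: "predictor d $$ i = x i + q i" for i
  proof -
    have "predictor d $$ i - x i = q i" for i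
      unfolding q_def
    proof (rule state_unique)
      fix i assume "N \<le> i"
      then have "x (i + 1) = F *v x i + G *v (inl_row *v d $$ i)"
        by (simp add: x_def state_Suc)
      then show "predictor d $$ (i + 1) - x (i + 1) = FP *v (predictor d $$ i - x i) + (- KP) *v y i"
        using arg_cong[OF predictor[of d], of "\<lambda>x. x $$ i"]
        by (simp add: y_def F_P_def matrix_vector_mult_diff_distrib matrix_vector_mult_diff_rdistrib
            matrix_vector_right_distrib matrix_vector_uminus matrix_vector_mul_assoc matrix_mult_uminus_left)
    qed (simp add: pred0 x_def state_start)
    then show ?thesis
      by (simp add: algebra_simps)
  qed
  have \<nu>i: "\<nu> $$ i = RPi *v (y i + H *v q i)" for i
    by (simp add: \<nu>_def innovation_def q y_def matrix_vector_right_distrib add_ac)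
  have \<nu>0: "\<nu> $$ i = 0" if "i < N" for i
    using that start by (simp add: \<nu>_def innovation_def pred0)
  have filter: "causal_apply N (\<lambda>i j. RPi ** ((if i = j then mat 1 else 0) + plant FP (- KP) H i j)) y i = \<nu> $$ i"
    if "N \<le> i" for i
    unfolding causal_apply_left causal_apply_add causal_apply_diag[OF that] causal_apply_plant \<nu>i q_def by simp
  obtain g where g: "\<And>i. g $$ i = NQ *v costate \<nu> $$ (i + 1) - causal_apply N (convolution c) (Rep_ell2 \<nu>) i"
    "g \<bullet> (RQi \<rhd> g) \<le> \<nu> \<bullet> (RP \<rhd> \<nu>)"
    using gap_signal[OF \<nu>0] by blast
  have "block_apply (error_matrix F G H L (estimator c)) d i =
      (L \<rhd> smoother d + (g + L \<rhd> resolvent FW (KQ \<rhd> g))) $$ i" for i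
  proof -
    have gain: "causal_apply N (innovation_gain c) (Rep_ell2 \<nu>) i =
        (L \<rhd> P \<rhd> costate \<nu> - (g + L \<rhd> resolvent FW (KQ \<rhd> g))) $$ i"
      by (rule innovation_gain_apply[OF \<nu>0 g(1)])
    have "block_apply (error_matrix F G H L (estimator c)) d i = L *v x i - causal_apply N (estimator c) y i"
      unfolding x_def y_def by (rule error_matrix_apply[OF causal_estimator start])
    also have "causal_apply N (estimator c) y i = - (L *v q i) + causal_apply N (innovation_gain c) (Rep_ell2 \<nu>) i"
      unfolding estimator_def causal_apply_add causal_apply_plant causal_apply_prod
      using causal_apply_cong[OF filter, where i=i and M="innovation_gain c"] by (simp add: q_def matrix_vector_uminus)
    also have "L *v x i - \<dots> = (L \<rhd> smoother d + (g + L \<rhd> resolvent FW (KQ \<rhd> g))) $$ i"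
      unfolding gain
      by (simp add: smoother_def \<nu>_def[symmetric] q matrix_vector_mult_diff_distrib matrix_vector_right_distrib)
    finally show ?thesis .
  qed
  with g(2) that show ?thesis
    by blast
qed

text \<open>\<open>bounded_real\<close> is applied with both signs of the smoothing error: one gives
  the upper bound, the parallelogram law turns the other into the lower bound.\<close>

lemma smoother_perturbation_bound:
  fixes d :: "(complex^('m + 'p)) ell2"
  defines "\<nu> \<equiv> RPi \<rhd> innovation d"
  assumes g: "g \<bullet> (RQi \<rhd> g) \<le> \<nu> \<bullet> (RP \<rhd> \<nu>)"
  shows "\<bar>(norm (L \<rhd> smoother d + (g + L \<rhd> resolvent FW (KQ \<rhd> g))))\<^sup>2 - (norm (L \<rhd> smoother d))\<^sup>2\<bar> \<le> \<gamma>\<^sup>2 * (norm d)\<^sup>2"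
proof -
  obtain w v where null: "output_null w v (smoother d)"
    and nd: "(norm d)\<^sup>2 = (norm w)\<^sup>2 + (norm v)\<^sup>2 + \<nu> \<bullet> (RP \<rhd> \<nu>)"
    using decomposition[of d] unfolding \<nu>_def by metis
  let ?x = "smoother d" and ?th = "resolvent FW (KQ \<rhd> g)"
  let ?f = "g + L \<rhd> ?th"
  define om where "om = w + KW \<rhd> ?x"
  have x: "shift 1 ?x = FW \<rhd> ?x + G \<rhd> om"
    using output_null_regulator(1)[OF null] by (simp add: om_def)
  have "\<gamma>\<^sup>2 * (om \<bullet> (RW \<rhd> om) + g \<bullet> (RQi \<rhd> g)) \<le> \<gamma>\<^sup>2 * ((norm d)\<^sup>2 + (norm (L \<rhd> ?x))\<^sup>2 / \<gamma>\<^sup>2)"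
    using g output_null_regulator(2)[OF null] nd by (intro mult_left_mono) (auto simp: om_def)
  then have bnd: "\<gamma>\<^sup>2 * (om \<bullet> (RW \<rhd> om) + g \<bullet> (RQi \<rhd> g)) \<le> \<gamma>\<^sup>2 * (norm d)\<^sup>2 + (norm (L \<rhd> ?x))\<^sup>2"
    using \<gamma> by (simp add: distrib_left)
  have "shift 1 (?x + ?th) = FW \<rhd> (?x + ?th) + G \<rhd> om + KQ \<rhd> g"
    by (simp add: shift_add x resolvent[OF powers_FW] pointwise_add)
  from bounded_real[OF this] bnd
  have 1: "(norm (L \<rhd> ?x + ?f))\<^sup>2 \<le> \<gamma>\<^sup>2 * (norm d)\<^sup>2 + (norm (L \<rhd> ?x))\<^sup>2"
    by (simp add: pointwise_add add_ac)
  have "shift 1 (?th - ?x) = FW \<rhd> (?th - ?x) + G \<rhd> (- om) + KQ \<rhd> g"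
    by (simp add: shift_diff x resolvent[OF powers_FW] pointwise_diff pointwise_minus)
  from bounded_real[OF this] bnd
  have 2: "(norm (?f - L \<rhd> ?x))\<^sup>2 \<le> \<gamma>\<^sup>2 * (norm d)\<^sup>2 + (norm (L \<rhd> ?x))\<^sup>2"
    by (simp add: pointwise_diff pointwise_minus algebra_simps)
  have "(norm (L \<rhd> ?x + ?f))\<^sup>2 + (norm (?f - L \<rhd> ?x))\<^sup>2 = 2 * (norm (L \<rhd> ?x))\<^sup>2 + 2 * (norm ?f)\<^sup>2"
    by (simp add: power2_norm_eq_inner inner_add_left inner_add_right inner_diff_left inner_diff_right inner_commute)
  then show ?thesis
    using 1 2 zero_le_power2[of "norm ?f"] by linarith
qed

lemma estimator_gamma_optimal: "gamma_optimal F G H L \<gamma> (estimator c)"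
proof -
  let ?E = "error_matrix F G H L (estimator c)"
  have T0: "bounded_linear (\<lambda>d. L \<rhd> smoother d)"
    by (rule bounded_linear_compose[OF bounded_linear_pointwise bounded_linear_smoother])
  obtain B where B: "\<And>d. norm (L \<rhd> smoother d) \<le> norm d * B" "0 < B"
    using bounded_linear.pos_bounded[OF T0] by blast
  have cE: "causal ?E"
    by (rule causal_error_matrix[OF causal_estimator])
  have start: "\<exists>y. (\<forall>i. y $$ i = block_apply ?E d i) \<and>
      \<bar>(norm y)\<^sup>2 - (norm (L \<rhd> smoother d))\<^sup>2\<bar> \<le> \<gamma>\<^sup>2 * (norm d)\<^sup>2"
    if d: "\<And>j. j < N \<Longrightarrow> d $$ j = 0" for N d
  proof (rule estimator_error[OF d])
    fix g
    assume "g \<bullet> (RQi \<rhd> g) \<le> (RPi \<rhd> innovation d) \<bullet> (RP \<rhd> RPi \<rhd> innovation d)"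
      "\<And>i. block_apply ?E d i = (L \<rhd> smoother d + (g + L \<rhd> resolvent FW (KQ \<rhd> g))) $$ i"
    then show ?thesis
      using smoother_perturbation_bound[of g d]
      by (intro exI[of _ "L \<rhd> smoother d + (g + L \<rhd> resolvent FW (KQ \<rhd> g))"]) simp
  qed
  have bE: "block_bounded ?E"
  \<comment> \<open>The constant comes from
    \<open>\<gamma>\<^sup>2 + B\<^sup>2 \<le> (\<gamma> + B)\<^sup>2\<close>.\<close>
  proof (rule block_bounded_if_bounded_start[OF cE, where B="\<gamma> + B"])
    fix N and d :: "(complex^('m + 'p)) ell2"
    assume "\<And>j. j < N \<Longrightarrow> d $$ j = 0"
    from start[OF this] obtain y where y: "\<forall>i. y $$ i = block_apply ?E d i"
      "\<bar>(norm y)\<^sup>2 - (norm (L \<rhd> smoother d))\<^sup>2\<bar> \<le> \<gamma>\<^sup>2 * (norm d)\<^sup>2"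
      by blast
    have "(norm (L \<rhd> smoother d))\<^sup>2 \<le> (norm d * B)\<^sup>2"
      using B by (intro power_mono) auto
    then have "(norm y)\<^sup>2 \<le> (\<gamma>\<^sup>2 + B\<^sup>2) * (norm d)\<^sup>2"
      using y(2) by (simp add: power_mult_distrib algebra_simps)
    also have "\<dots> \<le> (\<gamma> + B)\<^sup>2 * (norm d)\<^sup>2"
      using \<gamma> B(2) by (intro mult_right_mono) (auto simp: power2_sum)
    finally have "norm y \<le> (\<gamma> + B) * norm d"
      using \<gamma> B(2) power2_le_imp_le[of "norm y" "(\<gamma> + B) * norm d"] by (simp add: power_mult_distrib)
    then show "\<exists>y. (\<forall>i. y $$ i = block_apply ?E d i) \<and> norm y \<le> (\<gamma> + B) * norm d"
      using y(1) by blast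
  qed
  have T: "bounded_linear (block_op ?E)"
    using bE by (simp add: block_bounded_def)
  have quad: "\<bar>(norm (block_op ?E d))\<^sup>2 - (norm (L \<rhd> smoother d))\<^sup>2\<bar> \<le> \<gamma>\<^sup>2 * (norm d)\<^sup>2" for d
  proof (rule LIMSEQ_le)
    let ?w = "\<lambda>n. window {- int n..} d"
    have lim: "(\<lambda>n. f (?w n)) \<longlonglongrightarrow> f d" if "bounded_linear f" for f :: "_ \<Rightarrow> (complex^'q) ell2"
      by (rule bounded_linear.tendsto[OF that window_tendsto])
    show "(\<lambda>n. \<bar>(norm (block_op ?E (?w n)))\<^sup>2 - (norm (L \<rhd> smoother (?w n)))\<^sup>2\<bar>)
        \<longlonglongrightarrow> \<bar>(norm (block_op ?E d))\<^sup>2 - (norm (L \<rhd> smoother d))\<^sup>2\<bar>"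
      by (intro tendsto_intros lim[OF T] lim[OF T0])
    show "(\<lambda>n. \<gamma>\<^sup>2 * (norm (?w n))\<^sup>2) \<longlonglongrightarrow> \<gamma>\<^sup>2 * (norm d)\<^sup>2"
      by (intro tendsto_intros window_tendsto)
    have "\<bar>(norm (block_op ?E (?w n)))\<^sup>2 - (norm (L \<rhd> smoother (?w n)))\<^sup>2\<bar> \<le> \<gamma>\<^sup>2 * (norm (?w n))\<^sup>2" for n
    proof -
      have "?w n $$ j = 0" if "j < - int n" for j
        using that by simp
      from start[OF this] obtain y where y: "\<forall>i. y $$ i = block_apply ?E (?w n) i"
        "\<bar>(norm y)\<^sup>2 - (norm (L \<rhd> smoother (?w n)))\<^sup>2\<bar> \<le> \<gamma>\<^sup>2 * (norm (?w n))\<^sup>2"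
        by blast
      have "block_op ?E (?w n) = y"
        using y(1) by (intro ell2_eqI) (simp add: block_op_nth[OF bE])
      then show ?thesis
        using y(2) by simp
    qed
    then show "\<exists>N. \<forall>n\<ge>N. \<bar>(norm (block_op ?E (?w n)))\<^sup>2 - (norm (L \<rhd> smoother (?w n)))\<^sup>2\<bar> \<le> \<gamma>\<^sup>2 * (norm (?w n))\<^sup>2"
      by blast
  qed
  have "regret_operator F G H L (estimator c) = (\<lambda>d. adjoint (block_op ?E) (block_op ?E d) -
      adjoint (\<lambda>d. L \<rhd> smoother d) (L \<rhd> smoother d))"
    by (simp add: regret_operator_def Let_def block_op_noncausal)
  then have "onorm (regret_operator F G H L (estimator c)) \<le> \<gamma>\<^sup>2"
    using onorm_gram_difference_le_iff[OF T T0, of "\<gamma>\<^sup>2"] quad by simp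
  then show ?thesis
    using bE causal_estimator by (simp add: gamma_optimal_def)
qed

end

text \<open>One eigenvalue \<open>t\<close> with \<open>Z Y Z \<le> t Z\<close> makes
  \<open>lambda_max\<close> well defined and, once at most 1, supplies the inequality for
  \<open>nehari\<close>; necessity bounds all real eigenvalues.\<close>

lemma exists_gamma_optimal_iff: "(\<exists>K. gamma_optimal F G H L \<gamma> K) \<longleftrightarrow> lambda_max (Z ** Y) \<le> 1"
proof -
  obtain t where t: "eigenval (Z ** Y) (complex_of_real t)"
    "\<And>x. (Z *v x) \<bullet> (Y *v (Z *v x)) \<le> t * (x \<bullet> (Z *v x))"
    using psd_product_eigenval[OF psd_Z psd_Y] by blast
  show ?thesis
    unfolding lambda_max_le_iff[OF t(1)]
  proof
    assume "\<exists>K. gamma_optimal F G H L \<gamma> K"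
    then show "\<forall>s. eigenval (Z ** Y) (complex_of_real s) \<longrightarrow> s \<le> 1"
      using necessity_eigenval by (auto simp: gamma_optimal_def)
  next
    assume "\<forall>s. eigenval (Z ** Y) (complex_of_real s) \<longrightarrow> s \<le> 1"
    then have "t \<le> 1"
      using t(1) by blast
    then have "(Z *v x) \<bullet> (Y *v (Z *v x)) \<le> x \<bullet> (Z *v x)" for x
      using t(2)[of x] mult_right_mono[of t 1 "x \<bullet> (Z *v x)"] psd_nonneg[OF psd_Z, of x] by simp
    then obtain c where "\<And>k. admissible k c"
      using nehari by blast
    then show "\<exists>K. gamma_optimal F G H L \<gamma> K"
      using estimator_gamma_optimal by blast
  qed
qed

end

theorem theorem6:
  fixes F :: "complex^'n^'n" and G :: "complex^'m^'n"
    and H :: "complex^'n^'p" and L :: "complex^'n^'q"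
    and P W Q U \<Pi>\<^sub>P Z\<^sub>\<gamma> :: "complex^'n^'n" and \<gamma> :: real
  assumes "detectable F H"
    and "controllable_on_circle F G"
    and "\<gamma> > 0"
    and "stabilizing_P F G H P"
    and "stabilizing_W F G H L \<gamma> W"
    and "stabilizing_Q F G L \<gamma> W Q"
    and "U = K_Q F G L \<gamma> W Q ** L ** P ** (F_P F H P)\<^sup>\<dagger>
             + F_Q F G L \<gamma> W Q ** U ** (F_P F H P)\<^sup>\<dagger>"
    and "\<Pi>\<^sub>P = (F_P F H P)\<^sup>\<dagger> ** \<Pi>\<^sub>P ** F_P F H P
             + H\<^sup>\<dagger> ** matrix_inv (R_P H P) ** H"
    and "Z\<^sub>\<gamma> = F_P F H P ** Z\<^sub>\<gamma> ** (F_P F H P)\<^sup>\<dagger>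
             + F_P F H P ** (P - U)\<^sup>\<dagger> ** L\<^sup>\<dagger> ** matrix_inv (R_Q L \<gamma> Q) ** L ** (P - U) ** (F_P F H P)\<^sup>\<dagger>"
  shows "(\<exists>K :: int \<Rightarrow> int \<Rightarrow> complex^'p^'q. gamma_optimal F G H L \<gamma> K)
         \<longleftrightarrow> lambda_max (Z\<^sub>\<gamma> ** \<Pi>\<^sub>P) \<le> 1"
proof -
  interpret regret_data F G H L P W Q U \<Pi>\<^sub>P Z\<^sub>\<gamma> \<gamma>
    by (rule regret_data.intro) fact+
  show ?thesis
    by (rule exists_gamma_optimal_iff)
qed

end
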